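(* Let $A=\{1<2<3<\cdots\}$ and $\bar A=\{\bar1<\bar2<\cdots\}$, totally ordered so that every element of $\bar A$ exceeds every element of $A$. Let $\beta\leq_c\alpha$ be compositions, $\tau_o$ an SSRCT of shape $\alpha/\!\!/\beta$ with entries in $A$, $\bar\tau$ an SSRCT of straight shape $\beta$ with entries in $\bar A$, and $\tau$ the SSRCT of straight shape $\alpha$ obtained by filling the inner shape of $\tau_o$ according to $\bar\tau$. Let $i\geq1$ be such that $\widetilde\alpha$ has an addable node in column $i$, let $T=\rho(\tau)$, and let $j$ be the greatest integer with $1\leq j\leq i-1$ such that the entry moving horizontally from column $j$ to column $j+1$ during the computation of $\mathrm{jdt}_i(T)$ belongs to $\bar A$ ($j=0$ if there is none). Let $\gamma=\mu_i(\tau)$. Then the entries of $\gamma$ belonging to $\bar A$ form an SSRCT of shape $u_{j+1}(\beta)/\!\!/(1)$, and the entries of $\gamma$ belonging to $A$ form an SSRCT of shape $u_i(\alpha)/\!\!/u_{j+1}(\beta)$, which is independent of the choice of $\bar\tau$.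
   Context: All fillings take values in a totally ordered alphabet. Compositions are drawn as reverse composition diagrams: row $r$ from the top has $\alpha_r$ left-justified boxes; $\widetilde\alpha$ is the sorted partition. Define $\alpha\lessdot_c\beta$ iff $\beta=(1,\alpha_1,\ldots,\alpha_l)$ or $\beta$ is obtained by adding $1$ to a part $\alpha_k$ with $\alpha_s\neq\alpha_k$ for all $s<k$; $\leq_c$ is the reflexive transitive closure. For $\beta\leq_c\alpha$, $\alpha/\!\!/\beta$ is $\alpha$ with the boxes of $\beta$ removed, $\beta$ placed left-justified in the last $l(\beta)$ rows of $\alpha$. An SSRCT of shape $\alpha/\!\!/\beta$ is a filling of $\alpha/\!\!/\beta$ with rows weakly decreasing left to right, first-column entries strictly increasing top to bottom, and for rows $r<s$ and column $c$ with $(s,c+1)\in\alpha/\!\!/\beta$: if $(r,c)\in\beta$ or $\tau(r,c)\geq\tau(s,c+1)$ then $(r,c+1)\in\beta$ or both $(r,c+1)\in\alpha/\!\!/\beta$ and $\tau(r,c+1)>\tau(s,c+1)$. SSRTs (French convention, rows bottom to top): fillings of a partition weakly decreasing along rows, strictly decreasing up columns. $\rho(\tau)$ sorts each column of $\tau$ decreasingly from bottom to top, bottom-justified. $\mathrm{jdt}_i(T)$: starting from the addable node in column $i$, the empty box $(p,q)$ is filled from whichever of $(p-1,q),(p,q-1)$ holds the smaller entry (ties to $(p-1,q)$), until the empty box is $(1,1)$. Operators: $\mathfrak{d}_t(\alpha)$ subtracts $1$ from the rightmost part equal to $t$ (omitting a $0$; $0$ if none); $\mathfrak{v}_{[t-1]}=\mathfrak{d}_1\cdots\mathfrak{d}_{t-1}$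 ($\mathfrak{d}_{t-1}$ first; $\mathfrak{v}_{[0]}=\mathrm{id}$); $a_t$ appends a part $t$; $u_t=a_t\mathfrak{v}_{[t-1]}$. $\phi_{t+1}$ ($t\geq1$) on an SSRCT $\tau$ of straight shape with a part equal to $t$ (entries outside the shape count as $0$, smaller than all letters): $r_1$ is the largest row index of a part equal to $t$; for $m\geq2$, $r_m$ is the largest $r<r_{m-1}$ with $\tau(r,t)>\tau(r_{m-1},t)\geq\tau(r,t+1)$, ending at $r_k$; $\phi_{t+1}(\tau)$ places, for $m=k,\ldots,2$, the original $\tau(r_{m-1},t)$ into $(r_m,t)$ and deletes box $(r_1,t)$ (and its row if empty); $\tau(r_k,t)$ exits. $\mu_i(\tau)$: if $i=1$, $\tau'=\tau$, $H=\varnothing$; else $\tau'=\phi_2(\cdots\phi_i(\tau)\cdots)$ and $H$ the multiset of the $i-1$ exiting entries; with $\tau'$ of shape $(\gamma_1,\ldots,\gamma_s)$, $\mu_i(\tau)$ is the filling of $(\gamma_1,\ldots,\gamma_s,i)/\!\!/(1)$ with first $s$ rows $\tau'$ and last row an empty first box followed by $H$ in decreasing order. "The entries in $\bar A$ form an SSRCT of shape $X/\!\!/(1)$" and "the entries in $A$ form an SSRCT of shape $Y/\!\!/X$" mean that the boxes with entries in $\bar A$ together with the empty box form the diagram $X$ placed as an inner shape, and the remaining boxes form $Y/\!\!/X$. *)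

theory Defs
  imports Main "HOL-Library.Option_ord"
begin

datatype letter = Unb nat | Bar nat

instantiation letter :: linorder
begin
fun less_eq_letter :: "letter \<Rightarrow> letter \<Rightarrow> bool" where
  "less_eq_letter (Unb a) (Unb b) = (a \<le> b)"
| "less_eq_letter (Unb a) (Bar b) = True"
| "less_eq_letter (Bar a) (Unb b) = False"
| "less_eq_letter (Bar a) (Bar b) = (a \<le> b)"
definition less_letter :: "letter \<Rightarrow> letter \<Rightarrow> bool" where
  "less_letter x y \<longleftrightarrow> x \<le> y \<and> \<not> y \<le> x"
instance
proof
  fix x y z :: letter
  show "(x < y) = (x \<le> y \<and> \<not> y \<le> x)" by (simp add: less_letter_def)
  show "x \<le> x" by (cases x) auto
  show "x \<le> y \<Longrightarrow> y \<le> z \<Longrightarrow> x \<le> z"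
    by (cases x; cases y; cases z) auto
  show "x \<le> y \<Longrightarrow> y \<le> x \<Longrightarrow> x = y"
    by (cases x; cases y) auto
  show "x \<le> y \<or> y \<le> x" by (cases x; cases y) auto
qed
end

definition inA :: "letter \<Rightarrow> bool" where
  "inA x \<longleftrightarrow> (\<exists>n\<ge>1. x = Unb n)"

definition inAbar :: "letter \<Rightarrow> bool" where
  "inAbar x \<longleftrightarrow> (\<exists>n\<ge>1. x = Bar n)"

text \<open>A composition is a list of positive naturals; row r (1-based, from the top)
  has alpha!(r-1) boxes; boxes are pairs (row, column), both 1-based.\<close>

definition is_comp :: "nat list \<Rightarrow> bool" where
  "is_comp \<alpha> \<longleftrightarrow> (\<forall>x\<in>set \<alpha>. 0 < x)"

definition diag :: "nat list \<Rightarrow> (nat \<times> nat) set" where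
  "diag \<alpha> = {(r, c). 1 \<le> r \<and> r \<le> length \<alpha> \<and> 1 \<le> c \<and> c \<le> \<alpha> ! (r - 1)}"

definition cover_c :: "nat list \<Rightarrow> nat list \<Rightarrow> bool" where
  "cover_c \<alpha> \<beta> \<longleftrightarrow> \<beta> = 1 # \<alpha> \<or>
     (\<exists>k < length \<alpha>. \<beta> = \<alpha>[k := \<alpha> ! k + 1] \<and> (\<forall>s < k. \<alpha> ! s \<noteq> \<alpha> ! k))"

definition leq_c :: "nat list \<Rightarrow> nat list \<Rightarrow> bool" where
  "leq_c = cover_c\<^sup>*\<^sup>*"

definition inner :: "nat list \<Rightarrow> nat list \<Rightarrow> (nat \<times> nat) set" where
  "inner \<alpha> \<beta> = {(r, c). length \<alpha> - length \<beta> < r \<and> r \<le> length \<alpha> \<and> 1 \<le> c \<and>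
                     c \<le> \<beta> ! (r - (length \<alpha> - length \<beta>) - 1)}"

definition skew :: "nat list \<Rightarrow> nat list \<Rightarrow> (nat \<times> nat) set" where
  "skew \<alpha> \<beta> = diag \<alpha> - inner \<alpha> \<beta>"

type_synonym 'a filling = "nat \<times> nat \<Rightarrow> 'a option"

definition ssrct :: "nat list \<Rightarrow> nat list \<Rightarrow> ('a::linorder) filling \<Rightarrow> bool" where
  "ssrct \<alpha> \<beta> \<tau> \<longleftrightarrow> dom \<tau> = skew \<alpha> \<beta> \<and>
    (\<forall>r c c'. (r, c) \<in> skew \<alpha> \<beta> \<and> (r, c') \<in> skew \<alpha> \<beta> \<and> c < c'
        \<longrightarrow> the (\<tau> (r, c')) \<le> the (\<tau> (r, c))) \<and>
    (\<forall>r s. r < s \<and> (r, 1) \<in> skew \<alpha> \<beta> \<and> (s, 1) \<in> skew \<alpha> \<beta>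
        \<longrightarrow> the (\<tau> (r, 1)) < the (\<tau> (s, 1))) \<and>
    (\<forall>r s c. r < s \<and> 1 \<le> c \<and> (s, c + 1) \<in> skew \<alpha> \<beta> \<and>
        ((r, c) \<in> inner \<alpha> \<beta> \<or> ((r, c) \<in> skew \<alpha> \<beta> \<and> the (\<tau> (r, c)) \<ge> the (\<tau> (s, c + 1))))
        \<longrightarrow> ((r, c + 1) \<in> inner \<alpha> \<beta> \<or>
             ((r, c + 1) \<in> skew \<alpha> \<beta> \<and> the (\<tau> (r, c + 1)) > the (\<tau> (s, c + 1)))))"

definition filt :: "('a \<Rightarrow> bool) \<Rightarrow> 'a filling \<Rightarrow> 'a filling" where
  "filt P \<tau> = (\<lambda>b. case \<tau> b of None \<Rightarrow> None | Some x \<Rightarrow> if P x then Some x else None)"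

definition combine :: "nat list \<Rightarrow> nat list \<Rightarrow> 'a filling \<Rightarrow> 'a filling \<Rightarrow> 'a filling" where
  "combine \<alpha> \<beta> \<tau>o \<tau>b = (\<lambda>(r, c). if (r, c) \<in> inner \<alpha> \<beta>
       then \<tau>b (r - (length \<alpha> - length \<beta>), c) else \<tau>o (r, c))"

definition lastrows :: "nat \<Rightarrow> nat \<Rightarrow> 'a filling \<Rightarrow> 'a filling" where
  "lastrows n m \<tau> = (\<lambda>(r, c). if 1 \<le> r then \<tau> (r + (n - m), c) else None)"

definition psort :: "nat list \<Rightarrow> nat list" where
  "psort \<alpha> = rev (sort \<alpha>)"

text \<open>For a partition lambda, diag lambda is its French diagram: row p counted from the bottom.\<close>
definition addable :: "(nat \<times> nat) set \<Rightarrow> nat \<times> nat \<Rightarrow> bool" where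
  "addable D b \<longleftrightarrow> (case b of (p, q) \<Rightarrow> 1 \<le> p \<and> 1 \<le> q \<and> (p, q) \<notin> D \<and>
       (p = 1 \<or> (p - 1, q) \<in> D) \<and> (q = 1 \<or> (p, q - 1) \<in> D))"

definition rho :: "nat list \<Rightarrow> ('a::linorder) filling \<Rightarrow> 'a filling" where
  "rho \<alpha> \<tau> = (\<lambda>(p, c). let xs = rev (sort [the (\<tau> (r, c)). r \<leftarrow> [1..<length \<alpha> + 1], (r, c) \<in> dom \<tau>])
       in if 1 \<le> c \<and> 1 \<le> p \<and> p \<le> length xs then Some (xs ! (p - 1)) else None)"

text \<open>The sequence of moves (from box, to box) of jdt starting with the empty box (p,q).\<close>
function jpath :: "('a::linorder) filling \<Rightarrow> nat \<Rightarrow> nat \<Rightarrow> ((nat \<times> nat) \<times> (nat \<times> nat)) list" where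
  "jpath T p q =
    (if p \<le> 1 \<and> q \<le> 1 then []
     else if p \<le> 1 then ((p, q - 1), (p, q)) # jpath T p (q - 1)
     else if q \<le> 1 then ((p - 1, q), (p, q)) # jpath T (p - 1) q
     else if the (T (p, q - 1)) < the (T (p - 1, q))
       then ((p, q - 1), (p, q)) # jpath T p (q - 1)
       else ((p - 1, q), (p, q)) # jpath T (p - 1) q)"
  by pat_completeness auto
termination by (relation "measure (\<lambda>(T, p, q). p + q)") auto

text \<open>j: the greatest 1 \<le> j \<le> i-1 such that the entry moving horizontally from column j
  to column j+1 in jdt_i(T) lies in Abar (0 if none); (p,i) is the addable node.\<close>
definition jval :: "letter filling \<Rightarrow> nat \<Rightarrow> nat \<Rightarrow> nat" where
  "jval T p i = Max ({0} \<union> {b. 1 \<le> b \<and> b \<le> i - 1 \<and>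
      (\<exists>a. ((a, b), (a, b + 1)) \<in> set (jpath T p i) \<and> inAbar (the (T (a, b))))})"

section \<open>Operators on compositions (None encodes the result 0)\<close>

definition dop :: "nat \<Rightarrow> nat list \<Rightarrow> nat list option" where
  "dop t \<alpha> = (if t \<in> set \<alpha> then
      (let k = Max {k. k < length \<alpha> \<and> \<alpha> ! k = t} in
       Some (if t = 1 then take k \<alpha> @ drop (k + 1) \<alpha> else \<alpha>[k := t - 1]))
     else None)"

fun vop :: "nat \<Rightarrow> nat list \<Rightarrow> nat list option" where
  "vop 0 \<alpha> = Some \<alpha>"
| "vop (Suc n) \<alpha> = Option.bind (dop (Suc n) \<alpha>) (vop n)"

definition uop :: "nat \<Rightarrow> nat list \<Rightarrow> nat list option" where
  "uop t \<alpha> = map_option (\<lambda>\<gamma>. \<gamma> @ [t]) (vop (t - 1) \<alpha>)"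

text \<open>The rows r_1 > r_2 > ... > r_k (entries outside the shape are None, below all letters).\<close>
fun rchain :: "('a::linorder) filling \<Rightarrow> nat \<Rightarrow> nat \<Rightarrow> nat \<Rightarrow> nat list" where
  "rchain \<tau> t 0 r = [r]"
| "rchain \<tau> t (Suc n) r =
    (let S = {r'. 1 \<le> r' \<and> r' < r \<and> \<tau> (r', t) > \<tau> (r, t) \<and> \<tau> (r, t) \<ge> \<tau> (r', t + 1)}
     in if S = {} then [r] else r # rchain \<tau> t n (Max S))"

text \<open>phi t = phi_{t+1}: returns new shape, new filling and the exiting entry.\<close>
definition phi :: "nat \<Rightarrow> nat list \<times> ('a::linorder) filling \<Rightarrow> nat list \<times> 'a filling \<times> 'a" where
  "phi t st = (case st of (\<gamma>, \<tau>) \<Rightarrow>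
     (let r1 = Max {r. 1 \<le> r \<and> r \<le> length \<gamma> \<and> \<gamma> ! (r - 1) = t};
          rs = rchain \<tau> t r1 r1;
          \<tau>1 = (\<lambda>(r, c). if c = t \<and> r = r1 then None
                 else if c = t \<and> (\<exists>m. 1 \<le> m \<and> m < length rs \<and> rs ! m = r)
                 then \<tau> (rs ! ((THE m. 1 \<le> m \<and> m < length rs \<and> rs ! m = r) - 1), t)
                 else \<tau> (r, c));
          \<tau>2 = (if t = 1 then (\<lambda>(r, c). if r < r1 then \<tau>1 (r, c) else \<tau>1 (r + 1, c)) else \<tau>1);
          \<gamma>2 = (if t = 1 then take (r1 - 1) \<gamma> @ drop r1 \<gamma> else \<gamma>[r1 - 1 := t - 1])
      in (\<gamma>2, \<tau>2, the (\<tau> (last rs, t)))))"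

fun phiseq :: "nat \<Rightarrow> nat list \<times> ('a::linorder) filling \<Rightarrow> (nat list \<times> 'a filling) \<times> 'a list" where
  "phiseq 0 st = (st, [])"
| "phiseq (Suc t) st = (case phi (Suc t) st of (\<gamma>1, \<tau>1, x) \<Rightarrow>
      (case phiseq t (\<gamma>1, \<tau>1) of (st2, H) \<Rightarrow> (st2, x # H)))"

text \<open>mu_i: returns the outer shape (gamma_1,...,gamma_s,i) and the filling of
  (gamma_1,...,gamma_s,i)//(1).\<close>
definition mu :: "nat \<Rightarrow> nat list \<Rightarrow> ('a::linorder) filling \<Rightarrow> nat list \<times> 'a filling" where
  "mu i \<alpha> \<tau> = (case phiseq (i - 1) (\<alpha>, \<tau>) of ((\<gamma>, \<tau>'), H) \<Rightarrow>
     (let Hs = rev (sort H); s = length \<gamma> in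
      (\<gamma> @ [i], \<lambda>(r, c). if r \<le> s then \<tau>' (r, c)
                  else if r = s + 1 \<and> 2 \<le> c \<and> c \<le> i then Some (Hs ! (c - 2)) else None)))"

end

theory Submission
  imports Defs
begin

text \<open>A slide only affects the column \<open>t\<close> and depends only on the columns \<open>t\<close> and \<open>t + 1\<close>: scanning the
  rows upwards from the lowest row of length \<open>t\<close>, one carries a value \<open>K\<close> that is exchanged with each
  entry that is larger and whose right neighbour is at most \<open>K\<close>; the value left over is the exiting
  entry \<open>x\<close>. The triple rule gives three things: the result is again a tableau; after the slide every
  entry \<open>\<ge> x\<close> of column \<open>t\<close> has a right neighbour \<open>> x\<close>, so that the exiting entries can be appended
  as a new row; and the boxes with letters in an up-closed set lose either nothing or one box,
  at the end of their lowest row of length \<open>t\<close>, according to whether \<open>x\<close> is outside or in this set.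

  Counting the entries larger than \<open>x\<close> in adjacent columns shows that the exiting entries increase
  weakly from column \<open>i - 1\<close> to column \<open>1\<close> and are the entries that jeu de taquin moves
  horizontally. Hence exactly the last \<open>j\<close> slides act on the barred letters, as slides of the inner
  tableau. The unbarred letters see the barred ones only through their positions.\<close>

section \<open>Sliding a single column\<close>

text \<open>The rows of a slide are defined by jumping to the next maximum. Scanning all rows
  instead makes each step a comparison of the carried value with two entries of one row. The carried
  value only grows on the way up, so it enters an up-closed set of letters at most once; this single
  crossing is the row where the subshape of large letters loses its box.

  The link with jeu de taquin has to survive \<open>rho\<close>, which sorts the columns and forgets
  the rows. What survives is, for each letter \<open>y\<close>, the number of entries above
  \<open>y\<close> in a column. The condition on right neighbours of entries \<open>\<ge> x\<close>
  passes to these numbers. Together with the row condition, before and after all slides, it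
  determines the path: the exit of column \<open>t\<close> sits in the sorted column just above all
  larger entries, and in that row the path turns left.

  Sortedness of the exits has to precede the shape of the large letters: it makes the slides that
  expel large letters those of the columns \<open>J, ..., 1\<close>, which is what
  \<open>vop J\<close> performs on the inner shape.\<close>

locale column_slide =
  fixes f g K :: "nat \<Rightarrow> 'a::linorder option" and r1 :: nat
  assumes r1_pos: "1 \<le> r1" and f_r1: "f r1 \<noteq> None" and g_r1: "g r1 = None"
    and K_start: "K (r1 - 1) = f r1"
    and K_step: "Suc r < r1 \<Longrightarrow> K r = (if K (Suc r) < f (Suc r) \<and> g (Suc r) \<le> K (Suc r)
                                       then f (Suc r) else K (Suc r))"
    and g_le_f: "g r \<le> f r"
    and triple: "r < s \<Longrightarrow> g s \<noteq> None \<Longrightarrow> g s \<le> f r \<Longrightarrow> g s < g r"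
    and inj: "f r = f s \<Longrightarrow> f r \<noteq> None \<Longrightarrow> r = s"
    and lowest: "r1 < r \<Longrightarrow> f r \<noteq> None \<Longrightarrow> g r \<noteq> None"
begin

text \<open>Read \<open>f\<close> and \<open>g\<close> as the columns \<open>t\<close> and
  \<open>t + 1\<close>, and \<open>K r\<close> as the value carried on arrival at row
  \<open>r\<close>, when the rows from \<open>r1\<close> up to \<open>r + 1\<close> have been
  handled; so \<open>K 0\<close> exits. The assumption \<open>lowest\<close> records that
  \<open>r1\<close> is the last row of length exactly \<open>t\<close>.\<close>

definition bump :: "nat \<Rightarrow> bool" where
  "bump r \<longleftrightarrow> 1 \<le> r \<and> r < r1 \<and> K r < f r \<and> g r \<le> K r"

definition new :: "nat \<Rightarrow> 'a option" where
  "new r = (if r = r1 then None else if bump r then K r else f r)"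

section \<open>Growth and origin of the carried value\<close>

lemma K_bump: "bump r \<Longrightarrow> K (r - 1) = f r"
  unfolding bump_def using K_step[of "r - 1"] by auto

lemma K_not_bump: "r < r1 \<Longrightarrow> 1 \<le> r \<Longrightarrow> \<not> bump r \<Longrightarrow> K (r - 1) = K r"
  unfolding bump_def using K_step[of "r - 1"] by auto

lemma K_antimono: "r \<le> s \<Longrightarrow> s < r1 \<Longrightarrow> K s \<le> K r"
proof (induction r rule: inc_induct)
  case (step n)
  have "K (Suc n) \<le> K n" using K_step[of n] step by auto
  then show ?case using step by auto
qed simp

text \<open>Traces a carried value back to the row where it was picked up, strictly below row
  \<open>r\<close>. As an entry of the original column it is subject to the rules for that
  column.\<close>

lemma K_attained:
  assumes "r < r1"
  shows "\<exists>q>r. q \<le> r1 \<and> f q = K r \<and> (q = r1 \<or> bump q)"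
proof -
  have "r \<le> r1 - 1" using assms by simp
  then show ?thesis
  proof (induction r rule: inc_induct)
    case (step n)
    then have n: "Suc n < r1" by simp
    show ?case
    proof (cases "bump (Suc n)")
      case True
      then show ?thesis using K_bump[of "Suc n"] n by (intro exI[of _ "Suc n"]) auto
    next
      case False
      then have "K n = K (Suc n)" using K_not_bump[of "Suc n"] n by simp
      then show ?thesis using step n by (metis Suc_lessD)
    qed
  qed (use r1_pos K_start in auto)
qed

lemma K_Some: "r < r1 \<Longrightarrow> K r \<noteq> None"
proof -
  assume r: "r < r1"
  then have "f r1 \<le> K r" using K_antimono[of r "r1 - 1"] K_start by auto
  then show ?thesis using f_r1 by (cases "K r"; cases "f r1") auto
qed

lemma bump_ne_r1: "bump r \<Longrightarrow> r \<noteq> r1"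
  by (auto simp: bump_def)

text \<open>To overtake \<open>g q\<close>, the carried value would have to be replaced by some
  \<open>f (Suc m) \<ge> g q\<close>. The triple rule then puts \<open>g (Suc m)\<close> above
  \<open>g q\<close>, hence above the carried value, and this blocks the exchange.\<close>

lemma K_less_stays:
  assumes "K n < g q" "m \<le> n" "n < q" "n < r1"
  shows "K m < g q"
  using assms(2,1,3,4)
proof (induction m rule: inc_induct)
  case (step m)
  show ?case
  proof (cases "bump (Suc m)")
    case True
    have gq: "g q \<noteq> None" using step by (cases "g q") auto
    have "\<not> g q \<le> f (Suc m)"
    proof
      assume "g q \<le> f (Suc m)"
      then have "g q < g (Suc m)" using triple[of "Suc m" q] gq step by auto
      then show False using True step unfolding bump_def by auto
    qed
    then show ?thesis using K_bump[OF True] by auto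
  next
    case False
    then show ?thesis using K_not_bump[of "Suc m"] step by auto
  qed
qed auto

text \<open>A larger entry that is not exchanged is blocked by its right neighbour, and
  \<open>K_less_stays\<close> keeps the carried value below that neighbour all the way up.\<close>

lemma above_not_bump:
  assumes "r < r1" "\<not> bump r" "K r < f r" "m \<le> r" "1 \<le> r"
  shows "K m < g r"
proof -
  have "K r < g r" using assms unfolding bump_def by auto
  then show ?thesis
    using K_less_stays[of "r - 1" r m] K_not_bump[of r] assms by (cases "m = r") auto
qed

text \<open>Row \<open>r1\<close> stops at column \<open>t\<close>, so the triple rule for
  \<open>r1\<close> and a longer row below it forces \<open>f r1 < g r\<close>. The scan starts
  below \<open>g r\<close> and stays there.\<close>

lemma above_below:
  assumes "r1 < r" "f r \<noteq> None" "m < r1"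
  shows "K m < g r"
proof -
  have gr: "g r \<noteq> None" using lowest assms by auto
  have "\<not> g r \<le> f r1" using triple[of r1 r] gr g_r1 assms by auto
  then show ?thesis using K_less_stays[of "r1 - 1" r m] K_start assms by auto
qed

lemma new_le: "new r \<le> f r"
  unfolding new_def bump_def by auto

lemma g_le_new: "g r \<le> new r"
  unfolding new_def using g_r1 g_le_f[of r] by (auto simp: bump_def)

text \<open>If \<open>g r\<close> did not exceed the exit, row \<open>r\<close> would lie above
  \<open>r1\<close>, would not be bumped (a bumped row keeps a value smaller than the exit) and
  would not be blocked. Then \<open>f r = K r = K 0\<close>, and this value occurs again further
  down, a repetition in the column.\<close>

lemma exit_rule:
  assumes "K 0 \<le> new r" "1 \<le> r"
  shows "K 0 < g r"
proof (rule ccontr)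
  assume neg: "\<not> K 0 < g r"
  have K0: "K 0 \<noteq> None" using K_Some[of 0] r1_pos by auto
  have rr: "r \<noteq> r1" using assms K0 by (auto simp: new_def)
  have fr: "f r \<noteq> None" using assms K0 new_le[of r] by (cases "f r"; cases "K 0"; cases "new r") auto
  have lt: "r < r1" using above_below[of r 0] fr r1_pos rr neg by force
  have nb: "\<not> bump r"
  proof
    assume b: "bump r"
    then have "K r < K (r - 1)" using K_bump by (auto simp: bump_def)
    moreover have "K (r - 1) \<le> K 0" using K_antimono[of 0 "r - 1"] lt by auto
    ultimately show False using assms b rr by (auto simp: new_def)
  qed
  then have K0f: "K 0 \<le> f r" using assms rr by (auto simp: new_def)
  have "\<not> K r < f r" using above_not_bump[of r 0] nb lt assms neg by auto
  then have "f r = K r" "f r = K 0" using K0f K_antimono[of 0 r] lt by auto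
  then obtain q where "r < q" "f q = f r" using K_attained[of r] lt by auto
  then show False using inj[of q r] fr by auto
qed

text \<open>Here \<open>e\<close> is the column to the left of \<open>f\<close>. A bumped lower row
  holds an entry from further down, to which the original rule applies; the delicate case is an
  upper row whose entry has decreased.\<close>

lemma new_triple:
  assumes ef: "\<And>r s. r < s \<Longrightarrow> f s \<noteq> None \<Longrightarrow> f s \<le> e r \<Longrightarrow> f s < f r"
    and rs: "1 \<le> r" "r < s" and ns: "new s \<noteq> None" and le: "new s \<le> e r"
  shows "new s < new r"
proof (cases "bump s")
  case True
  then have s: "s < r1" "new s = K s" by (auto simp: bump_def new_def)
  obtain q where q: "s < q" "f q = K s" using K_attained s by blast
  have fr: "K s < f r" using ef[of r q] q rs le s K_Some[of s] by auto
  show ?thesis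
  proof (cases "bump r")
    case b: True
    have "K (s - 1) \<le> K r" using K_antimono[of r "s - 1"] s rs by auto
    then show ?thesis using K_bump[OF True] True b s by (auto simp: bump_def new_def)
  next
    case False
    then show ?thesis using fr s rs by (auto simp: new_def)
  qed
next
  case False
  then have s: "s \<noteq> r1" "new s = f s" using ns by (auto simp: new_def split: if_splits)
  have fr: "f s < f r" using ef[of r s] rs le s ns by auto
  show ?thesis
  proof (cases "r = r1 \<or> bump r")
    case True
    \<comment> \<open>With the carried value below \<open>g s\<close>, the triple rule for
      \<open>f\<close> and \<open>g\<close> would give \<open>g s < g r\<close>, whereas an
      exchanged row has \<open>g r \<le> K (r - 1)\<close>. This excludes both reasons for which row
      \<open>s\<close> could keep an entry above the carried value: lying below \<open>r1\<close>,
      or being blocked.\<close>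
    have no: "\<not> K m < g s" if "m = r - 1" for m
    proof
      assume "K m < g s"
      then have gs: "K (r - 1) < g s" "g s \<noteq> None" using that by (cases "g s"; auto)+
      then have "g s < g r" using triple[of r s] rs fr g_le_f[of s] by auto
      moreover have "g r \<le> K (r - 1)"
        using True K_bump[of r] g_r1 g_le_f[of r] K_start by auto
      ultimately show False using gs by auto
    qed
    have "s < r1"
    proof (rule ccontr)
      assume "\<not> s < r1"
      then have "K (r - 1) < g s" using above_below[of s "r - 1"] s ns rs True
        by (auto simp: bump_def)
      then show False using no by auto
    qed
    then have b: "bump r" and rr: "r \<noteq> r1" using True rs by auto
    have "f s \<le> K s"
      using above_not_bump[of s "r - 1"] no s False \<open>s < r1\<close> rs by (meson diff_le_self le_trans less_imp_le not_le order.strict_trans2)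
    also have "\<dots> \<le> K r" using K_antimono[of r s] \<open>s < r1\<close> rs by auto
    finally have 1: "f s \<le> K r" .
    have "f s \<noteq> K r"
    proof
      assume eq: "f s = K r"
      obtain q where "f q = K r" "q = r1 \<or> bump q" using K_attained[of r] b by (auto simp: bump_def)
      then have "q = s" using inj[of q s] eq s ns by auto
      then show False using False s \<open>q = r1 \<or> bump q\<close> by auto
    qed
    then show ?thesis using 1 b rr s by (auto simp: new_def)
  next
    case False
    then show ?thesis using fr s by (auto simp: new_def)
  qed
qed

section \<open>The set of entries of the changed column\<close>

lemma K_dropped: "n < r1 \<Longrightarrow> K n = K 0 \<or> (\<exists>q. bump q \<and> q \<le> n \<and> K q = K n)"
proof (induction n)
  case (Suc n)
  show ?case
  proof (cases "bump (Suc n)")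
    case False
    then have "K n = K (Suc n)" using Suc K_not_bump[of "Suc n"] by auto
    then show ?thesis using Suc by (metis Suc_lessD le_SucI)
  qed auto
qed auto

lemma new_ne_exit: "1 \<le> r \<Longrightarrow> new r \<noteq> K 0"
proof
  assume r: "1 \<le> r" and eq: "new r = K 0"
  then have *: "K 0 < g r" using exit_rule by auto
  then show False using g_le_new[of r] eq by auto
qed

text \<open>Values only move up the column: whatever is picked up is dropped at a later bump or
  exits. By \<open>new_ne_exit\<close> the exit does not also remain in some row.\<close>

lemma new_values:
  assumes "f 0 = None"
  shows "{x. \<exists>r. new r = Some x} = {x. \<exists>r. f r = Some x} - {the (K 0)}"
proof -
  have K0: "K 0 = Some (the (K 0))" using K_Some[of 0] r1_pos by auto
  have new0: "new 0 = None" using assms r1_pos by (auto simp: new_def bump_def)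
  have "\<exists>r. f r = Some x \<and> x \<noteq> the (K 0)" if "new r = Some x" for r x
  proof -
    have "1 \<le> r" using that new0 by (cases r) auto
    then have "x \<noteq> the (K 0)" using new_ne_exit[of r] that K0 by auto
    moreover have "\<exists>r. f r = Some x"
      using that K_attained[of r] by (auto simp: new_def bump_def split: if_splits)
    ultimately show ?thesis by auto
  qed
  moreover have "\<exists>r. new r = Some x" if "f r = Some x" "x \<noteq> the (K 0)" for r x
  proof (cases "r = r1 \<or> bump r")
    case True
    then have r: "1 \<le> r" "r \<le> r1" "K (r - 1) = f r" using r1_pos K_start K_bump
      by (auto simp: bump_def)
    then have "K (r - 1) \<noteq> K 0" using that K0 by (metis option.sel)
    moreover have "r - 1 < r1" using r by simp
    ultimately obtain q where "bump q" "K q = f r" using K_dropped[of "r - 1"] r by metis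
    then have "new q = Some x" using that bump_ne_r1 by (auto simp: new_def)
    then show ?thesis by blast
  next
    case False
    then have "new r = Some x" using that by (auto simp: new_def)
    then show ?thesis by blast
  qed
  ultimately show ?thesis by fastforce
qed

end

section \<open>Large letters under a slide\<close>

definition holds :: "('a \<Rightarrow> bool) \<Rightarrow> 'a option \<Rightarrow> bool" where
  "holds P u \<longleftrightarrow> (\<exists>x. u = Some x \<and> P x)"

definition upclosed :: "('a::linorder \<Rightarrow> bool) \<Rightarrow> bool" where
  "upclosed P \<longleftrightarrow> (\<forall>x y. P x \<longrightarrow> x \<le> y \<longrightarrow> P y)"

lemma holds_simps [simp]: "holds P (Some x) = P x" "\<not> holds P None"
  by (auto simp: holds_def)

lemma holds_mono: "upclosed P \<Longrightarrow> holds P u \<Longrightarrow> u \<le> v \<Longrightarrow> holds P v"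
  by (cases u; cases v) (auto simp: upclosed_def)

context column_slide
begin

text \<open>The exit is the largest value ever carried. If it lies outside the set, so does every
  exchanged entry, before and after.\<close>

lemma holds_new_unchanged:
  assumes P: "upclosed P" and ex: "\<not> holds P (K 0)"
  shows "holds P (new r) \<longleftrightarrow> holds P (f r)"
proof -
  have K: "\<not> holds P (K m)" if "m < r1" for m
    using holds_mono[OF P _ K_antimono[of 0 m]] ex that by auto
  show ?thesis
  proof (cases "r = r1 \<or> bump r")
    case True
    have "f r = K (r - 1)" using True K_start K_bump by auto
    moreover have "r - 1 < r1" using True r1_pos by (auto simp: bump_def)
    ultimately have "\<not> holds P (f r)" using K by auto
    then show ?thesis using holds_mono[OF P _ new_le] by blast
  qed (auto simp: new_def)
qed

lemma holds_new_one_row: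
  assumes P: "upclosed P" and ex: "holds P (K 0)"
  obtains q where "1 \<le> q" "q \<le> r1" "holds P (f q)" "\<not> holds P (new q)"
    "\<And>r. r \<noteq> q \<Longrightarrow> holds P (new r) = holds P (f r)"
    "\<And>r. holds P (f r) \<Longrightarrow> \<not> holds P (g r) \<Longrightarrow> r \<le> q"
proof -
  \<comment> \<open>The threshold of the growing carried value: it is large on arrival at the rows
    above \<open>q\<close> and not large from \<open>q\<close> downwards, so row \<open>q\<close>
    supplies the first large value. The disjunct \<open>n \<ge> r1\<close> covers a large starting
    value, where \<open>q = r1\<close>.\<close>
  define q where "q = (LEAST n. n \<ge> r1 \<or> \<not> holds P (K n))"
  have q: "q \<ge> r1 \<or> \<not> holds P (K q)" unfolding q_def by (rule LeastI[of _ r1]) simp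
  have below_q: "n < r1 \<and> holds P (K n)" if "n < q" for n
    using not_less_Least[of n "\<lambda>n. n \<ge> r1 \<or> \<not> holds P (K n)"] that unfolding q_def by auto
  have "q \<le> r1" unfolding q_def by (rule Least_le) simp
  have "1 \<le> q" using q ex r1_pos by (cases q) auto
  have not_K: "\<not> holds P (K m)" if "q \<le> m" "m < r1" for m
    using q holds_mono[OF P _ K_antimono[of q m]] that by auto
  have prev: "holds P (K (q - 1))" using below_q[of "q - 1"] \<open>1 \<le> q\<close> by auto
  have q_cases: "q = r1 \<or> bump q"
  proof (rule ccontr)
    assume n: "\<not> (q = r1 \<or> bump q)"
    then have "K (q - 1) = K q" using K_not_bump[of q] \<open>1 \<le> q\<close> \<open>q \<le> r1\<close> by auto
    then show False using prev q n \<open>q \<le> r1\<close> by auto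
  qed
  have fq: "f q = K (q - 1)" using q_cases K_start K_bump by auto
  show thesis
  proof (rule that[of q])
    show "1 \<le> q" "q \<le> r1" by fact+
    show "holds P (f q)" using fq prev by simp
    show "\<not> holds P (new q)"
      using q_cases not_K[of q] by (auto simp: new_def bump_def)
    show "holds P (new r) = holds P (f r)" if "r \<noteq> q" for r
    proof (cases "r = r1 \<or> bump r")
      case True
      show ?thesis
      proof (cases "r < q")
        case True
        then have "bump r" "r \<noteq> r1" using \<open>r = r1 \<or> bump r\<close> \<open>q \<le> r1\<close> by auto
        then have "holds P (new r)" using below_q[OF True] by (auto simp: new_def)
        then show ?thesis using holds_mono[OF P _ new_le] by blast
      next
        case False
        then have r: "q \<le> r - 1" "r \<le> r1" using that True by (auto simp: bump_def)
        have "f r = K (r - 1)" using True K_start K_bump by auto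
        then have "\<not> holds P (f r)" using not_K[of "r - 1"] r \<open>1 \<le> q\<close> by auto
        then show ?thesis using holds_mono[OF P _ new_le] by blast
      qed
    qed (auto simp: new_def)
    \<comment> \<open>This makes \<open>q\<close> the lowest row in which the large letters reach
      column \<open>t\<close> but not column \<open>t + 1\<close>, that is, the row on which
      \<open>dop\<close> acts in the inner shape.\<close>
    show "r \<le> q" if fr: "holds P (f r)" and gr: "\<not> holds P (g r)" for r
    proof (rule ccontr)
      assume "\<not> r \<le> q"
      then have rq: "q < r" by simp
      have no: "\<not> K 0 < g r"
        using gr holds_mono[OF P ex, of "g r"] by (auto dest: less_imp_le)
      have "f r \<noteq> None" using fr by (cases "f r") simp_all
      then have "r \<le> r1" using above_below[of r 0] no r1_pos
        by (meson not_le less_le_trans zero_less_one)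
      then have "q \<le> r - 1" "r - 1 < r1" using rq \<open>1 \<le> q\<close> by linarith+
      then have frK: "\<not> holds P (K (r - 1))" by (rule not_K)
      then have "r \<noteq> r1" using fr K_start by metis
      then have "r < r1" using \<open>r \<le> r1\<close> by auto
      moreover have "\<not> bump r" using fr frK K_bump[of r] by metis
      ultimately have "\<not> K r < f r" using above_not_bump[of r 0] no rq by linarith
      then have "f r \<le> K r" by simp
      then have "holds P (K r)" by (rule holds_mono[OF P fr])
      then show False using not_K[of r] rq \<open>r < r1\<close> by simp
    qed
  qed
qed

end

section \<open>The scanning description of the chain\<close>

text \<open>Between consecutive chain rows no row qualifies, so the scan carries a constant value
  there, and at the next chain row it meets the condition defining \<open>S\<close>. The number
  \<open>n\<close> bounds the rows left above \<open>r\<close>.\<close>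

lemma rchain_scan:
  fixes \<tau> :: "('a::linorder) filling"
  assumes "1 \<le> r" "r \<le> Suc n" "K (r - 1) = \<tau> (r, t)"
    "\<And>q. Suc q < r \<Longrightarrow> K q = (if K (Suc q) < \<tau> (Suc q, t) \<and> \<tau> (Suc q, t + 1) \<le> K (Suc q)
        then \<tau> (Suc q, t) else K (Suc q))"
  shows "\<exists>rs. rchain \<tau> t n r = r # rs \<and> distinct rs \<and>
      set rs = {q. 1 \<le> q \<and> q < r \<and> K q < \<tau> (q, t) \<and> \<tau> (q, t + 1) \<le> K q} \<and>
      (\<forall>m<length rs. \<tau> ((r # rs) ! m, t) = K (rs ! m)) \<and> \<tau> (last (r # rs), t) = K 0"
  using assms
proof (induction n arbitrary: r)
  case 0
  then have "r = 1" by simp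
  then show ?case using 0 by auto
next
  case (Suc n)
  define S where "S = {q. 1 \<le> q \<and> q < r \<and> \<tau> (q, t) > \<tau> (r, t) \<and> \<tau> (r, t) \<ge> \<tau> (q, t + 1)}"
  have fin: "finite S" unfolding S_def by auto
  have unfold: "rchain \<tau> t (Suc n) r = (if S = {} then [r] else r # rchain \<tau> t n (Max S))"
    by (simp only: rchain.simps Let_def S_def)
  have const: "K q = \<tau> (r, t)" if "q \<le> r - 1" "\<And>q'. q < q' \<Longrightarrow> q' \<notin> S" for q
    using that(1,2)
  proof (induction q rule: inc_induct)
    case base
    then show ?case using Suc.prems by simp
  next
    case (step m)
    have IH: "K (Suc m) = \<tau> (r, t)" using step by simp
    have "Suc m \<notin> S" using step by auto
    moreover have "Suc m < r" using step by auto
    ultimately show ?case using IH Suc.prems(4)[of m] by (auto simp: S_def)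
  qed
  show ?case
  proof (cases "S = {}")
    case True
    have all: "K q = \<tau> (r, t)" if "q < r" for q
      using const[of q] that True by auto
    then have "rchain \<tau> t (Suc n) r = [r]" using True unfold by simp
    moreover have "{q. 1 \<le> q \<and> q < r \<and> K q < \<tau> (q, t) \<and> \<tau> (q, t + 1) \<le> K q} = {}"
      using True all by (auto simp: S_def)
    ultimately show ?thesis using all[of 0] Suc.prems(1) by auto
  next
    case False
    define M where "M = Max S"
    have M: "M \<in> S" "\<And>q. q \<in> S \<Longrightarrow> q \<le> M" unfolding M_def using fin False by auto
    have Mr: "1 \<le> M" "M < r" using M by (auto simp: S_def)
    have above: "K q = \<tau> (r, t)" if "M \<le> q" "q < r" for q
      using const[of q] M(2) that by force
    have KM: "K (M - 1) = \<tau> (M, t)"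
      using Suc.prems(4)[of "M - 1"] Mr above[of M] M(1) by (auto simp: S_def)
    obtain rs where rs: "rchain \<tau> t n M = M # rs" "distinct rs"
      "set rs = {q. 1 \<le> q \<and> q < M \<and> K q < \<tau> (q, t) \<and> \<tau> (q, t + 1) \<le> K q}"
      "\<forall>m<length rs. \<tau> ((M # rs) ! m, t) = K (rs ! m)" "\<tau> (last (M # rs), t) = K 0"
      using Suc.IH[of M] Mr KM Suc.prems by auto
    have "rchain \<tau> t (Suc n) r = r # M # rs"
      using False rs(1) unfold by (simp add: M_def)
    moreover have "set (M # rs) = {q. 1 \<le> q \<and> q < r \<and> K q < \<tau> (q, t) \<and> \<tau> (q, t + 1) \<le> K q}"
      (is "_ = ?R")
    proof -
      have "q \<in> ?R \<longleftrightarrow> q = M \<or> q \<in> set rs" for q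
      proof (cases "M < q \<and> q < r")
        case True
        then have "q \<notin> S" using M(2)[of q] by auto
        then show ?thesis using True above[of q] rs(3) by (auto simp: S_def)
      next
        case False
        have "K M = \<tau> (r, t)" using above Mr by simp
        then have MR: "M \<in> ?R" using M(1) by (simp add: S_def)
        consider "q = M" | "q < M" | "r \<le> q" using False by linarith
        then show ?thesis
        proof cases
          case 1
          then show ?thesis using MR by simp
        qed (use rs(3) Mr in simp_all)
      qed
      then have "?R = insert M (set rs)" by blast
      then show ?thesis by simp
    qed
    moreover have "\<tau> ((r # M # rs) ! m, t) = K ((M # rs) ! m)" if "m < length (M # rs)" for m
      using that rs(4) above[of M] Mr by (cases m) auto
    moreover have "M \<notin> set rs" using rs(3) by auto
    ultimately show ?thesis using rs(2,5) by (intro exI[of _ "M # rs"]) auto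
  qed
qed

text \<open>The value carried after the \<open>d\<close> rows directly above \<open>r\<close>.
  Counting upwards makes the recursion primitive; \<open>scan\<close> reindexes it by rows.\<close>

primrec held :: "(nat \<Rightarrow> 'a::linorder option) \<Rightarrow> (nat \<Rightarrow> 'a option) \<Rightarrow> nat \<Rightarrow> nat \<Rightarrow> 'a option" where
  "held f g r 0 = f r"
| "held f g r (Suc d) = (let k = held f g r d; q = r - Suc d
     in if k < f q \<and> g q \<le> k then f q else k)"

definition scan :: "(nat \<Rightarrow> 'a::linorder option) \<Rightarrow> (nat \<Rightarrow> 'a option) \<Rightarrow> nat \<Rightarrow> nat \<Rightarrow> 'a option" where
  "scan f g r q = held f g r (r - 1 - q)"

lemma scan_start: "scan f g r (r - 1) = f r"
  by (simp add: scan_def)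

lemma scan_step: "Suc q < r \<Longrightarrow> scan f g r q =
    (if scan f g r (Suc q) < f (Suc q) \<and> g (Suc q) \<le> scan f g r (Suc q) then f (Suc q)
     else scan f g r (Suc q))"
proof -
  assume "Suc q < r"
  then have "r - 1 - q = Suc (r - 1 - Suc q)" "r - Suc (r - 1 - Suc q) = Suc q" by auto
  then show ?thesis by (simp add: scan_def Let_def)
qed

definition slid :: "(nat \<Rightarrow> 'a::linorder option) \<Rightarrow> (nat \<Rightarrow> 'a option) \<Rightarrow> nat \<Rightarrow> nat \<Rightarrow> 'a option" where
  "slid f g r q = (if q = r then None
     else if 1 \<le> q \<and> q < r \<and> scan f g r q < f q \<and> g q \<le> scan f g r q then scan f g r q else f q)"

definition lastrow :: "nat \<Rightarrow> nat list \<Rightarrow> nat" where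
  "lastrow t \<gamma> = Max {r. 1 \<le> r \<and> r \<le> length \<gamma> \<and> \<gamma> ! (r - 1) = t}"

definition cutrow :: "nat \<Rightarrow> 'a filling \<Rightarrow> 'a filling" where
  "cutrow r1 \<tau> = (\<lambda>(r, c). if r < r1 then \<tau> (r, c) else \<tau> (r + 1, c))"

definition slidecol :: "nat \<Rightarrow> nat \<Rightarrow> ('a::linorder) filling \<Rightarrow> 'a filling" where
  "slidecol t r1 \<tau> = (\<lambda>(r, c). if c = t then slid (\<lambda>r. \<tau> (r, t)) (\<lambda>r. \<tau> (r, t + 1)) r1 r else \<tau> (r, c))"

text \<open>Stated for arbitrary fillings because it is applied later to fillings with identified
  letters, in which a column may repeat an entry.\<close>

lemma phi_scan:
  assumes "1 \<le> lastrow t \<gamma>"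
  shows "phi t (\<gamma>, \<tau>) =
    (if t = 1 then take (lastrow t \<gamma> - 1) \<gamma> @ drop (lastrow t \<gamma>) \<gamma> else \<gamma>[lastrow t \<gamma> - 1 := t - 1],
     if t = 1 then cutrow (lastrow t \<gamma>) (slidecol t (lastrow t \<gamma>) \<tau>) else slidecol t (lastrow t \<gamma>) \<tau>,
     the (scan (\<lambda>r. \<tau> (r, t)) (\<lambda>r. \<tau> (r, t + 1)) (lastrow t \<gamma>) 0))"
proof -
  define r1 where "r1 = lastrow t \<gamma>"
  define K where "K = scan (\<lambda>r. \<tau> (r, t)) (\<lambda>r. \<tau> (r, t + 1)) r1"
  obtain rs where rs: "rchain \<tau> t r1 r1 = r1 # rs" "distinct rs"
      "set rs = {q. 1 \<le> q \<and> q < r1 \<and> K q < \<tau> (q, t) \<and> \<tau> (q, t + 1) \<le> K q}"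
      "\<forall>m<length rs. \<tau> ((r1 # rs) ! m, t) = K (rs ! m)" "\<tau> (last (r1 # rs), t) = K 0"
    using rchain_scan[of r1 r1 K \<tau> t] assms
      scan_start[of "\<lambda>r. \<tau> (r, t)" "\<lambda>r. \<tau> (r, t + 1)" r1]
      scan_step[of _ r1 "\<lambda>r. \<tau> (r, t)" "\<lambda>r. \<tau> (r, t + 1)"]
    unfolding K_def r1_def by auto
  define R where "R = rchain \<tau> t r1 r1"
  have mem: "(\<exists>m. 1 \<le> m \<and> m < length R \<and> R ! m = r) \<longleftrightarrow> r \<in> set rs" for r
  proof
    assume "r \<in> set rs"
    then obtain m where "m < length rs" "rs ! m = r" by (auto simp: in_set_conv_nth)
    then show "\<exists>m. 1 \<le> m \<and> m < length R \<and> R ! m = r"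
      using rs(1) by (intro exI[of _ "Suc m"]) (auto simp: R_def)
  next
    assume "\<exists>m. 1 \<le> m \<and> m < length R \<and> R ! m = r"
    then obtain m where m: "1 \<le> m" "m < length R" "R ! m = r" by auto
    then show "r \<in> set rs" using rs(1) by (cases m) (auto simp: R_def)
  qed
  have val: "\<tau> (R ! ((THE m. 1 \<le> m \<and> m < length R \<and> R ! m = r) - 1), t) = K r" if r: "r \<in> set rs" for r
  proof -
    obtain m where m: "m < length rs" "rs ! m = r" using r by (auto simp: in_set_conv_nth)
    \<comment> \<open>The chain has no repetitions, so the index chosen by \<open>phi\<close> is
      unique, and the preceding row holds the value carried to \<open>r\<close>.\<close>
    have "(THE m. 1 \<le> m \<and> m < length R \<and> R ! m = r) = Suc m"
    proof (rule the_equality)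
      show "1 \<le> Suc m \<and> Suc m < length R \<and> R ! Suc m = r" using m rs(1) by (auto simp: R_def)
      fix m' assume m': "1 \<le> m' \<and> m' < length R \<and> R ! m' = r"
      then obtain n where "m' = Suc n" by (cases m') auto
      then show "m' = Suc m"
        using m' m rs(1,2) nth_eq_iff_index_eq[of rs n m] by (auto simp: R_def)
    qed
    then show ?thesis using rs(1,4) m by (auto simp: R_def)
  qed
  let ?col = "\<lambda>(r, c). if c = t \<and> r = r1 then None
                 else if c = t \<and> (\<exists>m. 1 \<le> m \<and> m < length R \<and> R ! m = r)
                 then \<tau> (R ! ((THE m. 1 \<le> m \<and> m < length R \<and> R ! m = r) - 1), t)
                 else \<tau> (r, c)"
  have col: "?col = slidecol t r1 \<tau>"
    unfolding mem slidecol_def slid_def K_def[symmetric]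
    using val rs(3) by (auto simp: fun_eq_iff)
  have ex: "\<tau> (last R, t) = K 0" using rs(1,5) by (simp add: R_def)
  have "phi t (\<gamma>, \<tau>) = (if t = 1 then take (r1 - 1) \<gamma> @ drop r1 \<gamma> else \<gamma>[r1 - 1 := t - 1],
     if t = 1 then cutrow r1 ?col else ?col, the (\<tau> (last R, t)))"
    unfolding phi_def r1_def lastrow_def R_def cutrow_def Let_def prod.case by (rule refl)
  then show ?thesis unfolding col ex unfolding K_def r1_def .
qed

section \<open>Straight shapes\<close>

text \<open>Since \<open>None\<close> lies below every letter, comparisons of options
  also cover boxes outside the shape.\<close>

definition sct :: "('a::linorder) filling \<Rightarrow> bool" where
  "sct \<tau> \<longleftrightarrow> (\<forall>r c. 1 \<le> c \<longrightarrow> \<tau> (r, c + 1) \<le> \<tau> (r, c)) \<and>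
    (\<forall>r s. r < s \<longrightarrow> \<tau> (r, 1) \<noteq> None \<longrightarrow> \<tau> (s, 1) \<noteq> None \<longrightarrow> \<tau> (r, 1) < \<tau> (s, 1)) \<and>
    (\<forall>r s c. r < s \<longrightarrow> 1 \<le> c \<longrightarrow> \<tau> (s, c + 1) \<noteq> None \<longrightarrow> \<tau> (s, c + 1) \<le> \<tau> (r, c)
        \<longrightarrow> \<tau> (s, c + 1) < \<tau> (r, c + 1))"

definition col :: "'a filling \<Rightarrow> nat \<Rightarrow> 'a set" where
  "col \<tau> c = {x. \<exists>r. \<tau> (r, c) = Some x}"

lemma sct_row: "sct \<tau> \<Longrightarrow> 1 \<le> c \<Longrightarrow> \<tau> (r, c + 1) \<le> \<tau> (r, c)"
  and sct_first: "sct \<tau> \<Longrightarrow> r < s \<Longrightarrow> \<tau> (r, 1) \<noteq> None \<Longrightarrow> \<tau> (s, 1) \<noteq> None \<Longrightarrow> \<tau> (r, 1) < \<tau> (s, 1)"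
  and sct_triple: "sct \<tau> \<Longrightarrow> r < s \<Longrightarrow> 1 \<le> c \<Longrightarrow> \<tau> (s, c + 1) \<noteq> None \<Longrightarrow>
      \<tau> (s, c + 1) \<le> \<tau> (r, c) \<Longrightarrow> \<tau> (s, c + 1) < \<tau> (r, c + 1)"
  by (simp_all add: sct_def)

lemma sct_row_mono:
  assumes "sct \<tau>" "1 \<le> c" "c \<le> c'"
  shows "\<tau> (r, c') \<le> \<tau> (r, c)"
  using assms(3)
proof (induction c' rule: dec_induct)
  case (step n)
  then show ?case using sct_row[OF assms(1), of n r] assms(2) by simp
qed simp

text \<open>Beyond the first column, equal entries in rows \<open>r < s\<close> contradict the
  triple rule, because the left neighbour of the upper one is at least as large.\<close>

lemma sct_column_inj:
  assumes "sct \<tau>" "1 \<le> c" "\<tau> (r, c) = \<tau> (s, c)" "\<tau> (r, c) \<noteq> None"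
  shows "r = s"
proof -
  have False if "r < s" "\<tau> (r, c) = \<tau> (s, c)" "\<tau> (r, c) \<noteq> None" for r s
  proof (cases "c = 1")
    case True
    then show ?thesis using sct_first[OF assms(1) that(1)] that by simp
  next
    case False
    then obtain b where b: "c = b + 1" "1 \<le> b" using assms(2) by (cases c) auto
    then show ?thesis
      using sct_triple[OF assms(1) that(1) b(2)] sct_row[OF assms(1) b(2), of r] that by simp
  qed
  then show ?thesis using assms by (metis linorder_neqE_nat)
qed

lemma diagD: "(r, c) \<in> diag \<alpha> \<Longrightarrow> 1 \<le> b \<Longrightarrow> b \<le> c \<Longrightarrow> (r, b) \<in> diag \<alpha>"
  by (auto simp: diag_def)

lemma inner_Nil [simp]: "inner \<alpha> [] = {}"
  by (auto simp: inner_def)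

lemma skew_Nil [simp]: "skew \<alpha> [] = diag \<alpha>"
  by (simp add: skew_def)

lemma ssrct_Nil_iff: "ssrct \<gamma> [] \<tau> \<longleftrightarrow> dom \<tau> = diag \<gamma> \<and> sct \<tau>"
proof
  assume s: "ssrct \<gamma> [] \<tau>"
  then have d: "dom \<tau> = diag \<gamma>" by (simp add: ssrct_def)
  then have D: "(r, c) \<in> diag \<gamma> \<longleftrightarrow> \<tau> (r, c) \<noteq> None" for r c by auto
  have "\<tau> (r, c + 1) \<le> \<tau> (r, c)" if "1 \<le> c" for r c
  proof (cases "\<tau> (r, c + 1)")
    case (Some y)
    then have 1: "(r, c + 1) \<in> diag \<gamma>" "(r, c) \<in> diag \<gamma>"
      using that d diagD[of r "c + 1" \<gamma> c] by auto
    then obtain x where "\<tau> (r, c) = Some x" using D by auto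
    moreover have "the (\<tau> (r, c + 1)) \<le> the (\<tau> (r, c))"
      using s 1 unfolding ssrct_def skew_Nil by (metis less_add_one)
    ultimately show ?thesis using Some by simp
  qed simp
  moreover have "\<tau> (r, 1) < \<tau> (s, 1)" if "r < s" "\<tau> (r, 1) \<noteq> None" "\<tau> (s, 1) \<noteq> None" for r s
  proof -
    have "the (\<tau> (r, 1)) < the (\<tau> (s, 1))" using s that unfolding ssrct_def skew_Nil D by blast
    then show ?thesis using that by (cases "\<tau> (r, 1)"; cases "\<tau> (s, 1)") auto
  qed
  moreover have "\<tau> (s, c + 1) < \<tau> (r, c + 1)"
    if "r < s" "1 \<le> c" "\<tau> (s, c + 1) \<noteq> None" "\<tau> (s, c + 1) \<le> \<tau> (r, c)" for r s c
  proof -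
    have "\<tau> (r, c) \<noteq> None" "the (\<tau> (s, c + 1)) \<le> the (\<tau> (r, c))"
      using that by (cases "\<tau> (r, c)"; cases "\<tau> (s, c + 1)"; auto)+
    then have "\<tau> (r, c + 1) \<noteq> None \<and> the (\<tau> (s, c + 1)) < the (\<tau> (r, c + 1))"
      using s that unfolding ssrct_def skew_Nil D inner_Nil by blast
    then show ?thesis using that by (cases "\<tau> (r, c + 1)"; cases "\<tau> (s, c + 1)") auto
  qed
  ultimately show "dom \<tau> = diag \<gamma> \<and> sct \<tau>" using d by (simp add: sct_def)
next
  assume "dom \<tau> = diag \<gamma> \<and> sct \<tau>"
  then have d: "dom \<tau> = diag \<gamma>" and s: "sct \<tau>" by auto
  then have D: "(r, c) \<in> diag \<gamma> \<longleftrightarrow> \<tau> (r, c) \<noteq> None" for r c by auto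
  have pos: "1 \<le> c" if "\<tau> (r, c) \<noteq> None" for r c
    using that D by (auto simp: diag_def)
  show "ssrct \<gamma> [] \<tau>"
    unfolding ssrct_def skew_Nil inner_Nil D
  proof (intro conjI allI impI)
    fix r c c' assume "\<tau> (r, c) \<noteq> None \<and> \<tau> (r, c') \<noteq> None \<and> c < c'"
    then show "the (\<tau> (r, c')) \<le> the (\<tau> (r, c))"
      using sct_row_mono[OF s pos, of r c c' r] by auto
  next
    fix r t assume "r < t \<and> \<tau> (r, 1) \<noteq> None \<and> \<tau> (t, 1) \<noteq> None"
    then show "the (\<tau> (r, 1)) < the (\<tau> (t, 1))"
      using sct_first[OF s, of r t] by auto
  next
    fix r t c
    assume a: "r < t \<and> 1 \<le> c \<and> \<tau> (t, c + 1) \<noteq> None \<and> ((r, c) \<in> {} \<or> \<tau> (r, c) \<noteq> None \<and>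
              the (\<tau> (t, c + 1)) \<le> the (\<tau> (r, c)))"
    then obtain x y where xy: "\<tau> (t, c + 1) = Some x" "\<tau> (r, c) = Some y" by auto
    then have "\<tau> (t, c + 1) < \<tau> (r, c + 1)"
      using a by (intro sct_triple[OF s, of r t c]) auto
    then show "(r, c + 1) \<in> {} \<or> \<tau> (r, c + 1) \<noteq> None \<and> the (\<tau> (t, c + 1)) < the (\<tau> (r, c + 1))"
      using xy by (cases "\<tau> (r, c + 1)") auto
  qed (use d in auto)
qed

section \<open>Slides of straight tableaux\<close>

lemma lastrow_props:
  assumes "t \<in> set \<gamma>"
  shows "1 \<le> lastrow t \<gamma>" "lastrow t \<gamma> \<le> length \<gamma>" "\<gamma> ! (lastrow t \<gamma> - 1) = t"
    and "lastrow t \<gamma> < r \<Longrightarrow> r \<le> length \<gamma> \<Longrightarrow> \<gamma> ! (r - 1) \<noteq> t"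
proof -
  let ?S = "{r. 1 \<le> r \<and> r \<le> length \<gamma> \<and> \<gamma> ! (r - 1) = t}"
  obtain k where "k < length \<gamma>" "\<gamma> ! k = t" using assms by (auto simp: in_set_conv_nth)
  then have "Suc k \<in> ?S" by auto
  then have m: "lastrow t \<gamma> \<in> ?S" unfolding lastrow_def by (intro Max_in) auto
  then show "1 \<le> lastrow t \<gamma>" "lastrow t \<gamma> \<le> length \<gamma>" "\<gamma> ! (lastrow t \<gamma> - 1) = t" by auto
  assume r: "lastrow t \<gamma> < r" "r \<le> length \<gamma>"
  show "\<gamma> ! (r - 1) \<noteq> t"
  proof
    assume "\<gamma> ! (r - 1) = t"
    then have "r \<in> ?S" using r by auto
    then have "r \<le> lastrow t \<gamma>" unfolding lastrow_def by (intro Max_ge) auto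
    then show False using r by simp
  qed
qed

lemma dop_lastrow:
  assumes "t \<in> set \<gamma>"
  shows "dop t \<gamma> = Some (if t = 1 then take (lastrow t \<gamma> - 1) \<gamma> @ drop (lastrow t \<gamma>) \<gamma>
                        else \<gamma>[lastrow t \<gamma> - 1 := t - 1])"
proof -
  note l = lastrow_props[OF assms]
  have "Max {k. k < length \<gamma> \<and> \<gamma> ! k = t} = lastrow t \<gamma> - 1"
  proof (rule Max_eqI)
    fix k assume k: "k \<in> {k. k < length \<gamma> \<and> \<gamma> ! k = t}"
    then have "\<not> lastrow t \<gamma> < Suc k" using l(4)[of "Suc k"] by auto
    then show "k \<le> lastrow t \<gamma> - 1" by simp
  qed (use l in auto)
  moreover have "lastrow t \<gamma> - 1 + 1 = lastrow t \<gamma>" using l(1) by simp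
  ultimately show ?thesis using assms by (simp only: dop_def Let_def if_True)
qed

lemma slide_column:
  assumes s: "sct \<tau>" and d: "dom \<tau> = diag \<gamma>" and t: "1 \<le> t" "t \<in> set \<gamma>"
  shows "column_slide (\<lambda>r. \<tau> (r, t)) (\<lambda>r. \<tau> (r, t + 1))
    (scan (\<lambda>r. \<tau> (r, t)) (\<lambda>r. \<tau> (r, t + 1)) (lastrow t \<gamma>)) (lastrow t \<gamma>)"
proof -
  note l = lastrow_props[OF t(2)]
  have D: "\<tau> (r, c) \<noteq> None \<longleftrightarrow> (r, c) \<in> diag \<gamma>" for r c using d by auto
  have D': "\<tau> (r, c) = None \<longleftrightarrow> (r, c) \<notin> diag \<gamma>" for r c using d by auto
  show ?thesis
  proof
    show "\<tau> (lastrow t \<gamma>, t) \<noteq> None" "\<tau> (lastrow t \<gamma>, t + 1) = None"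
      unfolding D D' using l t by (auto simp: diag_def)
    show "\<tau> (r, t + 1) \<noteq> None" if "lastrow t \<gamma> < r" "\<tau> (r, t) \<noteq> None" for r
    proof -
      have "r \<le> length \<gamma>" "t \<le> \<gamma> ! (r - 1)" using that(2) unfolding D by (auto simp: diag_def)
      moreover have "\<gamma> ! (r - 1) \<noteq> t" using l(4)[OF that(1)] calculation by simp
      ultimately show ?thesis unfolding D using that(1) by (auto simp: diag_def)
    qed
    show "\<tau> (r, t) = \<tau> (q, t) \<Longrightarrow> \<tau> (r, t) \<noteq> None \<Longrightarrow> r = q" for r q
      using sct_column_inj[OF s t(1)] by blast
    show "scan (\<lambda>r. \<tau> (r, t)) (\<lambda>r. \<tau> (r, t + 1)) (lastrow t \<gamma>) (lastrow t \<gamma> - 1) = \<tau> (lastrow t \<gamma>, t)"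
      by (rule scan_start)
  qed (rule l(1), erule scan_step, rule sct_row[OF s t(1)], rule sct_triple[OF s _ t(1)], assumption+)
qed

lemma slid_new:
  assumes "column_slide f g (scan f g r) r"
  shows "slid f g r = column_slide.new f g (scan f g r) r"
  unfolding slid_def fun_eq_iff column_slide.new_def[OF assms] column_slide.bump_def[OF assms]
  by auto

text \<open>The columns \<open>t - 1\<close> and \<open>t\<close> are the subject of
  \<open>new_triple\<close>. For \<open>t\<close> and \<open>t + 1\<close>, the entries of column
  \<open>t\<close> only decrease, which makes the premise of the triple rule stronger, and rows stay
  decreasing by \<open>g_le_new\<close>.\<close>

lemma sct_slidecol:
  assumes s: "sct \<tau>" and d: "dom \<tau> = diag \<gamma>" and t: "1 \<le> t" "t \<in> set \<gamma>"
  shows "sct (slidecol t (lastrow t \<gamma>) \<tau>)"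
proof -
  define f where "f = (\<lambda>r. \<tau> (r, t))"
  define g where "g = (\<lambda>r. \<tau> (r, t + 1))"
  define r1 where "r1 = lastrow t \<gamma>"
  interpret column_slide f g "scan f g r1" r1
    using slide_column[OF assms] by (simp add: f_def g_def r1_def)
  have sl: "slid f g r1 = new" by (rule slid_new) unfold_locales
  have zero: "\<tau> (0, c) = None" for c
    using d by (cases "\<tau> (0, c)") (auto simp: diag_def)
  define \<sigma> where "\<sigma> = slidecol t r1 \<tau>"
  have \<sigma>: "\<sigma> (r, c) = (if c = t then new r else \<tau> (r, c))" for r c
    unfolding \<sigma>_def slidecol_def f_def[symmetric] g_def[symmetric] sl by simp
  have "\<sigma> (r, c + 1) \<le> \<sigma> (r, c)" if "1 \<le> c" for r c
    using sct_row[OF s that, of r] new_le[of r] g_le_new[of r]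
    unfolding \<sigma> by (auto simp: f_def g_def)
  moreover have "\<sigma> (r, 1) < \<sigma> (q, 1)" if "r < q" "\<sigma> (r, 1) \<noteq> None" "\<sigma> (q, 1) \<noteq> None" for r q
  proof (cases "t = 1")
    case True
    \<comment> \<open>In the first column the entries grow downwards, so the carried value, which
      comes from below, is never smaller than the entry it meets.\<close>
    have nb: "\<not> bump r" for r
    proof
      assume b: "bump r"
      then have "r < r1" by (simp add: bump_def)
      then obtain q where q: "r < q" "f q = scan f g r1 r" using K_attained by blast
      have "f r \<noteq> None" "f q \<noteq> None"
        using b q K_Some[OF \<open>r < r1\<close>] by (cases "f r"; auto simp: bump_def)+
      then have "f r < f q" using sct_first[OF s q(1)] True by (simp add: f_def)
      then show False using b q by (auto simp: bump_def)
    qed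
    have "new r = f r" "new q = f q"
      using that True nb unfolding \<sigma> by (auto simp: new_def split: if_splits)
    then show ?thesis using that True sct_first[OF s that(1)] unfolding \<sigma> by (simp add: f_def)
  next
    case False
    then show ?thesis using that sct_first[OF s that(1)] unfolding \<sigma> by simp
  qed
  moreover have "\<sigma> (q, c + 1) < \<sigma> (r, c + 1)"
    if h: "r < q" "1 \<le> c" "\<sigma> (q, c + 1) \<noteq> None" "\<sigma> (q, c + 1) \<le> \<sigma> (r, c)" for r q c
  proof (cases "c + 1 = t")
    case True
    have "1 \<le> r"
    proof (rule ccontr)
      assume "\<not> 1 \<le> r"
      then have "r = 0" by simp
      then have "\<sigma> (r, c) = None" using True zero unfolding \<sigma> by simp
      then show False using h(3,4) by (cases "\<sigma> (q, c + 1)") auto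
    qed
    then have "new q < new r"
      using new_triple[of "\<lambda>r. \<tau> (r, c)" r q] sct_triple[OF s _ h(2)] h True unfolding \<sigma>
      by (auto simp: f_def)
    then show ?thesis using True unfolding \<sigma> by simp
  next
    case False
    then have "\<tau> (q, c + 1) \<le> \<tau> (r, c)" "\<tau> (q, c + 1) \<noteq> None"
      using h(3,4) new_le[of r] unfolding \<sigma> by (auto simp: f_def split: if_splits)
    then show ?thesis using sct_triple[OF s h(1,2)] False unfolding \<sigma> by simp
  qed
  ultimately have "sct \<sigma>" by (simp add: sct_def)
  then show ?thesis by (simp add: \<sigma>_def r1_def)
qed

lemma slidecol_None_iff:
  assumes s: "sct \<tau>" and d: "dom \<tau> = diag \<gamma>" and t: "1 \<le> t" "t \<in> set \<gamma>"
  shows "slidecol t (lastrow t \<gamma>) \<tau> b = None \<longleftrightarrow> b = (lastrow t \<gamma>, t) \<or> \<tau> b = None"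
proof -
  define f where "f = (\<lambda>r. \<tau> (r, t))"
  define g where "g = (\<lambda>r. \<tau> (r, t + 1))"
  define r1 where "r1 = lastrow t \<gamma>"
  interpret column_slide f g "scan f g r1" r1
    using slide_column[OF assms] by (simp add: f_def g_def r1_def)
  have sl: "slid f g r1 = new" by (rule slid_new) unfold_locales
  have "new r = None \<longleftrightarrow> r = r1 \<or> f r = None" for r
    using K_Some[of r] unfolding new_def by (auto simp: bump_def)
  then show ?thesis
    unfolding r1_def[symmetric] slidecol_def f_def[symmetric] g_def[symmetric] sl
    by (cases b) (auto simp: f_def)
qed

lemma sct_cutrow: "sct \<tau> \<Longrightarrow> sct (cutrow r1 \<tau>)"
proof -
  assume s: "sct \<tau>"
  define h where "h r = (if r < r1 then r else r + 1)" for r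
  have c: "cutrow r1 \<tau> (r, c) = \<tau> (h r, c)" for r c by (simp add: cutrow_def h_def)
  have h: "h r < h q" if "r < q" for r q using that by (simp add: h_def)
  show ?thesis
    unfolding sct_def c
    using sct_row[OF s] sct_first[OF s h] sct_triple[OF s h] by blast
qed

lemma nth_cut: "1 \<le> r1 \<Longrightarrow> r1 \<le> length \<gamma> \<Longrightarrow> k < length \<gamma> - 1 \<Longrightarrow>
    (take (r1 - 1) \<gamma> @ drop r1 \<gamma>) ! k = \<gamma> ! (if k < r1 - 1 then k else k + 1)"
  by (auto simp: nth_append min_def)

lemma diag_cut:
  assumes "1 \<le> r1" "r1 \<le> length \<gamma>"
  shows "(r, c) \<in> diag (take (r1 - 1) \<gamma> @ drop r1 \<gamma>) \<longleftrightarrow>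
    (if r < r1 then (r, c) \<in> diag \<gamma> else (r + 1, c) \<in> diag \<gamma>)"
proof -
  have len: "length (take (r1 - 1) \<gamma> @ drop r1 \<gamma>) = length \<gamma> - 1" using assms by simp
  show ?thesis
  proof (cases "1 \<le> r \<and> r \<le> length \<gamma> - 1")
    case True
    then have "(take (r1 - 1) \<gamma> @ drop r1 \<gamma>) ! (r - 1) = \<gamma> ! (if r < r1 then r - 1 else r)"
      using nth_cut[OF assms, of "r - 1"] by auto
    then show ?thesis using True assms unfolding diag_def mem_Collect_eq prod.case len by auto
  next
    case False
    then show ?thesis using assms unfolding diag_def mem_Collect_eq prod.case len by auto
  qed
qed

text \<open>The last three facts serve the iteration. Later slides act in smaller columns but may
  delete a row; hence rows are matched, on the columns right of \<open>t\<close>, only up to some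
  \<open>q\<close>, which suffices to carry the exit rule along. The part \<open>t - 1\<close> makes
  the next slide possible.\<close>

lemma phi_step:
  assumes ss: "ssrct \<gamma> [] \<tau>" and cp: "is_comp \<gamma>" and t: "1 \<le> t" "t \<in> set \<gamma>"
    and p: "phi t (\<gamma>, \<tau>) = (\<gamma>', \<tau>', x)"
  shows "dop t \<gamma> = Some \<gamma>'" and "is_comp \<gamma>'" and "ssrct \<gamma>' [] \<tau>'"
    and "x \<in> col \<tau> t" and "col \<tau>' t = col \<tau> t - {x}" and "c \<noteq> t \<Longrightarrow> col \<tau>' c = col \<tau> c"
    and "Some x \<le> \<tau>' (r, t) \<Longrightarrow> Some x < \<tau>' (r, t + 1)"
    and "\<exists>q. \<forall>c>t. \<tau>' (r, c) = \<tau> (q, c)"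
    and "2 \<le> t \<Longrightarrow> t - 1 \<in> set \<gamma>'"
proof -
  have s: "sct \<tau>" and d: "dom \<tau> = diag \<gamma>" using ss by (auto simp: ssrct_Nil_iff)
  define f where "f = (\<lambda>r. \<tau> (r, t))"
  define g where "g = (\<lambda>r. \<tau> (r, t + 1))"
  define r1 where "r1 = lastrow t \<gamma>"
  note l = lastrow_props[OF t(2), folded r1_def]
  interpret column_slide f g "scan f g r1" r1
    using slide_column[OF s d t] by (simp add: f_def g_def r1_def)
  have sl: "slid f g r1 = new" by (rule slid_new) unfold_locales
  define \<sigma> where "\<sigma> = slidecol t r1 \<tau>"
  have \<sigma>t: "\<sigma> (r, t) = new r" for r
    unfolding \<sigma>_def slidecol_def f_def[symmetric] g_def[symmetric] sl by simp
  have \<sigma>c: "\<sigma> (r, c) = \<tau> (r, c)" if "c \<noteq> t" for r c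
    using that by (simp add: \<sigma>_def slidecol_def)
  have scs: "sct \<sigma>" unfolding \<sigma>_def r1_def by (rule sct_slidecol[OF s d t])
  have N: "\<sigma> b = None \<longleftrightarrow> b = (r1, t) \<or> \<tau> b = None" for b
    unfolding \<sigma>_def r1_def by (rule slidecol_None_iff[OF s d t])
  have N\<tau>: "\<tau> b = None \<longleftrightarrow> b \<notin> diag \<gamma>" for b using d by auto
  have ph: "\<gamma>' = (if t = 1 then take (r1 - 1) \<gamma> @ drop r1 \<gamma> else \<gamma>[r1 - 1 := t - 1])"
    "\<tau>' = (if t = 1 then cutrow r1 \<sigma> else \<sigma>)" "x = the (scan f g r1 0)"
    using p phi_scan[of t \<gamma> \<tau>, folded r1_def f_def g_def] l(1) by (auto simp: \<sigma>_def)
  have x: "scan f g r1 0 = Some x" using K_Some[of 0] r1_pos ph(3) by auto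
  have f0: "f 0 = None" unfolding f_def N\<tau> by (simp add: diag_def)
  show "dop t \<gamma> = Some \<gamma>'" using dop_lastrow[OF t(2), folded r1_def] ph(1) by simp
  show "is_comp \<gamma>'"
    using cp t(1) unfolding ph(1) is_comp_def
    by (auto dest!: set_update_subset_insert[THEN subsetD] in_set_takeD in_set_dropD)
  have row1: "\<sigma> (r1, c) = None" if "t = 1" for c
    unfolding N N\<tau> using that l by (auto simp: diag_def)
  have d': "\<tau>' (r, c) = None \<longleftrightarrow> (r, c) \<notin> diag \<gamma>'" for r c
  proof (cases "t = 1")
    case True
    have "\<tau>' (r, c) = \<sigma> (if r < r1 then r else r + 1, c)"
      using True ph(2) by (simp add: cutrow_def)
    then have "\<tau>' (r, c) = None \<longleftrightarrow> (if r < r1 then r else r + 1, c) \<notin> diag \<gamma>"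
      by (simp add: N N\<tau>)
    moreover have "\<gamma>' = take (r1 - 1) \<gamma> @ drop r1 \<gamma>" using True ph(1) by simp
    ultimately show ?thesis using diag_cut[OF l(1,2), of r c] by (cases "r < r1") simp_all
  next
    case False
    have "(r, c) \<in> diag \<gamma>' \<longleftrightarrow> (r, c) \<in> diag \<gamma> \<and> (r, c) \<noteq> (r1, t)"
      using False ph(1) l t unfolding diag_def by (auto simp: nth_list_update)
    then show ?thesis using False ph(2) N N\<tau> by auto
  qed
  then have "dom \<tau>' = diag \<gamma>'" by (force simp: dom_def)
  then show "ssrct \<gamma>' [] \<tau>'" unfolding ssrct_Nil_iff using scs sct_cutrow ph(2) by auto
  have colx: "col \<tau>' c = col \<sigma> c" for c
  proof (cases "t = 1")
    case True
    have "\<exists>q. \<tau>' (q, c) = Some y" if "\<sigma> (r, c) = Some y" for r y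
    proof -
      have "r \<noteq> r1" using that row1[OF True] by auto
      then have "\<tau>' (if r < r1 then r else r - 1, c) = Some y"
        using that True ph(2) l(1) by (auto simp: cutrow_def)
      then show ?thesis by blast
    qed
    moreover have "\<exists>q. \<sigma> (q, c) = Some y" if "\<tau>' (r, c) = Some y" for r y
      using that True ph(2) by (auto simp: cutrow_def split: if_splits)
    ultimately show ?thesis by (auto simp: col_def)
  qed (use ph(2) in simp)
  have "col \<sigma> t = col \<tau> t - {x}"
    using new_values[OF f0] unfolding col_def \<sigma>t x by (simp add: f_def)
  then show "col \<tau>' t = col \<tau> t - {x}" using colx by simp
  show "col \<tau>' c = col \<tau> c" if "c \<noteq> t"
    unfolding colx using \<sigma>c[OF that] by (simp add: col_def)
  show "x \<in> col \<tau> t"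
    using K_attained[of 0] r1_pos x unfolding col_def by (auto simp: f_def)
  have h: "\<exists>q. (1 \<le> r \<longrightarrow> 1 \<le> q) \<and> (\<forall>c. \<tau>' (r, c) = \<sigma> (q, c))" for r
    using ph(2) by (cases "t = 1"; cases "r < r1") (auto simp: cutrow_def)
  show "\<exists>q. \<forall>c>t. \<tau>' (r, c) = \<tau> (q, c)" using h[of r] \<sigma>c by force
  show "Some x < \<tau>' (r, t + 1)" if a: "Some x \<le> \<tau>' (r, t)"
  proof -
    obtain q where q: "1 \<le> r \<longrightarrow> 1 \<le> q" "\<And>c. \<tau>' (r, c) = \<sigma> (q, c)" using h by blast
    have "(r, t) \<in> diag \<gamma>'" using a d'[of r t] by (cases "\<tau>' (r, t)") auto
    then have "1 \<le> q" using q by (simp add: diag_def)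
    then show ?thesis using exit_rule[of q] a x q(2) \<sigma>t \<sigma>c[of "t + 1"] by (simp add: g_def)
  qed
  show "t - 1 \<in> set \<gamma>'" if "2 \<le> t"
    using that l unfolding ph(1) by (auto simp: set_update_memI)
qed

section \<open>The subshape of the large letters\<close>

definition barshape :: "('a::linorder \<Rightarrow> bool) \<Rightarrow> nat list \<Rightarrow> 'a filling \<Rightarrow> nat list \<Rightarrow> bool" where
  "barshape P \<gamma> \<tau> \<beta> \<longleftrightarrow> is_comp \<beta> \<and> length \<beta> \<le> length \<gamma> \<and>
     (\<forall>b. holds P (\<tau> b) \<longleftrightarrow> b \<in> inner \<gamma> \<beta>)"

lemma inner_iff: "length \<beta> \<le> length \<gamma> \<Longrightarrow> (r, c) \<in> inner \<gamma> \<beta> \<longleftrightarrow>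
    length \<gamma> - length \<beta> < r \<and> (r - (length \<gamma> - length \<beta>), c) \<in> diag \<beta>"
  by (auto simp: inner_def diag_def)

lemma is_comp_dop: "is_comp \<beta> \<Longrightarrow> dop t \<beta> = Some \<beta>' \<Longrightarrow> 1 \<le> t \<Longrightarrow> is_comp \<beta>'"
  unfolding is_comp_def dop_def Let_def
  by (auto dest!: set_update_subset_insert[THEN subsetD] in_set_takeD in_set_dropD split: if_splits)

lemma diag_decr:
  assumes "1 \<le> k" "k \<le> length \<beta>" "\<beta> ! (k - 1) = t" "1 \<le> t"
  shows "b \<in> diag (\<beta>[k - 1 := t - 1]) \<longleftrightarrow> b \<in> diag \<beta> \<and> b \<noteq> (k, t)"
  using assms unfolding diag_def by (cases b) (auto simp: nth_list_update)

lemma first_in_diag: "is_comp \<beta> \<Longrightarrow> 1 \<le> k \<Longrightarrow> k \<le> length \<beta> \<Longrightarrow> (k, 1) \<in> diag \<beta>"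
  using nth_mem[of "k - 1" \<beta>] by (auto simp: is_comp_def diag_def Suc_le_eq)

text \<open>\<open>holds_new_unchanged\<close> and \<open>holds_new_one_row\<close> decide which box
  of the inner shape goes. The rest is the offset \<open>off\<close> between the rows of
  \<open>\<gamma>\<close> and \<open>\<beta>\<close> when a slide in column \<open>1\<close> deletes
  a row: for a small exit that row lies above the inner shape, for a large one it belongs to
  it.\<close>

lemma phi_barshape:
  assumes ss: "ssrct \<gamma> [] \<tau>" and cp: "is_comp \<gamma>" and t: "1 \<le> t" "t \<in> set \<gamma>"
    and p: "phi t (\<gamma>, \<tau>) = (\<gamma>', \<tau>', x)" and P: "upclosed P" and b: "barshape P \<gamma> \<tau> \<beta>"
  shows "if P x then \<exists>\<beta>'. dop t \<beta> = Some \<beta>' \<and> barshape P \<gamma>' \<tau>' \<beta>' else barshape P \<gamma>' \<tau>' \<beta>"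
proof -
  have s: "sct \<tau>" and d: "dom \<tau> = diag \<gamma>" using ss by (auto simp: ssrct_Nil_iff)
  define f where "f = (\<lambda>r. \<tau> (r, t))"
  define g where "g = (\<lambda>r. \<tau> (r, t + 1))"
  define r1 where "r1 = lastrow t \<gamma>"
  note l = lastrow_props[OF t(2), folded r1_def]
  interpret column_slide f g "scan f g r1" r1
    using slide_column[OF s d t] by (simp add: f_def g_def r1_def)
  have sl: "slid f g r1 = new" by (rule slid_new) unfold_locales
  define \<sigma> where "\<sigma> = slidecol t r1 \<tau>"
  have \<sigma>: "\<sigma> (r, c) = (if c = t then new r else \<tau> (r, c))" for r c
    unfolding \<sigma>_def slidecol_def f_def[symmetric] g_def[symmetric] sl by simp
  have ph: "\<gamma>' = (if t = 1 then take (r1 - 1) \<gamma> @ drop r1 \<gamma> else \<gamma>[r1 - 1 := t - 1])"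
    "\<tau>' = (if t = 1 then cutrow r1 \<sigma> else \<sigma>)" "x = the (scan f g r1 0)"
    using p phi_scan[of t \<gamma> \<tau>, folded r1_def f_def g_def] l(1) by (auto simp: \<sigma>_def)
  have x: "scan f g r1 0 = Some x" using K_Some[of 0] r1_pos ph(3) by auto
  have cb: "is_comp \<beta>" and lb: "length \<beta> \<le> length \<gamma>"
    and hb: "\<And>b. holds P (\<tau> b) \<longleftrightarrow> b \<in> inner \<gamma> \<beta>" using b by (auto simp: barshape_def)
  have f\<tau>: "f r = \<tau> (r, t)" and g\<tau>: "g r = \<tau> (r, t + 1)" for r by (simp_all add: f_def g_def)
  define off where "off = length \<gamma> - length \<beta>"
  have inn: "(r, c) \<in> inner \<gamma> \<beta> \<longleftrightarrow> off < r \<and> (r - off, c) \<in> diag \<beta>" for r c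
    using inner_iff[OF lb] by (simp add: off_def)
  have cut: "\<tau>' (r, c) = \<sigma> (if r < r1 then r else r + 1, c)" if "t = 1" for r c
    using that ph(2) by (simp add: cutrow_def)
  have len: "length \<gamma>' = (if t = 1 then length \<gamma> - 1 else length \<gamma>)"
    using ph(1) l(1,2) by simp
  show ?thesis
  proof (cases "P x")
    case False
    then have hn: "holds P (new r) \<longleftrightarrow> holds P (f r)" for r
      using holds_new_unchanged[OF P, of r] x by simp
    then have h\<sigma>: "holds P (\<sigma> b) \<longleftrightarrow> b \<in> inner \<gamma> \<beta>" for b
      unfolding hb[symmetric] by (cases b) (simp add: \<sigma> f_def)
    have "barshape P \<gamma>' \<tau>' \<beta>"
    proof (cases "t = 1")
      case True
      have "(r1, 1) \<notin> inner \<gamma> \<beta>"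
      proof -
        have "\<not> holds P (f r1)" using hn[of r1] by (simp add: new_def)
        then show ?thesis using True unfolding hb[symmetric] by (simp add: f_def)
      qed
      then have no: "\<not> (off < r1 \<and> (r1 - off, 1) \<in> diag \<beta>)" unfolding inn .
      \<comment> \<open>Every row of the inner shape begins with a large letter and the deleted row
        does not, so it lies above the inner shape, whose offset drops by one.\<close>
      have "r1 \<le> off"
      proof (rule ccontr)
        assume "\<not> r1 \<le> off"
        then have "1 \<le> r1 - off" "r1 - off \<le> length \<beta>" using l(2) lb unfolding off_def by linarith+
        then show False using first_in_diag[OF cb] no \<open>\<not> r1 \<le> off\<close> by simp
      qed
      then have off: "length \<gamma>' - length \<beta> = off - 1" "1 \<le> off" "length \<beta> \<le> length \<gamma>'"
        using len True l(1) by (auto simp: off_def)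
      have "holds P (\<tau>' (r, c)) \<longleftrightarrow> (r, c) \<in> inner \<gamma>' \<beta>" for r c
        unfolding cut[OF True] h\<sigma> inn inner_iff[OF off(3)] off(1)
        using off \<open>r1 \<le> off\<close> by auto
      then show ?thesis using cb off(3) by (auto simp: barshape_def)
    next
      case False
      then show ?thesis using h\<sigma> cb lb len ph(2) by (auto simp: barshape_def inner_def)
    qed
    then show ?thesis using False by simp
  next
    case Px: True
    obtain q where q: "1 \<le> q" "q \<le> r1" "holds P (f q)" "\<not> holds P (new q)"
      "\<And>r. r \<noteq> q \<Longrightarrow> holds P (new r) = holds P (f r)"
      "\<And>r. holds P (f r) \<Longrightarrow> \<not> holds P (g r) \<Longrightarrow> r \<le> q"
      using holds_new_one_row[OF P] Px x by auto
    have h\<sigma>: "holds P (\<sigma> b) \<longleftrightarrow> b \<in> inner \<gamma> \<beta> \<and> b \<noteq> (q, t)" for b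
    proof -
      have "holds P (new r) \<longleftrightarrow> holds P (f r) \<and> r \<noteq> q" for r
        using q(4,5) by (cases "r = q") simp_all
      then show ?thesis unfolding hb[symmetric] by (cases b) (simp add: \<sigma> f\<tau>)
    qed
    have "holds P (\<tau> (q, t))" using q(3) by (simp add: f\<tau>)
    then have fq: "off < q" "(q - off, t) \<in> diag \<beta>" unfolding hb inn by simp_all
    have "\<not> holds P (g q)" using q(4) holds_mono[OF P _ g_le_new] by blast
    then have gq: "(q - off, t + 1) \<notin> diag \<beta>"
      using hb[of "(q, t + 1)"] inn[of q "t + 1"] fq(1) by (simp add: g_def)
    have k: "1 \<le> q - off" "q - off \<le> length \<beta>" "\<beta> ! (q - off - 1) = t"
      using fq gq t(1) by (auto simp: diag_def)
    then have tb: "t \<in> set \<beta>" using nth_mem[of "q - off - 1" \<beta>] by auto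
    have ll: "lastrow t \<beta> = q - off"
      unfolding lastrow_def
    proof (rule Max_eqI)
      fix r assume "r \<in> {r. 1 \<le> r \<and> r \<le> length \<beta> \<and> \<beta> ! (r - 1) = t}"
      then have "(r, t) \<in> diag \<beta>" "(r, t + 1) \<notin> diag \<beta>" "1 \<le> r" using t(1) by (auto simp: diag_def)
      then have "holds P (f (r + off))" "\<not> holds P (g (r + off))"
        using hb[of "(r + off, t)"] hb[of "(r + off, t + 1)"] inn[of "r + off"]
        by (simp_all add: f\<tau> g\<tau>)
      then have "r + off \<le> q" using q(6) by blast
      then show "r \<le> q - off" by simp
    qed (use k in auto)
    then have dop: "dop t \<beta> = Some (if t = 1 then take (q - off - 1) \<beta> @ drop (q - off) \<beta>
                        else \<beta>[q - off - 1 := t - 1])" (is "_ = Some ?\<beta>'")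
      using dop_lastrow[OF tb] by (simp only: ll)
    have cb': "is_comp ?\<beta>'" by (rule is_comp_dop[OF cb dop t(1)])
    have "barshape P \<gamma>' \<tau>' ?\<beta>'"
    proof (cases "t = 1")
      case True
      \<comment> \<open>The first column grows downwards, so a large letter above row
        \<open>r1\<close> makes \<open>f r1\<close> large as well; then \<open>r1\<close> would be a
        second row losing a large letter.\<close>
      have "q = r1"
      proof (rule ccontr)
        assume n: "q \<noteq> r1"
        have "f q \<noteq> None" using q(3) by (cases "f q") simp_all
        then have "f q < f r1"
          unfolding f\<tau> True using f_r1 n q(2) True by (intro sct_first[OF s]) (simp_all add: f\<tau>)
        then have "holds P (f r1)" using holds_mono[OF P q(3)] by (meson less_imp_le)
        then show False using q(5)[of r1] n by (simp add: new_def)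
      qed
      have lenb: "length ?\<beta>' = length \<beta> - 1" using True k by simp
      then have off: "length \<gamma>' - length ?\<beta>' = off" "length ?\<beta>' \<le> length \<gamma>'"
        using len True k(1,2) lb by (auto simp: off_def)
      have "holds P (\<tau>' (r, c)) \<longleftrightarrow> (r, c) \<in> inner \<gamma>' ?\<beta>'" for r c
      proof -
        have 1: "(r, c) \<in> inner \<gamma>' ?\<beta>' \<longleftrightarrow> off < r \<and>
           (if r - off < q - off then (r - off, c) \<in> diag \<beta> else (r - off + 1, c) \<in> diag \<beta>)"
          unfolding inner_iff[OF off(2)] off(1) using diag_cut[OF k(1,2)] True by simp
        show ?thesis
          unfolding cut[OF True] h\<sigma> inn 1 using \<open>q = r1\<close> fq(1) by (auto simp: Suc_diff_le)
      qed
      then show ?thesis using cb' off(2) by (auto simp: barshape_def)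
    next
      case False
      then have e: "?\<beta>' = \<beta>[q - off - 1 := t - 1]" and e': "\<tau>' = \<sigma>" using ph(2) by simp_all
      have off: "length \<gamma>' - length ?\<beta>' = off" "length ?\<beta>' \<le> length \<gamma>'"
        using len False lb by (auto simp: off_def)
      have "holds P (\<tau>' (r, c)) \<longleftrightarrow> (r, c) \<in> inner \<gamma>' ?\<beta>'" for r c
        unfolding inner_iff[OF off(2)] off(1) unfolding e diag_decr[OF k t(1)] e' h\<sigma> inn
        using fq(1) by auto
      then show ?thesis using cb' off(2) by (auto simp: barshape_def)
    qed
    then show ?thesis using Px dop by auto
  qed
qed

section \<open>Iterated slides\<close>

text \<open>\<open>H\<close> lists the exits from column \<open>n\<close> down to column
  \<open>1\<close>, whence the index \<open>n - t\<close>. The exit rule can be asserted for the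
  final filling because the slides after that of column \<open>t\<close> change the columns
  \<open>t\<close> and \<open>t + 1\<close> only by renumbering rows.\<close>

lemma phiseq_props:
  assumes "ssrct \<gamma> [] \<tau>" "is_comp \<gamma>" "n = 0 \<or> n \<in> set \<gamma>" "phiseq n (\<gamma>, \<tau>) = ((\<gamma>', \<tau>'), H)"
  shows "vop n \<gamma> = Some \<gamma>' \<and> is_comp \<gamma>' \<and> ssrct \<gamma>' [] \<tau>' \<and> length H = n \<and>
    (\<forall>t. 1 \<le> t \<and> t \<le> n \<longrightarrow> H ! (n - t) \<in> col \<tau> t \<and> col \<tau>' t = col \<tau> t - {H ! (n - t)} \<and>
       (\<forall>r. Some (H ! (n - t)) \<le> \<tau>' (r, t) \<longrightarrow> Some (H ! (n - t)) < \<tau>' (r, t + 1))) \<and>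
    (\<forall>t. t = 0 \<or> n < t \<longrightarrow> col \<tau>' t = col \<tau> t) \<and> (\<forall>r. \<exists>q. \<forall>c>n. \<tau>' (r, c) = \<tau> (q, c))"
  using assms
proof (induction n arbitrary: \<gamma> \<tau> H)
  case 0
  then show ?case by auto
next
  case (Suc n)
  obtain \<gamma>1 \<tau>1 x where p: "phi (Suc n) (\<gamma>, \<tau>) = (\<gamma>1, \<tau>1, x)" by (cases "phi (Suc n) (\<gamma>, \<tau>)") auto
  obtain H' where H': "phiseq n (\<gamma>1, \<tau>1) = ((\<gamma>', \<tau>'), H')" "H = x # H'"
    using Suc.prems(4) p by (auto split: prod.splits)
  have t: "1 \<le> Suc n" "Suc n \<in> set \<gamma>" using Suc.prems(3) by auto
  note st = phi_step[OF Suc.prems(1,2) t p]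
  have "n = 0 \<or> n \<in> set \<gamma>1" using st(9) by (cases n) auto
  note IH = Suc.IH[OF st(3,2) this H'(1)]
  note IHe = IH[THEN conjunct2, THEN conjunct2, THEN conjunct2, THEN conjunct2, THEN conjunct1, rule_format]
  note IHc = IH[THEN conjunct2, THEN conjunct2, THEN conjunct2, THEN conjunct2, THEN conjunct2, THEN conjunct1, rule_format]
  note IHr = IH[THEN conjunct2, THEN conjunct2, THEN conjunct2, THEN conjunct2, THEN conjunct2, THEN conjunct2, rule_format]
  have "vop (Suc n) \<gamma> = Some \<gamma>'" using st(1) IH by simp
  moreover have "H ! (Suc n - t) \<in> col \<tau> t \<and> col \<tau>' t = col \<tau> t - {H ! (Suc n - t)} \<and>
       (\<forall>r. Some (H ! (Suc n - t)) \<le> \<tau>' (r, t) \<longrightarrow> Some (H ! (Suc n - t)) < \<tau>' (r, t + 1))"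
    if "1 \<le> t" "t \<le> Suc n" for t
  proof (cases "t = Suc n")
    case True
    have "Some x < \<tau>' (r, t + 1)" if "Some x \<le> \<tau>' (r, t)" for r
    proof -
      obtain q where "\<forall>c>n. \<tau>' (r, c) = \<tau>1 (q, c)" using IHr by blast
      then show ?thesis using that st(7)[of q] True by simp
    qed
    then show ?thesis using True H'(2) st(4,5) IHc[of "Suc n"] by simp
  next
    case False
    then have "H ! (Suc n - t) = H' ! (n - t)" "t \<le> n" using that H'(2) by (auto simp: Suc_diff_le)
    moreover have "H' ! (n - t) \<in> col \<tau>1 t \<and> col \<tau>' t = col \<tau>1 t - {H' ! (n - t)} \<and>
       (\<forall>r. Some (H' ! (n - t)) \<le> \<tau>' (r, t) \<longrightarrow> Some (H' ! (n - t)) < \<tau>' (r, t + 1))"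
      using IHe[OF conjI[OF that(1) \<open>t \<le> n\<close>]] by simp
    ultimately show ?thesis using st(6)[OF False] by simp
  qed
  moreover have "\<exists>q. \<forall>c>Suc n. \<tau>' (r, c) = \<tau> (q, c)" for r
  proof -
    obtain q where q: "\<forall>c>n. \<tau>' (r, c) = \<tau>1 (q, c)" using IHr by blast
    obtain q' where "\<forall>c>Suc n. \<tau>1 (q, c) = \<tau> (q', c)" using st(8) by blast
    then show ?thesis using q by (intro exI[of _ q']) auto
  qed
  moreover have "col \<tau>' t = col \<tau> t" if "t = 0 \<or> Suc n < t" for t
  proof -
    have "t \<noteq> Suc n" "t = 0 \<or> n < t" using that by auto
    then show ?thesis using IHc[of t] st(6)[of t] by simp
  qed
  moreover have "is_comp \<gamma>'" "ssrct \<gamma>' [] \<tau>'" "length H = Suc n" using IH H'(2) by simp_all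
  ultimately show ?case by blast
qed

text \<open>While the exits are small the inner shape stays. From the first large exit on, all exits
  are large because \<open>H\<close> is sorted; if that slide is in column \<open>J\<close>, the
  remaining ones perform \<open>dop J\<close>, ..., \<open>dop 1\<close>, which is
  \<open>vop J\<close>.\<close>

lemma phiseq_barshape:
  assumes "ssrct \<gamma> [] \<tau>" "is_comp \<gamma>" "n = 0 \<or> n \<in> set \<gamma>" "phiseq n (\<gamma>, \<tau>) = ((\<gamma>', \<tau>'), H)"
    "upclosed P" "barshape P \<gamma> \<tau> \<beta>" "sorted H"
  shows "\<exists>\<beta>'. vop (length (filter P H)) \<beta> = Some \<beta>' \<and> barshape P \<gamma>' \<tau>' \<beta>'"
  using assms
proof (induction n arbitrary: \<gamma> \<tau> H \<beta>)
  case 0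
  then show ?case by auto
next
  case (Suc n)
  obtain \<gamma>1 \<tau>1 x where p: "phi (Suc n) (\<gamma>, \<tau>) = (\<gamma>1, \<tau>1, x)" by (cases "phi (Suc n) (\<gamma>, \<tau>)") auto
  obtain H' where H': "phiseq n (\<gamma>1, \<tau>1) = ((\<gamma>', \<tau>'), H')" "H = x # H'"
    using Suc.prems(4) p by (auto split: prod.splits)
  have t: "1 \<le> Suc n" "Suc n \<in> set \<gamma>" using Suc.prems(3) by auto
  note st = phi_step[OF Suc.prems(1,2) t p]
  have n: "n = 0 \<or> n \<in> set \<gamma>1" using st(9) by (cases n) auto
  have so: "sorted H'" using Suc.prems(7) H' by simp
  note IH = Suc.IH[OF st(3,2) n H'(1) Suc.prems(5) _ so]
  note pb = phi_barshape[OF Suc.prems(1,2) t p Suc.prems(5,6)]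
  have len: "length H' = n" using phiseq_props[OF st(3,2) n H'(1)] by simp
  show ?case
  proof (cases "P x")
    case True
    have "\<forall>y\<in>set H'. P y" using Suc.prems(5,7) H'(2) True by (auto simp: upclosed_def)
    then have "filter P H' = H'" by (simp add: filter_id_conv)
    then show ?thesis using True H'(2) len pb IH by auto
  next
    case False
    then show ?thesis using H'(2) pb IH by simp
  qed
qed

section \<open>Counting the entries above a letter\<close>

definition cnt :: "('a::linorder) filling \<Rightarrow> nat \<Rightarrow> 'a \<Rightarrow> nat" where
  "cnt \<tau> c y = card {z \<in> col \<tau> c. y < z}"

lemma finite_diag [simp]: "finite (diag \<gamma>)"
proof -
  have "diag \<gamma> \<subseteq> {..length \<gamma>} \<times> {..sum_list \<gamma>}"
  proof
    fix b assume "b \<in> diag \<gamma>"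
    then obtain r c where b: "b = (r, c)" "r - 1 < length \<gamma>" "r \<le> length \<gamma>" "c \<le> \<gamma> ! (r - 1)"
      by (auto simp: diag_def)
    then show "b \<in> {..length \<gamma>} \<times> {..sum_list \<gamma>}"
      using elem_le_sum_list[of "r - 1" \<gamma>] by simp
  qed
  then show ?thesis by (rule finite_subset) simp
qed

lemma finite_col: "finite (dom \<tau>) \<Longrightarrow> finite (col \<tau> c)"
proof -
  assume "finite (dom \<tau>)"
  moreover have "col \<tau> c \<subseteq> (\<lambda>b. the (\<tau> b)) ` dom \<tau>" by (force simp: col_def)
  ultimately show ?thesis using finite_surj by blast
qed

lemma cnt_rows:
  assumes "sct \<tau>" "1 \<le> c"
  shows "cnt \<tau> c y = card {r. Some y < \<tau> (r, c)}"
proof -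
  have "bij_betw (\<lambda>r. the (\<tau> (r, c))) {r. Some y < \<tau> (r, c)} {z \<in> col \<tau> c. y < z}"
  proof (rule bij_betwI')
    fix r s assume "r \<in> {r. Some y < \<tau> (r, c)}" "s \<in> {r. Some y < \<tau> (r, c)}"
    then show "the (\<tau> (r, c)) = the (\<tau> (s, c)) \<longleftrightarrow> r = s"
      using sct_column_inj[OF assms, of r s] by (cases "\<tau> (r, c)"; cases "\<tau> (s, c)") auto
  next
    fix r assume "r \<in> {r. Some y < \<tau> (r, c)}"
    then show "the (\<tau> (r, c)) \<in> {z \<in> col \<tau> c. y < z}"
      by (cases "\<tau> (r, c)") (auto simp: col_def)
  next
    fix z assume "z \<in> {z \<in> col \<tau> c. y < z}"
    then obtain r where "\<tau> (r, c) = Some z" "y < z" by (auto simp: col_def)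
    then show "\<exists>r\<in>{r. Some y < \<tau> (r, c)}. z = the (\<tau> (r, c))" by (intro bexI[of _ r]) auto
  qed
  then show ?thesis by (simp add: cnt_def bij_betw_same_card)
qed

lemma finite_rows: "finite (dom \<tau>) \<Longrightarrow> finite {r. Some y < \<tau> (r, c)}"
proof -
  assume "finite (dom \<tau>)"
  moreover have "{r. Some y < \<tau> (r, c)} \<subseteq> fst ` dom \<tau>"
  proof
    fix r assume "r \<in> {r. Some y < \<tau> (r, c)}"
    then have "(r, c) \<in> dom \<tau>" by (cases "\<tau> (r, c)") auto
    then show "r \<in> fst ` dom \<tau>" by force
  qed
  ultimately show ?thesis using finite_surj by blast
qed

lemma cnt_Suc_le:
  assumes "sct \<tau>" "finite (dom \<tau>)" "1 \<le> c"
  shows "cnt \<tau> (c + 1) y \<le> cnt \<tau> c y"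
proof -
  have "{r. Some y < \<tau> (r, c + 1)} \<subseteq> {r. Some y < \<tau> (r, c)}"
    using sct_row[OF assms(1,3)] by (auto intro: less_le_trans)
  then show ?thesis
    using cnt_rows[OF assms(1)] assms(3) card_mono[OF finite_rows[OF assms(2)]] by simp
qed

lemma cnt_remove:
  assumes "finite (col \<tau> c)" "x \<in> col \<tau> c" "col \<tau>' c = col \<tau> c - {x}"
  shows "cnt \<tau> c y = cnt \<tau>' c y + (if y < x then 1 else 0)"
proof (cases "y < x")
  case True
  have "{z \<in> col \<tau> c. y < z} = insert x {z \<in> col \<tau>' c. y < z}" using assms True by auto
  moreover have "finite {z \<in> col \<tau>' c. y < z}" "x \<notin> {z \<in> col \<tau>' c. y < z}" using assms by auto
  ultimately show ?thesis using True by (simp add: cnt_def)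
next
  case False
  then have "{z \<in> col \<tau> c. y < z} = {z \<in> col \<tau>' c. y < z}" using assms by auto
  then show ?thesis using False by (simp add: cnt_def)
qed

lemma cnt_exit:
  assumes "sct \<tau>'" "finite (dom \<tau>')" "1 \<le> t"
    and "\<And>r. Some x \<le> \<tau>' (r, t) \<Longrightarrow> Some x < \<tau>' (r, t + 1)"
  shows "cnt \<tau>' t x \<le> cnt \<tau>' (t + 1) x"
proof -
  have "{r. Some x < \<tau>' (r, t)} \<subseteq> {r. Some x < \<tau>' (r, t + 1)}" using assms(4) by auto
  then show ?thesis
    using cnt_rows[OF assms(1)] assms(3) card_mono[OF finite_rows[OF assms(2)]] by simp
qed

text \<open>Let \<open>x\<close> be the exit of column \<open>t\<close> and suppose that of column
  \<open>t + 1\<close> is larger. The slides then lower the number of entries above \<open>x\<close>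
  by one in column \<open>t + 1\<close> and not in column \<open>t\<close>. Afterwards the exit rule
  makes the number in column \<open>t + 1\<close> at least that in column \<open>t\<close>, so it
  was strictly larger before, against the row condition.\<close>

lemma phiseq_sorted:
  assumes "ssrct \<gamma> [] \<tau>" "is_comp \<gamma>" "n = 0 \<or> n \<in> set \<gamma>" "phiseq n (\<gamma>, \<tau>) = ((\<gamma>', \<tau>'), H)"
  shows "sorted H"
proof -
  note ps = phiseq_props[OF assms]
  have s: "sct \<tau>" "finite (dom \<tau>)" using assms(1) by (auto simp: ssrct_Nil_iff)
  have s': "sct \<tau>'" "finite (dom \<tau>')" using ps by (auto simp: ssrct_Nil_iff)
  have mono: "H ! (n - (t + 1)) \<le> H ! (n - t)" if t: "1 \<le> t" "t < n" for t
  proof (rule ccontr)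
    let ?x = "H ! (n - t)" and ?z = "H ! (n - (t + 1))"
    assume "\<not> ?z \<le> ?x"
    then have lt: "?x < ?z" by simp
    have 1: "cnt \<tau> t ?x = cnt \<tau>' t ?x"
      using cnt_remove[OF finite_col[OF s(2)], of ?x t \<tau>' ?x] ps t by auto
    have 2: "cnt \<tau> (t + 1) ?x = cnt \<tau>' (t + 1) ?x + 1"
      using cnt_remove[OF finite_col[OF s(2)], of ?z "t + 1" \<tau>' ?x] ps t lt by auto
    have 3: "cnt \<tau>' t ?x \<le> cnt \<tau>' (t + 1) ?x"
      by (rule cnt_exit[OF s' t(1)]) (use ps t in auto)
    show False using 1 2 3 cnt_Suc_le[OF s t(1), of ?x] by simp
  qed
  show ?thesis
    unfolding sorted_iff_nth_Suc
  proof (intro allI impI)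
    fix k assume "Suc k < length H"
    then have "1 \<le> n - Suc k" "n - Suc k < n" "n - (n - Suc k + 1) = k" "n - (n - Suc k) = Suc k"
      using ps by auto
    then show "H ! k \<le> H ! Suc k" using mono[of "n - Suc k"] by simp
  qed
qed

section \<open>Skew shapes\<close>

text \<open>A box outside the outer shape acts as a smallest letter and is covered by
  \<open>None\<close>. A box of the inner shape acts as a largest letter, so it remains a separate
  disjunct.\<close>

lemma ssrct_iff: "ssrct \<alpha> \<beta> \<sigma> \<longleftrightarrow> dom \<sigma> = skew \<alpha> \<beta> \<and>
    (\<forall>r c c'. \<sigma> (r, c) \<noteq> None \<longrightarrow> \<sigma> (r, c') \<noteq> None \<longrightarrow> c < c' \<longrightarrow> \<sigma> (r, c') \<le> \<sigma> (r, c)) \<and>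
    (\<forall>r s. r < s \<longrightarrow> \<sigma> (r, 1) \<noteq> None \<longrightarrow> \<sigma> (s, 1) \<noteq> None \<longrightarrow> \<sigma> (r, 1) < \<sigma> (s, 1)) \<and>
    (\<forall>r s c. r < s \<longrightarrow> 1 \<le> c \<longrightarrow> \<sigma> (s, c + 1) \<noteq> None \<longrightarrow>
       (r, c) \<in> inner \<alpha> \<beta> \<or> \<sigma> (s, c + 1) \<le> \<sigma> (r, c) \<longrightarrow>
       (r, c + 1) \<in> inner \<alpha> \<beta> \<or> \<sigma> (s, c + 1) < \<sigma> (r, c + 1))"
proof (cases "dom \<sigma> = skew \<alpha> \<beta>")
  case True
  have D: "b \<in> skew \<alpha> \<beta> \<longleftrightarrow> \<sigma> b \<noteq> None" for b using True by auto
  have le: "u \<noteq> None \<Longrightarrow> u \<le> v \<longleftrightarrow> v \<noteq> None \<and> the u \<le> the v"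
    and lt: "u \<noteq> None \<Longrightarrow> u < v \<longleftrightarrow> v \<noteq> None \<and> the u < the v" for u v :: "'a option"
    by (cases u; cases v; simp)+
  have 1: "(\<forall>r c c'. \<sigma> (r, c) \<noteq> None \<and> \<sigma> (r, c') \<noteq> None \<and> c < c' \<longrightarrow> the (\<sigma> (r, c')) \<le> the (\<sigma> (r, c)))
     \<longleftrightarrow> (\<forall>r c c'. \<sigma> (r, c) \<noteq> None \<longrightarrow> \<sigma> (r, c') \<noteq> None \<longrightarrow> c < c' \<longrightarrow> \<sigma> (r, c') \<le> \<sigma> (r, c))"
    using le by meson
  have 2: "(\<forall>r s. r < s \<and> \<sigma> (r, 1) \<noteq> None \<and> \<sigma> (s, 1) \<noteq> None \<longrightarrow> the (\<sigma> (r, 1)) < the (\<sigma> (s, 1)))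
     \<longleftrightarrow> (\<forall>r s. r < s \<longrightarrow> \<sigma> (r, 1) \<noteq> None \<longrightarrow> \<sigma> (s, 1) \<noteq> None \<longrightarrow> \<sigma> (r, 1) < \<sigma> (s, 1))"
    using lt by meson
  have 3: "(r < s \<and> 1 \<le> c \<and> \<sigma> (s, c + 1) \<noteq> None \<and>
        ((r, c) \<in> inner \<alpha> \<beta> \<or> \<sigma> (r, c) \<noteq> None \<and> the (\<sigma> (s, c + 1)) \<le> the (\<sigma> (r, c))) \<longrightarrow>
        (r, c + 1) \<in> inner \<alpha> \<beta> \<or> \<sigma> (r, c + 1) \<noteq> None \<and> the (\<sigma> (s, c + 1)) < the (\<sigma> (r, c + 1)))
    \<longleftrightarrow> (r < s \<longrightarrow> 1 \<le> c \<longrightarrow> \<sigma> (s, c + 1) \<noteq> None \<longrightarrow>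
       (r, c) \<in> inner \<alpha> \<beta> \<or> \<sigma> (s, c + 1) \<le> \<sigma> (r, c) \<longrightarrow>
       (r, c + 1) \<in> inner \<alpha> \<beta> \<or> \<sigma> (s, c + 1) < \<sigma> (r, c + 1))" for r s c
    using le[of "\<sigma> (s, c + 1)" "\<sigma> (r, c)"] lt[of "\<sigma> (s, c + 1)" "\<sigma> (r, c + 1)"] by meson
  show ?thesis unfolding ssrct_def D 1 2 3 using True by simp
qed (simp add: ssrct_def)

lemma ssrct_dom: "ssrct \<alpha> \<beta> \<sigma> \<Longrightarrow> \<sigma> b \<noteq> None \<longleftrightarrow> b \<in> skew \<alpha> \<beta>"
  unfolding ssrct_def by (metis domIff)

lemmas ssrct_row = ssrct_iff[THEN iffD1, THEN conjunct2, THEN conjunct1, rule_format]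

lemmas ssrct_first = ssrct_iff[THEN iffD1, THEN conjunct2, THEN conjunct2, THEN conjunct1, rule_format]

lemmas ssrct_triple = ssrct_iff[THEN iffD1, THEN conjunct2, THEN conjunct2, THEN conjunct2, rule_format]

section \<open>From fillings to chains of covers\<close>

lemma is_comp_update: "is_comp \<alpha> \<Longrightarrow> 0 < x \<Longrightarrow> is_comp (\<alpha>[k := x])"
  unfolding is_comp_def by (auto dest!: set_update_subset_insert[THEN subsetD])

lemma diag_eqD:
  assumes "is_comp \<alpha>" "is_comp \<beta>" "diag \<alpha> = diag \<beta>"
  shows "\<alpha> = \<beta>"
proof -
  have le: "length \<alpha> \<le> length \<beta>" "k < length \<alpha> \<Longrightarrow> \<alpha> ! k \<le> \<beta> ! k"
    if h: "is_comp \<alpha>" "diag \<alpha> \<subseteq> diag \<beta>" for \<alpha> \<beta> :: "nat list" and k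
  proof -
    show "length \<alpha> \<le> length \<beta>"
    proof (cases "\<alpha> = []")
      case False
      then have "(length \<alpha>, 1) \<in> diag \<beta>" using h first_in_diag[of \<alpha> "length \<alpha>"] by (auto simp: Suc_le_eq)
      then show ?thesis by (auto simp: diag_def)
    qed simp
    assume k: "k < length \<alpha>"
    then have "(Suc k, \<alpha> ! k) \<in> diag \<alpha>" using h(1) by (auto simp: diag_def is_comp_def Suc_le_eq)
    then have "(Suc k, \<alpha> ! k) \<in> diag \<beta>" using h(2) by blast
    then show "\<alpha> ! k \<le> \<beta> ! k" by (simp add: diag_def)
  qed
  have "length \<alpha> = length \<beta>" using le(1)[of \<alpha> \<beta>] le(1)[of \<beta> \<alpha>] assms by auto
  then show ?thesis
    using le(2)[of \<alpha> \<beta>] le(2)[of \<beta> \<alpha>] assms by (auto intro!: nth_equalityI simp: le_antisym)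
qed

lemma inner_closed: "(r, c) \<in> inner \<alpha> \<beta> \<Longrightarrow> 1 \<le> b \<Longrightarrow> b \<le> c \<Longrightarrow> (r, b) \<in> inner \<alpha> \<beta>"
  by (auto simp: inner_def)

lemma inner_first:
  assumes "is_comp \<beta>" "length \<beta> \<le> length \<alpha>" "length \<alpha> - length \<beta> < r" "r \<le> length \<alpha>"
  shows "(r, 1) \<in> inner \<alpha> \<beta>"
proof -
  have "1 \<le> r - (length \<alpha> - length \<beta>)" "r - (length \<alpha> - length \<beta>) \<le> length \<beta>"
    using assms(2-4) by linarith+
  then show ?thesis unfolding inner_iff[OF assms(2)] using assms(1,3) first_in_diag by blast
qed

text \<open>Conversely to the definition of the order by covers, a filling yields a chain of covers:
  remove the smallest entry, the rightmost one if there are ties.\<close>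

lemma ssrct_leq_c:
  assumes "is_comp Y" "is_comp X" "length X \<le> length Y" "inner Y X \<subseteq> diag Y" "ssrct Y X \<sigma>"
  shows "leq_c X Y"
  using assms
proof (induction "card (skew Y X)" arbitrary: Y \<sigma> rule: less_induct)
  case less
  note Y = less.prems(1) and len = less.prems(3) and sub = less.prems(4) and ss = less.prems(5)
  have fin: "finite (skew Y X)" by (simp add: skew_def)
  show ?case
  proof (cases "skew Y X = {}")
    case True
    then have eq: "diag Y = inner Y X" using sub by (auto simp: skew_def)
    have "length Y = length X"
    proof (rule ccontr)
      assume "length Y \<noteq> length X"
      then have "1 \<le> length Y" "\<not> length Y - length X < 1" using len by auto
      then show False using first_in_diag[OF Y, of 1] eq by (auto simp: inner_def)
    qed
    then have "inner Y X = diag X" using inner_iff[of X Y] by (auto simp: diag_def)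
    then have "Y = X" using diag_eqD[OF Y less.prems(2)] eq by simp
    then show ?thesis by (simp add: leq_c_def)
  next
    case False
    define m where "m = Min (\<sigma> ` skew Y X)"
    have "m \<in> \<sigma> ` skew Y X" unfolding m_def using fin False by (intro Min_in) auto
    have min: "m \<le> \<sigma> b" if "b \<in> skew Y X" for b unfolding m_def using fin that by (intro Min_le) auto
    define C where "C = snd ` {b \<in> skew Y X. \<sigma> b = m}"
    define c where "c = Max C"
    have finC: "finite C" "C \<noteq> {}" unfolding C_def using fin \<open>m \<in> \<sigma> ` skew Y X\<close> by auto
    then have "c \<in> C" unfolding c_def by (intro Max_in)
    then obtain r where rc: "(r, c) \<in> skew Y X" "\<sigma> (r, c) = m" unfolding C_def by auto
    have cmax: "b \<le> c" if "(q, b) \<in> skew Y X" "\<sigma> (q, b) = m" for q b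
      unfolding c_def using finC that by (intro Max_ge) (force simp: C_def)+
    have rcY: "(r, c) \<in> diag Y" "(r, c) \<notin> inner Y X" using rc by (auto simp: skew_def)
    then have r: "1 \<le> r" "r \<le> length Y" "1 \<le> c" "c \<le> Y ! (r - 1)" by (auto simp: diag_def)
    have rowend: "Y ! (r - 1) = c"
    proof (rule ccontr)
      assume "Y ! (r - 1) \<noteq> c"
      then have "(r, c + 1) \<in> diag Y" using r by (auto simp: diag_def)
      moreover have "(r, c + 1) \<notin> inner Y X" using rcY inner_closed[of r "c + 1" Y X c] r by auto
      ultimately have n: "(r, c + 1) \<in> skew Y X" by (simp add: skew_def)
      then have "\<sigma> (r, c + 1) \<le> m"
        using ssrct_row[OF ss, of r c "c + 1"] rc ssrct_dom[OF ss] by auto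
      then have "\<sigma> (r, c + 1) = m" using min[OF n] by simp
      then show False using cmax[OF n] by simp
    qed
    show ?thesis
    proof (cases "c = 1")
      case True
      have off: "r \<le> length Y - length X"
        using inner_first[OF less.prems(2) len, of r] rcY r True by force
      \<comment> \<open>Otherwise the first box of row \<open>1\<close> also lies outside the inner
        shape, and by the increasing first column its entry would be below the minimum.\<close>
      have "r = 1"
      proof (rule ccontr)
        assume "r \<noteq> 1"
        then have "(1, 1) \<in> skew Y X"
          using first_in_diag[OF Y, of 1] r off by (auto simp: skew_def inner_def)
        then show False
          using ssrct_first[OF ss, of 1 r] min[of "(1, 1)"] rc True ssrct_dom[OF ss] \<open>r \<noteq> 1\<close> r by force
      qed
      then obtain Y' where Y': "Y = 1 # Y'" using rowend True r by (cases Y) auto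
      have len': "length X \<le> length Y'" using off \<open>r = 1\<close> Y' by auto
      have dg: "(q, b) \<in> diag Y' \<longleftrightarrow> 1 \<le> q \<and> (q + 1, b) \<in> diag Y" for q b
        using Y' by (cases q) (auto simp: diag_def)
      have inn: "(q, b) \<in> inner Y' X \<longleftrightarrow> (q + 1, b) \<in> inner Y X" for q b
        unfolding inner_iff[OF len'] inner_iff[OF len] using Y' len' by (auto simp: Suc_diff_le)
      have inn0: "(q, b) \<in> inner Y X \<Longrightarrow> 1 < q" for q b
        using off \<open>r = 1\<close> by (auto simp: inner_def)
      have sk: "(q, b) \<in> skew Y' X \<longleftrightarrow> 1 \<le> q \<and> (q + 1, b) \<in> skew Y X" for q b
        by (auto simp: skew_def dg inn)
      define \<sigma>' where "\<sigma>' = (\<lambda>(q, b). if 1 \<le> q then \<sigma> (q + 1, b) else None)"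
      have \<sigma>': "\<sigma>' (q, b) = (if 1 \<le> q then \<sigma> (q + 1, b) else None)" for q b by (simp add: \<sigma>'_def)
      have "\<sigma>' (q, b) \<noteq> None \<longleftrightarrow> (q, b) \<in> skew Y' X" for q b
        unfolding sk \<sigma>' using ssrct_dom[OF ss] by auto
      then have "dom \<sigma>' = skew Y' X" by (force simp: dom_def)
      moreover have "\<sigma>' (q, b') \<le> \<sigma>' (q, b)" if "\<sigma>' (q, b) \<noteq> None" "\<sigma>' (q, b') \<noteq> None" "b < b'" for q b b'
        using that ssrct_row[OF ss, of "q + 1" b b'] unfolding \<sigma>' by (simp split: if_splits)
      moreover have "\<sigma>' (q, 1) < \<sigma>' (s, 1)" if "q < s" "\<sigma>' (q, 1) \<noteq> None" "\<sigma>' (s, 1) \<noteq> None" for q s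
        using that ssrct_first[OF ss, of "q + 1" "s + 1"] unfolding \<sigma>' by (simp split: if_splits)
      moreover have "(q, b + 1) \<in> inner Y' X \<or> \<sigma>' (s, b + 1) < \<sigma>' (q, b + 1)"
        if h: "q < s" "1 \<le> b" "\<sigma>' (s, b + 1) \<noteq> None" "(q, b) \<in> inner Y' X \<or> \<sigma>' (s, b + 1) \<le> \<sigma>' (q, b)" for q s b
      proof -
        have "1 \<le> q" using h(3,4) inn0[of "q + 1" b] unfolding inn \<sigma>'
          by (cases "1 \<le> q"; cases "\<sigma> (s + 1, b + 1)") auto
        then show ?thesis
          using h ssrct_triple[OF ss, of "q + 1" "s + 1" b] unfolding inn \<sigma>' by (simp split: if_splits)
      qed
      ultimately have "ssrct Y' X \<sigma>'" unfolding ssrct_iff by blast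
      moreover have "card (skew Y' X) < card (skew Y X)"
      proof -
        have "(\<lambda>(q, b). (q + 1, b)) ` skew Y' X \<subset> skew Y X"
          using sk rc \<open>r = 1\<close> by force
        then have "card ((\<lambda>(q, b). (q + 1, b)) ` skew Y' X) < card (skew Y X)"
          using fin by (rule psubset_card_mono[rotated])
        moreover have "inj_on (\<lambda>(q, b). (q + 1, b)) (skew Y' X)" by (auto simp: inj_on_def)
        ultimately show ?thesis by (simp add: card_image)
      qed
      moreover have "is_comp Y'" using Y Y' by (simp add: is_comp_def)
      moreover have "inner Y' X \<subseteq> diag Y'" using sub inn dg inn0 by force
      ultimately have "leq_c X Y'" using less.hyps less.prems(2) len' by blast
      moreover have "cover_c Y' Y" using Y' by (simp add: cover_c_def)
      ultimately show ?thesis unfolding leq_c_def by (rule rtranclp.rtrancl_into_rtrancl)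
    next
      case False
      define Y' where "Y' = Y[r - 1 := c - 1]"
      have len': "length Y' = length Y" by (simp add: Y'_def)
      have dg: "b \<in> diag Y' \<longleftrightarrow> b \<in> diag Y \<and> b \<noteq> (r, c)" for b
        unfolding Y'_def by (rule diag_decr[OF r(1,2) rowend r(3)])
      have inn: "inner Y' X = inner Y X" by (simp add: inner_def len')
      have sk: "skew Y' X = skew Y X - {(r, c)}" by (auto simp: skew_def dg inn)
      define \<sigma>' where "\<sigma>' = \<sigma>((r, c) := None)"
      have \<sigma>'le: "\<sigma>' b \<noteq> None \<Longrightarrow> \<sigma>' b = \<sigma> b" "\<sigma>' b \<le> \<sigma> b" for b by (auto simp: \<sigma>'_def)
      have "dom \<sigma>' = skew Y' X" using ss unfolding sk \<sigma>'_def by (auto simp: ssrct_def)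
      moreover have "\<sigma>' (q, b') \<le> \<sigma>' (q, b)" if "\<sigma>' (q, b) \<noteq> None" "\<sigma>' (q, b') \<noteq> None" "b < b'" for q b b'
        using that ssrct_row[OF ss, of q b b'] \<sigma>'le(1) by metis
      moreover have "\<sigma>' (q, 1) < \<sigma>' (s, 1)" if "q < s" "\<sigma>' (q, 1) \<noteq> None" "\<sigma>' (s, 1) \<noteq> None" for q s
        using that ssrct_first[OF ss, of q s] \<sigma>'le(1) by metis
      moreover have "(q, b + 1) \<in> inner Y' X \<or> \<sigma>' (s, b + 1) < \<sigma>' (q, b + 1)"
        if h: "q < s" "1 \<le> b" "\<sigma>' (s, b + 1) \<noteq> None" "(q, b) \<in> inner Y' X \<or> \<sigma>' (s, b + 1) \<le> \<sigma>' (q, b)" for q s b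
      proof -
        have eq: "\<sigma>' (s, b + 1) = \<sigma> (s, b + 1)" by (rule \<sigma>'le(1)[OF h(3)])
        have "(q, b + 1) \<in> inner Y X \<or> \<sigma> (s, b + 1) < \<sigma> (q, b + 1)"
          using h \<sigma>'le(2)[of "(q, b)"] unfolding inn eq
          by (intro ssrct_triple[OF ss]) (auto intro: order_trans)
        \<comment> \<open>The removed box is never the larger entry demanded by a triple, since it
          holds the minimum.\<close>
        moreover have "(q, b + 1) \<noteq> (r, c)" if "\<sigma> (s, b + 1) < \<sigma> (q, b + 1)"
        proof
          assume "(q, b + 1) = (r, c)"
          then have "\<sigma> (s, b + 1) < m" using that rc(2) by simp
          then show False using min[of "(s, b + 1)"] h(3) eq ssrct_dom[OF ss, of "(s, b + 1)"] by auto
        qed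
        ultimately show ?thesis unfolding inn eq by (auto simp: \<sigma>'_def)
      qed
      ultimately have "ssrct Y' X \<sigma>'" unfolding ssrct_iff by blast
      moreover have "card (skew Y' X) < card (skew Y X)"
        unfolding sk using rc(1) fin by (rule card_Diff1_less[rotated])
      moreover have Yc: "is_comp Y'" unfolding Y'_def using Y r False by (intro is_comp_update) auto
      moreover have "inner Y' X \<subseteq> diag Y'" using sub dg rcY unfolding inn by auto
      ultimately have "leq_c X Y'" using less.hyps less.prems(2) len len' by metis
      moreover have "cover_c Y' Y"
      proof -
        have "Y = Y'[r - 1 := Y' ! (r - 1) + 1]" using r rowend by (auto simp: Y'_def)
        \<comment> \<open>The last box of a higher row of length \<open>c - 1\<close> is inner or
          holds at least the minimum, so the triple rule with \<open>(r, c)\<close> would force that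
          row to reach column \<open>c\<close>.\<close>
        moreover have "Y' ! s \<noteq> Y' ! (r - 1)" if "s < r - 1" for s
        proof
          assume "Y' ! s = Y' ! (r - 1)"
          then have Ys: "Y ! s = c - 1" using that r by (simp add: Y'_def)
          then have "(s + 1, c - 1) \<in> diag Y" using that r False by (auto simp: diag_def)
          then have "(s + 1, c - 1) \<in> inner Y X \<or> \<sigma> (r, c - 1 + 1) \<le> \<sigma> (s + 1, c - 1)"
            using min[of "(s + 1, c - 1)"] rc(2) r(3) by (auto simp: skew_def)
          then have "(s + 1, c - 1 + 1) \<in> inner Y X \<or> \<sigma> (r, c - 1 + 1) < \<sigma> (s + 1, c - 1 + 1)"
            using that False r rc ssrct_dom[OF ss, of "(r, c)"] by (intro ssrct_triple[OF ss]) auto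
          then have "(s + 1, c) \<in> inner Y X \<or> \<sigma> (s + 1, c) \<noteq> None"
            using r(3) by (cases "\<sigma> (s + 1, c)") auto
          then have "(s + 1, c) \<in> diag Y" using sub ssrct_dom[OF ss] by (auto simp: skew_def)
          then show False using Ys r(3) by (auto simp: diag_def)
        qed
        moreover have "r - 1 < length Y'" using r len' by simp
        ultimately show ?thesis unfolding cover_c_def by blast
      qed
      ultimately show ?thesis unfolding leq_c_def by (rule rtranclp.rtrancl_into_rtrancl)
    qed
  qed
qed

section \<open>Gluing and splitting along an inner shape\<close>

lemma leq_c_diag:
  assumes "leq_c \<beta> \<alpha>"
  shows "length \<beta> \<le> length \<alpha> \<and> (\<forall>k c. (k, c) \<in> diag \<beta> \<longrightarrow> (k + (length \<alpha> - length \<beta>), c) \<in> diag \<alpha>)"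
  using assms unfolding leq_c_def
proof (induction rule: rtranclp_induct)
  case (step \<alpha> \<alpha>')
  have "(length \<alpha>' = Suc (length \<alpha>) \<and> (\<forall>k c. (k, c) \<in> diag \<alpha> \<longrightarrow> (k + 1, c) \<in> diag \<alpha>')) \<or>
      (length \<alpha>' = length \<alpha> \<and> diag \<alpha> \<subseteq> diag \<alpha>')"
    using step.hyps(2) unfolding cover_c_def
    by (auto simp: diag_def nth_list_update nth_Cons')
  then show ?case
  proof (elim disjE conjE)
    assume h: "length \<alpha>' = Suc (length \<alpha>)" "\<forall>k c. (k, c) \<in> diag \<alpha> \<longrightarrow> (k + 1, c) \<in> diag \<alpha>'"
    have "k + (length \<alpha>' - length \<beta>) = k + (length \<alpha> - length \<beta>) + 1" for k
      using h(1) step.IH by (simp add: Suc_diff_le)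
    then show ?thesis using h step.IH by (metis le_SucI)
  next
    assume "length \<alpha>' = length \<alpha>" "diag \<alpha> \<subseteq> diag \<alpha>'"
    then show ?thesis using step.IH by (metis subsetD)
  qed
qed simp

lemma leq_c_inner: "leq_c \<beta> \<alpha> \<Longrightarrow> length \<beta> \<le> length \<alpha> \<and> inner \<alpha> \<beta> \<subseteq> diag \<alpha>"
proof -
  assume "leq_c \<beta> \<alpha>"
  note l = leq_c_diag[OF this]
  have "(r, c) \<in> diag \<alpha>" if "(r, c) \<in> inner \<alpha> \<beta>" for r c
    using that l unfolding inner_iff[OF conjunct1[OF l]] by (metis le_add_diff_inverse2 less_imp_le)
  then show ?thesis using l by auto
qed

text \<open>The skew rules treat an inner box as larger than every entry, and letters of an
  up-closed set realize this. If the lower box of a triple is inner, the comparison makes its upper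
  left box inner too, so every condition reduces to one of the two parts or holds by size.\<close>

lemma combine_ssrct:
  assumes cb: "is_comp \<beta>" and le: "leq_c \<beta> \<alpha>" and o: "ssrct \<alpha> \<beta> \<tau>o" "\<forall>x\<in>ran \<tau>o. \<not> P x"
    and b: "ssrct \<beta> [] \<tau>b" "\<forall>x\<in>ran \<tau>b. P x" and P: "upclosed P"
  shows "ssrct \<alpha> [] (combine \<alpha> \<beta> \<tau>o \<tau>b)" and "barshape P \<alpha> (combine \<alpha> \<beta> \<tau>o \<tau>b) \<beta>"
proof -
  define off where "off = length \<alpha> - length \<beta>"
  define C where "C = combine \<alpha> \<beta> \<tau>o \<tau>b"
  have len: "length \<beta> \<le> length \<alpha>" and sub: "inner \<alpha> \<beta> \<subseteq> diag \<alpha>" using leq_c_inner[OF le] by auto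
  have inn: "(r, c) \<in> inner \<alpha> \<beta> \<longleftrightarrow> off < r \<and> (r - off, c) \<in> diag \<beta>" for r c
    using inner_iff[OF len] by (simp add: off_def)
  have C: "C (r, c) = (if (r, c) \<in> inner \<alpha> \<beta> then \<tau>b (r - off, c) else \<tau>o (r, c))" for r c
    by (simp add: C_def combine_def off_def)
  have db: "dom \<tau>b = diag \<beta>" and sb: "sct \<tau>b" using b(1) by (auto simp: ssrct_Nil_iff)
  have Nb: "\<tau>b b \<noteq> None \<longleftrightarrow> b \<in> diag \<beta>" for b using db by auto
  have No: "\<tau>o b \<noteq> None \<longleftrightarrow> b \<in> diag \<alpha> \<and> b \<notin> inner \<alpha> \<beta>" for b
    using ssrct_dom[OF o(1)] by (simp add: skew_def)
  have hP: "holds P (C (r, c)) \<longleftrightarrow> (r, c) \<in> inner \<alpha> \<beta>" for r c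
  proof (cases "(r, c) \<in> inner \<alpha> \<beta>")
    case True
    then obtain x where "\<tau>b (r - off, c) = Some x" using Nb[of "(r - off, c)"] inn by auto
    then show ?thesis using True b(2) C ranI by fastforce
  next
    case False
    then show ?thesis using o(2) C ranI by (cases "\<tau>o (r, c)") fastforce+
  qed
  have less: "u < v" if "\<not> holds P u" "holds P v" for u v
    using holds_mono[OF P that(2)] that(1) by (meson not_le)
  have NC: "C (r, c) \<noteq> None \<longleftrightarrow> (r, c) \<in> diag \<alpha>" for r c
    using Nb[of "(r - off, c)"] No[of "(r, c)"] inn sub unfolding C by auto
  show "barshape P \<alpha> (combine \<alpha> \<beta> \<tau>o \<tau>b) \<beta>"
    using hP cb len unfolding C_def barshape_def by auto
  have lower: "(s, c) \<in> inner \<alpha> \<beta>" if "(r, c) \<in> inner \<alpha> \<beta>" "r < s" "(s, c) \<in> diag \<alpha>" "c = 1" for r s c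
    using that inner_first[OF cb len, of s] by (auto simp: inner_def diag_def)
  have "dom C = diag \<alpha>" using NC by (force simp: dom_def)
  moreover have "C (r, c') \<le> C (r, c)" if h: "C (r, c) \<noteq> None" "C (r, c') \<noteq> None" "c < c'" for r c c'
  proof (cases "(r, c) \<in> inner \<alpha> \<beta>")
    case True
    show ?thesis
    proof (cases "(r, c') \<in> inner \<alpha> \<beta>")
      case True
      then show ?thesis using \<open>(r, c) \<in> inner \<alpha> \<beta>\<close> sct_row_mono[OF sb, of c c'] h(3)
        by (simp add: C inner_def)
    next
      case False
      then show ?thesis using True hP less by (meson less_imp_le)
    qed
  next
    case False
    moreover have "1 \<le> c" using h(1) NC by (auto simp: diag_def)
    ultimately have "(r, c') \<notin> inner \<alpha> \<beta>" using inner_closed[of r c' \<alpha> \<beta> c] h(3) by auto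
    then show ?thesis using False h ssrct_row[OF o(1), of r c c'] by (simp add: C)
  qed
  moreover have "C (r, 1) < C (s, 1)" if h: "r < s" "C (r, 1) \<noteq> None" "C (s, 1) \<noteq> None" for r s
  proof (cases "(s, 1) \<in> inner \<alpha> \<beta>")
    case s: True
    show ?thesis
    proof (cases "(r, 1) \<in> inner \<alpha> \<beta>")
      case True
      have "r - off < s - off" using True s h(1) unfolding inn by auto
      then show ?thesis using s True h sct_first[OF sb] by (simp add: C)
    next
      case False
      then show ?thesis using s hP less by metis
    qed
  next
    case False
    moreover have "(r, 1) \<notin> inner \<alpha> \<beta>" using False lower h NC by blast
    ultimately show ?thesis using h ssrct_first[OF o(1), of r s] by (simp add: C)
  qed
  moreover have "C (s, c + 1) < C (r, c + 1)"
    if h: "r < s" "1 \<le> c" "C (s, c + 1) \<noteq> None" "C (s, c + 1) \<le> C (r, c)" for r s c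
  proof (cases "(s, c + 1) \<in> inner \<alpha> \<beta>")
    case True
    then have "holds P (C (r, c))" using hP holds_mono[OF P _ h(4)] by blast
    then have r: "(r, c) \<in> inner \<alpha> \<beta>" using hP by blast
    have "r - off < s - off" using True r h(1) unfolding inn by auto
    then have lt: "\<tau>b (s - off, c + 1) < \<tau>b (r - off, c + 1)"
      using sct_triple[OF sb, of "r - off" "s - off" c] h True r by (simp add: C)
    then have "\<tau>b (r - off, c + 1) \<noteq> None" by (cases "\<tau>b (r - off, c + 1)") auto
    then have "(r, c + 1) \<in> inner \<alpha> \<beta>" using r Nb unfolding inn by blast
    then show ?thesis using lt True by (simp add: C)
  next
    case False
    have "(r, c) \<in> inner \<alpha> \<beta> \<or> \<tau>o (s, c + 1) \<le> \<tau>o (r, c)"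
      using h(4) False by (auto simp: C split: if_splits)
    then have "(r, c + 1) \<in> inner \<alpha> \<beta> \<or> \<tau>o (s, c + 1) < \<tau>o (r, c + 1)"
      using ssrct_triple[OF o(1) h(1,2)] h(3) False by (simp add: C)
    moreover have "C (s, c + 1) < C (r, c + 1)" if "(r, c + 1) \<in> inner \<alpha> \<beta>"
      using that False hP less by blast
    ultimately show ?thesis using False by (auto simp: C)
  qed
  ultimately show "ssrct \<alpha> [] (combine \<alpha> \<beta> \<tau>o \<tau>b)"
    unfolding ssrct_iff skew_Nil inner_Nil C_def[symmetric] by blast
qed

lemma inner_one: "Y \<noteq> [] \<Longrightarrow> inner Y [1] = {(length Y, 1)}"
  by (cases Y rule: rev_cases) (auto simp: inner_def)

lemma filt_eq: "filt P G b = (if holds P (G b) then G b else None)"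
  and filt_Not_eq: "filt (\<lambda>x. \<not> P x) G b = (if holds P (G b) then None else G b)"
  by (cases "G b"; simp add: filt_def)+

text \<open>A large lower entry forces the upper entries of its triple to be large, and a large
  upper entry beats every small one; so the rules for \<open>G\<close> restrict to both
  parts.\<close>

lemma ssrct_split:
  assumes ss: "ssrct Y [1] G" and X: "is_comp X" "X \<noteq> []" "length X \<le> length Y" and P: "upclosed P"
    and in_eq: "{b. holds P (G b)} \<union> {(length Y, 1)} = inner Y X" and Yc: "is_comp Y"
  shows "ssrct Y X (filt (\<lambda>x. \<not> P x) G)" and "ssrct X [1] (lastrows (length Y) (length X) (filt P G))"
    and "inner Y X \<subseteq> diag Y"
proof -
  have Yne: "Y \<noteq> []" using X by auto
  have N: "G b \<noteq> None \<longleftrightarrow> b \<in> diag Y \<and> b \<noteq> (length Y, 1)" for b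
    unfolding ssrct_dom[OF ss] skew_def Diff_iff inner_one[OF Yne] by simp
  have last: "(length Y, 1) \<in> diag Y" using first_in_diag[OF Yc, of "length Y"] Yne by (simp add: Suc_le_eq)
  have hP: "b \<in> inner Y X \<longleftrightarrow> holds P (G b) \<or> b = (length Y, 1)" for b using in_eq by blast
  have hN: "holds P (G b) \<Longrightarrow> G b \<noteq> None" for b by (cases "G b") auto
  show sub: "inner Y X \<subseteq> diag Y" using hP hN N last by blast
  have triple: "G (s, c + 1) < G (r, c + 1)"
    if "r < s" "1 \<le> c" "G (s, c + 1) \<noteq> None" "G (s, c + 1) \<le> G (r, c)" for r s c
  proof -
    have "(r, c + 1) \<notin> inner Y [1]" using that(2) unfolding inner_one[OF Yne] by simp
    then show ?thesis using ssrct_triple[OF ss that(1-3)] that(4) by blast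
  qed
  define A where "A = filt (\<lambda>x. \<not> P x) G"
  have A: "A b = (if holds P (G b) then None else G b)" for b by (simp add: A_def filt_Not_eq)
  have "A b \<noteq> None \<longleftrightarrow> b \<in> skew Y X" for b
    unfolding A skew_def using N hP by auto
  then have "dom A = skew Y X" by (force simp: dom_def)
  moreover have "A (r, c') \<le> A (r, c)" if "A (r, c) \<noteq> None" "A (r, c') \<noteq> None" "c < c'" for r c c'
    using that ssrct_row[OF ss, of r c c'] by (simp add: A split: if_splits)
  moreover have "A (r, 1) < A (s, 1)" if "r < s" "A (r, 1) \<noteq> None" "A (s, 1) \<noteq> None" for r s
    using that ssrct_first[OF ss, of r s] by (simp add: A split: if_splits)
  moreover have "(r, c + 1) \<in> inner Y X \<or> A (s, c + 1) < A (r, c + 1)"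
    if h: "r < s" "1 \<le> c" "A (s, c + 1) \<noteq> None" "(r, c) \<in> inner Y X \<or> A (s, c + 1) \<le> A (r, c)" for r s c
  proof -
    have As: "A (s, c + 1) = G (s, c + 1)" "\<not> holds P (G (s, c + 1))" "G (s, c + 1) \<noteq> None"
      using h(3) by (auto simp: A split: if_splits)
    \<comment> \<open>The empty box counts as inner although it carries no letter; lying in the last
      row, it is never the upper box of a triple.\<close>
    have "(r, c) \<noteq> (length Y, 1)"
    proof
      assume "(r, c) = (length Y, 1)"
      then have "(s, c + 1) \<notin> diag Y" using h(1) by (auto simp: diag_def)
      then show False using As(3) N by blast
    qed
    then have "holds P (G (r, c)) \<or> A (s, c + 1) \<le> A (r, c)" using h(4) hP by blast
    then have "G (s, c + 1) \<le> G (r, c)"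
    proof
      assume "holds P (G (r, c))"
      then show ?thesis using As(2) holds_mono[OF P] by (meson linear)
    next
      assume a: "A (s, c + 1) \<le> A (r, c)"
      then have "A (r, c) \<noteq> None" using h(3) by (cases "A (r, c)"; cases "A (s, c + 1)") auto
      then show ?thesis using a As(1) by (simp add: A split: if_splits)
    qed
    then have "G (s, c + 1) < G (r, c + 1)" using triple[OF h(1,2) As(3)] by blast
    then show ?thesis using As(1) hP by (simp add: A)
  qed
  ultimately show "ssrct Y X (filt (\<lambda>x. \<not> P x) G)" unfolding ssrct_iff A_def[symmetric] by blast
  define off where "off = length Y - length X"
  define B where "B = lastrows (length Y) (length X) (filt P G)"
  have B: "B (r, c) = (if 1 \<le> r \<and> holds P (G (r + off, c)) then G (r + off, c) else None)" for r c
    by (simp add: B_def lastrows_def filt_eq off_def)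
  have X1: "inner X [1] = {(length X, 1)}" by (rule inner_one[OF X(2)])
  have BN: "B (r, c) \<noteq> None \<longleftrightarrow> 1 \<le> r \<and> holds P (G (r + off, c))" for r c
    using hN[of "(r + off, c)"] by (auto simp: B)
  have "B (r, c) \<noteq> None \<longleftrightarrow> (r, c) \<in> skew X [1]" for r c
  proof -
    have "\<not> holds P (G (length Y, 1))" using N[of "(length Y, 1)"] hN by blast
    then have "holds P (G (r + off, c)) \<longleftrightarrow> (r + off, c) \<in> inner Y X \<and> (r + off, c) \<noteq> (length Y, 1)"
      using hP[of "(r + off, c)"] by metis
    moreover have "(r + off, c) \<in> inner Y X \<longleftrightarrow> (r, c) \<in> diag X"
      unfolding inner_iff[OF X(3)] off_def[symmetric] by (auto simp: diag_def)
    moreover have "r + off = length Y \<longleftrightarrow> r = length X" using X(3) unfolding off_def by linarith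
    moreover have "(r, c) \<in> diag X \<Longrightarrow> 1 \<le> r" by (simp add: diag_def)
    ultimately show ?thesis
      unfolding BN skew_def X1 Diff_iff singleton_iff prod.inject by blast
  qed
  then have "dom B = skew X [1]" by (force simp: dom_def)
  moreover have "B (r, c') \<le> B (r, c)" if "B (r, c) \<noteq> None" "B (r, c') \<noteq> None" "c < c'" for r c c'
    using that ssrct_row[OF ss, of "r + off" c c'] hN unfolding BN by (simp add: B)
  moreover have "B (r, 1) < B (s, 1)" if "r < s" "B (r, 1) \<noteq> None" "B (s, 1) \<noteq> None" for r s
    using that ssrct_first[OF ss, of "r + off" "s + off"] hN unfolding BN by (simp add: B)
  moreover have "B (s, c + 1) < B (r, c + 1)"
    if h: "r < s" "1 \<le> c" "B (s, c + 1) \<noteq> None" "(r, c) \<in> inner X [1] \<or> B (s, c + 1) \<le> B (r, c)" for r s c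
  proof -
    have s: "1 \<le> s" "holds P (G (s + off, c + 1))" using h(3) unfolding BN by auto
    have "(r, c) \<notin> inner X [1]"
    proof
      assume "(r, c) \<in> inner X [1]"
      then have "r = length X" unfolding X1 by simp
      then have "(s + off, c + 1) \<notin> diag Y" using h(1) X(3) by (auto simp: diag_def off_def)
      then show False using s(2) N hN by blast
    qed
    then have a: "B (s, c + 1) \<le> B (r, c)" using h(4) by blast
    then have "B (r, c) \<noteq> None" using h(3) by (cases "B (r, c)"; cases "B (s, c + 1)") auto
    then have r: "1 \<le> r" "holds P (G (r + off, c))" unfolding BN by auto
    have lt: "G (s + off, c + 1) < G (r + off, c + 1)"
      using a s r h hN by (intro triple) (simp_all add: B)
    then have "holds P (G (r + off, c + 1))" using holds_mono[OF P s(2)] by (meson less_imp_le)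
    then show ?thesis using lt s r by (simp add: B)
  qed
  ultimately show "ssrct X [1] (lastrows (length Y) (length X) (filt P G))"
    unfolding ssrct_iff B_def[symmetric] by blast
qed

section \<open>The backward slide\<close>

text \<open>An up-closed set cuts a final segment out of a sorted list. Applied both to the exits
  and to the parts of a partition.\<close>

lemma sorted_filter_nth:
  assumes "sorted H" "upclosed P" "k < length H"
  shows "P (H ! k) \<longleftrightarrow> length H - length (filter P H) \<le> k"
  using assms
proof (induction H arbitrary: k)
  case (Cons x H)
  show ?case
  proof (cases "P x")
    case True
    then have "\<forall>y\<in>set (x # H). P y" using Cons.prems by (auto simp: upclosed_def)
    moreover have "(x # H) ! k \<in> set (x # H)" using Cons.prems(3) by (rule nth_mem)
    moreover have "filter P (x # H) = x # H" using calculation(1) by (simp only: filter_id_conv)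
    ultimately have "P ((x # H) ! k)" "filter P (x # H) = x # H" by blast+
    then show ?thesis by (simp del: filter.simps)
  next
    case False
    then show ?thesis using Cons length_filter_le[of P H] by (cases k) (auto simp: Suc_diff_le)
  qed
qed simp

text \<open>The last row is written without sorting: column \<open>c\<close> takes the exit of
  column \<open>c - 1\<close>, which has index \<open>i - 1 - (c - 1)\<close> in \<open>H\<close>.
  This agrees with \<open>mu\<close> once \<open>H\<close> is known to be sorted.\<close>

definition slideout :: "nat \<Rightarrow> nat \<Rightarrow> 'a filling \<Rightarrow> 'a list \<Rightarrow> 'a filling" where
  "slideout i s \<tau> H = (\<lambda>(r, c). if r \<le> s then \<tau> (r, c)
     else if r = s + 1 \<and> 2 \<le> c \<and> c \<le> i then Some (H ! (i - c)) else None)"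

lemma mu_slideout:
  assumes "phiseq (i - 1) (\<alpha>, \<tau>) = ((\<gamma>, \<tau>'), H)" "sorted H" "length H = i - 1"
  shows "mu i \<alpha> \<tau> = (\<gamma> @ [i], slideout i (length \<gamma>) \<tau>' H)"
proof -
  have "rev (sort H) ! (c - 2) = H ! (i - c)" if "2 \<le> c" "c \<le> i" for c
    using that assms(2,3) by (simp add: rev_nth sorted_sort_id Suc_diff_Suc numeral_2_eq_2)
  then show ?thesis
    using assms(1) unfolding mu_def slideout_def by (auto simp: Let_def fun_eq_iff)
qed

text \<open>The exit of column \<open>c\<close> stands in column \<open>c + 1\<close> of the new
  row, so the triple rule between an old row and the new one is the exit rule. The new row decreases
  because the exits are sorted, and its empty first box leaves no condition on the first
  column.\<close>

lemma slideout_ssrct: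
  assumes ss: "ssrct \<alpha> [] \<tau>" and cp: "is_comp \<alpha>" and i: "1 \<le> i" "i - 1 = 0 \<or> i - 1 \<in> set \<alpha>"
    and ph: "phiseq (i - 1) (\<alpha>, \<tau>) = ((\<gamma>, \<tau>'), H)"
  shows "ssrct (\<gamma> @ [i]) [1] (slideout i (length \<gamma>) \<tau>' H)"
proof -
  note pp = phiseq_props[OF ss cp i(2) ph]
  have so: "sorted H" by (rule phiseq_sorted[OF ss cp i(2) ph])
  have len: "length H = i - 1" using pp by simp
  have d: "dom \<tau>' = diag \<gamma>" and s: "sct \<tau>'" using pp by (auto simp: ssrct_Nil_iff)
  have ex: "Some (H ! (i - (c + 1))) < \<tau>' (r, c + 1)"
    if "1 \<le> c" "c + 1 \<le> i" "Some (H ! (i - (c + 1))) \<le> \<tau>' (r, c)" for r c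
  proof -
    have "i - 1 - c = i - (c + 1)" by simp
    then show ?thesis
      using that pp[THEN conjunct2, THEN conjunct2, THEN conjunct2, THEN conjunct2, THEN conjunct1,
          rule_format, of c, THEN conjunct2, THEN conjunct2, rule_format, of r] by simp
  qed
  define n where "n = length \<gamma>"
  define G where "G = slideout i n \<tau>' H"
  have G: "G (r, c) = (if r \<le> n then \<tau>' (r, c)
     else if r = n + 1 \<and> 2 \<le> c \<and> c \<le> i then Some (H ! (i - c)) else None)" for r c
    by (simp add: G_def slideout_def)
  have N': "\<tau>' b \<noteq> None \<longleftrightarrow> b \<in> diag \<gamma>" for b using d by auto
  have I1: "b \<in> inner (\<gamma> @ [i]) [1] \<longleftrightarrow> b = (n + 1, 1)" for b
    using inner_one[of "\<gamma> @ [i]"] by (simp add: n_def)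
  have "G (r, c) \<noteq> None \<longleftrightarrow> (r, c) \<in> skew (\<gamma> @ [i]) [1]" for r c
  proof (cases "r \<le> n")
    case True
    then have "(r, c) \<in> diag (\<gamma> @ [i]) \<longleftrightarrow> (r, c) \<in> diag \<gamma>"
      by (auto simp: diag_def n_def nth_append)
    then show ?thesis using True N'[of "(r, c)"] unfolding skew_def Diff_iff I1 by (simp add: G)
  next
    case False
    then have "(r, c) \<in> diag (\<gamma> @ [i]) \<longleftrightarrow> r = n + 1 \<and> 1 \<le> c \<and> c \<le> i"
      by (auto simp: diag_def n_def nth_append)
    then show ?thesis using False unfolding skew_def Diff_iff I1 by (auto simp: G)
  qed
  then have "dom G = skew (\<gamma> @ [i]) [1]" by (force simp: dom_def)
  moreover have "G (r, c') \<le> G (r, c)" if h: "G (r, c) \<noteq> None" "G (r, c') \<noteq> None" "c < c'" for r c c'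
  proof (cases "r \<le> n")
    case True
    moreover have "1 \<le> c" using h(1) True N' by (auto simp: G diag_def)
    ultimately show ?thesis using sct_row_mono[OF s, of c c' r] h(3) by (simp add: G)
  next
    case False
    then have "2 \<le> c" "c' \<le> i" "r = n + 1" using h by (auto simp: G split: if_splits)
    moreover have "H ! (i - c') \<le> H ! (i - c)"
      using so len h(3) calculation by (intro sorted_nth_mono) auto
    ultimately show ?thesis using h(3) by (simp add: G)
  qed
  moreover have "G (r, 1) < G (q, 1)" if "r < q" "G (r, 1) \<noteq> None" "G (q, 1) \<noteq> None" for r q
    using that sct_first[OF s, of r q] by (simp add: G split: if_splits)
  moreover have "G (q, c + 1) < G (r, c + 1)"
    if h: "r < q" "1 \<le> c" "G (q, c + 1) \<noteq> None" "(r, c) \<in> inner (\<gamma> @ [i]) [1] \<or> G (q, c + 1) \<le> G (r, c)" for r q c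
  proof -
    have "q \<le> n + 1" using h(3) by (auto simp: G split: if_splits)
    then have r: "r \<le> n" "(r, c) \<notin> inner (\<gamma> @ [i]) [1]"
      using h(1) unfolding I1 by simp_all
    show ?thesis
    proof (cases "q \<le> n")
      case True
      then show ?thesis using h r sct_triple[OF s h(1,2)] by (simp add: G)
    next
      case False
      then have "c + 1 \<le> i" using h(3) by (auto simp: G split: if_splits)
      then show ?thesis using h r False ex[of c r] \<open>q \<le> n + 1\<close> by (simp add: G)
    qed
  qed
  ultimately show ?thesis unfolding ssrct_iff n_def[symmetric] G_def[symmetric] by blast
qed

text \<open>The large exits end \<open>H\<close>, hence begin the new row. The empty box in front of
  them accounts for the \<open>+ 1\<close> in the appended part.\<close>

lemma slideout_inner:
  assumes b: "barshape P \<gamma> \<tau>' \<beta>'" and so: "sorted H" and P: "upclosed P"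
    and len: "length H = i - 1" and i: "1 \<le> i" and d: "dom \<tau>' = diag \<gamma>"
  shows "{b. holds P (slideout i (length \<gamma>) \<tau>' H b)} \<union> {(length (\<gamma> @ [i]), 1)}
    = inner (\<gamma> @ [i]) (\<beta>' @ [length (filter P H) + 1])"
proof -
  define J where "J = length (filter P H)"
  define n where "n = length \<gamma>"
  have J: "J \<le> i - 1" using length_filter_le[of P H] len by (simp add: J_def)
  have lb: "length \<beta>' \<le> n" and hb: "\<And>b. holds P (\<tau>' b) \<longleftrightarrow> b \<in> inner \<gamma> \<beta>'"
    using b by (auto simp: barshape_def n_def)
  have l2: "length (\<beta>' @ [J + 1]) \<le> length (\<gamma> @ [i])" using lb by (simp add: n_def)
  have "holds P (slideout i n \<tau>' H (r, c)) \<or> (r, c) = (n + 1, 1) \<longleftrightarrow>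
      (r, c) \<in> inner (\<gamma> @ [i]) (\<beta>' @ [J + 1])" for r c
  proof -
    consider "r \<le> n" | "r = n + 1" | "n + 1 < r" by linarith
    then show ?thesis
    proof cases
      case 1
      then show ?thesis using hb[of "(r, c)"] lb unfolding inner_iff[OF l2]
        by (auto simp: slideout_def inner_def diag_def n_def nth_append)
    next
      case 2
      have eq: "slideout i n \<tau>' H (r, c) = (if 2 \<le> c \<and> c \<le> i then Some (H ! (i - c)) else None)"
        using 2 by (simp add: slideout_def)
      have "P (H ! (i - c)) \<longleftrightarrow> c \<le> J + 1" if "2 \<le> c" "c \<le> i"
      proof -
        have "i - c < length H" using that len by simp
        then show ?thesis using sorted_filter_nth[OF so P] that len J unfolding J_def[symmetric] by auto
      qed
      then have "holds P (slideout i n \<tau>' H (r, c)) \<longleftrightarrow> 2 \<le> c \<and> c \<le> J + 1"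
        using eq J i by auto
      moreover have "(r, c) \<in> inner (\<gamma> @ [i]) (\<beta>' @ [J + 1]) \<longleftrightarrow> 1 \<le> c \<and> c \<le> J + 1"
        using 2 lb unfolding inner_iff[OF l2] by (auto simp: diag_def n_def nth_append)
      ultimately show ?thesis using 2 by auto
    next
      case 3
      then show ?thesis by (auto simp: slideout_def inner_def n_def)
    qed
  qed
  then show ?thesis unfolding J_def n_def by auto
qed

section \<open>Independence of the large letters\<close>

text \<open>Identifying all letters of the second alphabet commutes with a slide: as long as the value
  carried upwards is small, the comparisons are unaffected, and once it is large, large entries
  are only exchanged among each other.\<close>

fun blur :: "letter \<Rightarrow> letter" where
  "blur (Unb n) = Unb n"
| "blur (Bar n) = Bar 0"

definition blurf :: "letter filling \<Rightarrow> letter filling" where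
  "blurf \<tau> b = map_option blur (\<tau> b)"

lemma less_letter_simps [simp]:
  "Unb a < Unb b \<longleftrightarrow> a < b" "Unb a < Bar b" "\<not> Bar a < Unb b" "Bar a < Bar b \<longleftrightarrow> a < b"
  by (auto simp: less_letter_def)

lemma letter_option_cases:
  obtains "u = None" | n where "u = Some (Unb n)" | n where "u = Some (Bar n)"
  by (metis letter.exhaust option.exhaust)

text \<open>The first equation concerns the next carried value, the second the entry left in the
  row.\<close>

lemma blur_step:
  fixes k u v :: "letter option"
  shows "(if map_option blur k < map_option blur u \<and> map_option blur v \<le> map_option blur k
      then map_option blur u else map_option blur k) = map_option blur (if k < u \<and> v \<le> k then u else k)"
    and "(if map_option blur k < map_option blur u \<and> map_option blur v \<le> map_option blur k
      then map_option blur k else map_option blur u) = map_option blur (if k < u \<and> v \<le> k then k else u)"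
  by (cases k rule: letter_option_cases; cases u rule: letter_option_cases;
      cases v rule: letter_option_cases; simp)+

lemma held_blur: "held (\<lambda>r. map_option blur (f r)) (\<lambda>r. map_option blur (g r)) r d
    = map_option blur (held f g r d)"
  by (induction d) (simp_all add: Let_def blur_step)

lemma slid_blur: "slid (\<lambda>r. map_option blur (f r)) (\<lambda>r. map_option blur (g r)) r q
    = map_option blur (slid f g r q)"
  unfolding slid_def scan_def held_blur
  using blur_step(2)[of "held f g r (r - 1 - q)" "f q" "g q"] by auto

text \<open>A blurred filling may repeat letters in a column and need not be a tableau, so the
  comparison goes through the scan. The tableau \<open>\<tau>\<close> guarantees that an entry
  exits, so that \<open>the\<close> commutes with \<open>blur\<close>.\<close>

lemma phi_blur:
  assumes "ssrct \<gamma> [] \<tau>" "1 \<le> t" "t \<in> set \<gamma>" "phi t (\<gamma>, \<tau>) = (\<gamma>', \<tau>', x)"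
  shows "phi t (\<gamma>, blurf \<tau>) = (\<gamma>', blurf \<tau>', blur x)"
proof -
  define f where "f = (\<lambda>r. \<tau> (r, t))"
  define g where "g = (\<lambda>r. \<tau> (r, t + 1))"
  define r1 where "r1 = lastrow t \<gamma>"
  note l = lastrow_props(1)[OF assms(3)]
  interpret column_slide f g "scan f g r1" r1
    using slide_column[of \<tau> \<gamma> t] assms by (simp add: f_def g_def r1_def ssrct_Nil_iff)
  have x0: "scan f g r1 0 \<noteq> None" using K_Some[of 0] r1_pos by simp
  have bf: "(\<lambda>r. blurf \<tau> (r, t)) = (\<lambda>r. map_option blur (f r))"
    and bg: "(\<lambda>r. blurf \<tau> (r, t + 1)) = (\<lambda>r. map_option blur (g r))"
    by (simp_all add: blurf_def f_def g_def)
  have "slidecol t r1 (blurf \<tau>) = blurf (slidecol t r1 \<tau>)"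
    unfolding slidecol_def bf bg f_def[symmetric] g_def[symmetric] slid_blur
    by (auto simp: blurf_def)
  moreover have "cutrow r1 (blurf \<sigma>) = blurf (cutrow r1 \<sigma>)" for \<sigma>
    by (auto simp: cutrow_def blurf_def)
  moreover have "the (scan (\<lambda>r. map_option blur (f r)) (\<lambda>r. map_option blur (g r)) r1 0) = blur (the (scan f g r1 0))"
    using x0 unfolding scan_def held_blur by (auto simp: option.map_sel)
  ultimately have "phi t (\<gamma>, blurf \<tau>) =
    (if t = 1 then take (r1 - 1) \<gamma> @ drop r1 \<gamma> else \<gamma>[r1 - 1 := t - 1],
     blurf (if t = 1 then cutrow r1 (slidecol t r1 \<tau>) else slidecol t r1 \<tau>), blur (the (scan f g r1 0)))"
    using phi_scan[OF l, of "blurf \<tau>"] unfolding bf bg r1_def[symmetric] by presburger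
  moreover have "phi t (\<gamma>, \<tau>) =
    (if t = 1 then take (r1 - 1) \<gamma> @ drop r1 \<gamma> else \<gamma>[r1 - 1 := t - 1],
     if t = 1 then cutrow r1 (slidecol t r1 \<tau>) else slidecol t r1 \<tau>, the (scan f g r1 0))"
    unfolding phi_scan[OF l, folded r1_def] f_def g_def by (rule refl)
  ultimately show ?thesis using assms(4) by (metis prod.inject)
qed

lemma phiseq_blur:
  assumes "ssrct \<gamma> [] \<tau>" "is_comp \<gamma>" "n = 0 \<or> n \<in> set \<gamma>" "phiseq n (\<gamma>, \<tau>) = ((\<gamma>', \<tau>'), H)"
  shows "phiseq n (\<gamma>, blurf \<tau>) = ((\<gamma>', blurf \<tau>'), map blur H)"
  using assms
proof (induction n arbitrary: \<gamma> \<tau> H)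
  case 0
  then show ?case by auto
next
  case (Suc n)
  obtain \<gamma>1 \<tau>1 x where p: "phi (Suc n) (\<gamma>, \<tau>) = (\<gamma>1, \<tau>1, x)" by (cases "phi (Suc n) (\<gamma>, \<tau>)") auto
  obtain H' where H': "phiseq n (\<gamma>1, \<tau>1) = ((\<gamma>', \<tau>'), H')" "H = x # H'"
    using Suc.prems(4) p by (auto split: prod.splits)
  have t: "1 \<le> Suc n" "Suc n \<in> set \<gamma>" using Suc.prems(3) by auto
  note st = phi_step[OF Suc.prems(1,2) t p]
  have n: "n = 0 \<or> n \<in> set \<gamma>1" using st(9) by (cases n) auto
  show ?case
    using Suc.IH[OF st(3,2) n H'(1)] phi_blur[OF Suc.prems(1) t p] H'(2) by simp
qed

text \<open>\<open>blur\<close> is weakly monotone, so the blurred exits are still sorted and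
  \<open>mu\<close> places them in the same order.\<close>

lemma mu_blur:
  assumes ss: "ssrct \<alpha> [] \<tau>" and cp: "is_comp \<alpha>" and i: "1 \<le> i" "i - 1 = 0 \<or> i - 1 \<in> set \<alpha>"
  shows "snd (mu i \<alpha> (blurf \<tau>)) = blurf (snd (mu i \<alpha> \<tau>))"
proof -
  obtain \<gamma> \<tau>' H where ph: "phiseq (i - 1) (\<alpha>, \<tau>) = ((\<gamma>, \<tau>'), H)"
    by (cases "phiseq (i - 1) (\<alpha>, \<tau>)") auto
  have so: "sorted H" by (rule phiseq_sorted[OF ss cp i(2) ph])
  have len: "length H = i - 1" using phiseq_props[OF ss cp i(2) ph] by simp
  have "blur x \<le> blur y" if "x \<le> y" for x y using that by (cases x; cases y) auto
  then have so': "sorted (map blur H)" using so by (simp add: sorted_map sorted_wrt_mono_rel[of H "(\<le>)"])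
  have "map blur H ! (i - c) = blur (H ! (i - c))" if "2 \<le> c" "c \<le> i" for c
    using that len by simp
  then have "slideout i (length \<gamma>) (blurf \<tau>') (map blur H) = blurf (slideout i (length \<gamma>) \<tau>' H)"
    by (auto simp: slideout_def blurf_def fun_eq_iff)
  then show ?thesis
    using mu_slideout[OF ph so len] mu_slideout[OF phiseq_blur[OF ss cp i(2) ph] so'] len by simp
qed

lemma filt_inA_blurf: "filt inA (blurf \<tau>) = filt inA \<tau>"
proof
  fix b
  have "inA (blur x) \<longleftrightarrow> inA x" "inA x \<Longrightarrow> blur x = x" for x by (cases x; auto simp: inA_def)+
  then show "filt inA (blurf \<tau>) b = filt inA \<tau> b"
    by (cases "\<tau> b") (auto simp: filt_def blurf_def)
qed

lemma blurf_combine: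
  assumes "length \<beta> \<le> length \<alpha>" "dom \<tau>1 = diag \<beta>" "dom \<tau>2 = diag \<beta>"
    "\<forall>x\<in>ran \<tau>1. inAbar x" "\<forall>x\<in>ran \<tau>2. inAbar x"
  shows "blurf (combine \<alpha> \<beta> \<tau>o \<tau>1) = blurf (combine \<alpha> \<beta> \<tau>o \<tau>2)"
proof
  fix b :: "nat \<times> nat"
  obtain r c where b: "b = (r, c)" by (cases b) auto
  have "map_option blur (\<tau>1 d) = map_option blur (\<tau>2 d)" if "d \<in> diag \<beta>" for d
  proof -
    have "d \<in> dom \<tau>1" "d \<in> dom \<tau>2" using that assms(2,3) by simp_all
    then obtain x y where xy: "\<tau>1 d = Some x" "\<tau>2 d = Some y" by auto
    then have "inAbar x" "inAbar y" using assms(4,5) by (auto intro: ranI)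
    then show ?thesis using xy by (auto simp: inAbar_def)
  qed
  then show "blurf (combine \<alpha> \<beta> \<tau>o \<tau>1) b = blurf (combine \<alpha> \<beta> \<tau>o \<tau>2) b"
    using inner_iff[OF assms(1), of r c] by (simp add: blurf_def combine_def b)
qed

section \<open>Comparison with jeu de taquin\<close>

declare jpath.simps [simp del]

text \<open>For \<open>t < i\<close>, \<open>a t\<close> is the row in which the path passes from
  column \<open>t + 1\<close> to column \<open>t\<close>; by \<open>go\<close> it descends in column
  \<open>t + 1\<close> until it gets there. In row \<open>1\<close> the move to the left is forced,
  hence the guard in \<open>stop\<close>. The start \<open>(p, q)\<close> is general so that the
  induction covers every position on the path.\<close>

lemma jpath_horizontal:
  fixes T :: "('a::linorder) filling" and a :: "nat \<Rightarrow> nat"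
  assumes le: "\<And>t. 1 \<le> t \<Longrightarrow> t < i \<Longrightarrow> 1 \<le> a t \<and> a t \<le> a (t + 1)"
    and stop: "\<And>t. 1 \<le> t \<Longrightarrow> t < i \<Longrightarrow> 1 < a t \<Longrightarrow> the (T (a t, t)) < the (T (a t - 1, t + 1))"
    and go: "\<And>t b. 1 \<le> t \<Longrightarrow> t < i \<Longrightarrow> a t < b \<Longrightarrow> b \<le> a (t + 1) \<Longrightarrow> \<not> the (T (b, t)) < the (T (b - 1, t + 1))"
    and "1 \<le> q" "q \<le> i" "1 \<le> p" "p \<le> a q" "q = 1 \<or> a (q - 1) \<le> p"
  shows "((x, b), (x, b + 1)) \<in> set (jpath T p q) \<longleftrightarrow> 1 \<le> b \<and> b < q \<and> x = a b"
  using assms(4-8)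
proof (induction "p + q" arbitrary: p q rule: less_induct)
  case less
  note q = less.prems(1,2) and p = less.prems(3,4,5)
  show ?case
  proof (cases "q = 1")
    case True
    show ?thesis
    proof (cases "p = 1")
      case True
      then show ?thesis using \<open>q = 1\<close> by (subst jpath.simps) auto
    next
      case False
      then have "jpath T p q = ((p - 1, q), (p, q)) # jpath T (p - 1) q"
        using p(1) True by (subst jpath.simps) simp
      moreover have "((x, b), (x, b + 1)) \<in> set (jpath T (p - 1) q) \<longleftrightarrow> 1 \<le> b \<and> b < q \<and> x = a b"
        using less.hyps[of "p - 1" q] True False p q by simp
      ultimately show ?thesis using p(1) False by auto
    qed
  next
    case False
    define t where "t = q - 1"
    have t: "q = t + 1" "1 \<le> t" "t < i" using False q by (auto simp: t_def)
    have pa: "a t \<le> p" using p(3) False by (simp add: t_def)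
    have horizontal: ?thesis if "jpath T p q = ((p, q - 1), (p, q)) # jpath T p (q - 1)" "p = a t"
    proof -
      have "((x, b), (x, b + 1)) \<in> set (jpath T p t) \<longleftrightarrow> 1 \<le> b \<and> b < t \<and> x = a b"
      proof (rule less.hyps)
        show "t = 1 \<or> a (t - 1) \<le> p" using le[of "t - 1"] t that(2) by (cases "t = 1") simp_all
      qed (use t p(1) that(2) in auto)
      then show ?thesis using that t by (cases "b = t") auto
    qed
    have vertical: ?thesis
      if "jpath T p q = ((p - 1, q), (p, q)) # jpath T (p - 1) q" "a t < p" "1 < p"
    proof -
      have "((x, b), (x, b + 1)) \<in> set (jpath T (p - 1) q) \<longleftrightarrow> 1 \<le> b \<and> b < q \<and> x = a b"
        by (rule less.hyps) (use q p that t_def in auto)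
      then show ?thesis using that by auto
    qed
    show ?thesis
    proof (cases "p = 1")
      case True
      then have "p = a t" using le[OF t(2,3)] pa by simp
      moreover have "jpath T p q = ((p, q - 1), (p, q)) # jpath T p (q - 1)"
        using True False q(1) by (subst jpath.simps) simp
      ultimately show ?thesis using horizontal by simp
    next
      case p1: False
      show ?thesis
      proof (cases "the (T (p, q - 1)) < the (T (p - 1, q))")
        case True
        then have "jpath T p q = ((p, q - 1), (p, q)) # jpath T p (q - 1)"
          using p1 False q(1) p(1) by (subst jpath.simps) simp
        moreover have "p = a t"
        proof (rule ccontr)
          assume "p \<noteq> a t"
          then have "\<not> the (T (p, t)) < the (T (p - 1, t + 1))" using pa p(2) t by (intro go) auto
          then show False using True t by simp
        qed
        ultimately show ?thesis using horizontal by simp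
      next
        case no: False
        then have "jpath T p q = ((p - 1, q), (p, q)) # jpath T (p - 1) q"
          using p1 False q(1) p(1) by (subst jpath.simps) simp
        moreover have "p \<noteq> a t" using stop[OF t(2,3)] no t p1 p(1) by auto
        ultimately show ?thesis using vertical pa p1 p(1) by simp
      qed
    qed
  qed
qed

text \<open>Translates comparisons of entries in the sorted columns into inequalities between
  counts.\<close>

lemma decreasing_nth_card:
  fixes xs :: "'a::linorder list"
  assumes "sorted (rev xs)" "distinct xs" "k < length xs"
  shows "y < xs ! k \<longleftrightarrow> k < card {z \<in> set xs. y < z}"
proof -
  define S where "S = {k. k < length xs \<and> y < xs ! k}"
  have dec: "xs ! l \<le> xs ! j" if "j \<le> l" "l < length xs" for j l
    using sorted_rev_nth_mono[OF assms(1) that] .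
  have "bij_betw (\<lambda>k. xs ! k) S {z \<in> set xs. y < z}"
    unfolding bij_betw_def S_def using assms(2)
    by (auto simp: inj_on_def nth_eq_iff_index_eq in_set_conv_nth image_def)
  then have c: "card {z \<in> set xs. y < z} = card S" using bij_betw_same_card by metis
  have fin: "finite S" by (simp add: S_def)
  have "k < card S" if "k \<in> S"
  proof -
    have "{..k} \<subseteq> S"
    proof
      fix j assume "j \<in> {..k}"
      then show "j \<in> S" using that dec[of j k] by (auto simp: S_def intro: less_le_trans)
    qed
    then show ?thesis using card_mono[OF fin, of "{..k}"] by simp
  qed
  moreover have "card S \<le> k" if "k \<notin> S"
  proof -
    have "S \<subseteq> {..<k}"
    proof
      fix j assume j: "j \<in> S"
      show "j \<in> {..<k}"
      proof (rule ccontr)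
        assume "j \<notin> {..<k}"
        then have "k \<in> S" using j dec[of k j] assms(3) by (auto simp: S_def intro: less_le_trans)
        then show False using that by simp
      qed
    qed
    then show ?thesis using card_mono[of "{..<k}" S] by simp
  qed
  ultimately show ?thesis using assms(3) c by (force simp: S_def)
qed

lemma decreasing_card_nth:
  fixes xs :: "'a::linorder list"
  assumes "sorted (rev xs)" "distinct xs" "k < length xs"
  shows "card {z \<in> set xs. xs ! k < z} = k"
proof -
  have "\<not> k < card {z \<in> set xs. xs ! k < z}" using decreasing_nth_card[OF assms, of "xs ! k"] by simp
  moreover have "k \<le> card {z \<in> set xs. xs ! k < z}"
  proof (cases k)
    case (Suc j)
    have "xs ! k \<le> xs ! j" using sorted_rev_nth_mono[OF assms(1), of j k] Suc assms(3) by simp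
    moreover have "xs ! k \<noteq> xs ! j" using nth_eq_iff_index_eq[OF assms(2)] Suc assms(3) by simp
    ultimately show ?thesis
      using decreasing_nth_card[OF assms(1,2), of j "xs ! k"] Suc assms(3)
      by (simp only: Suc_le_eq) (simp add: less_le)
  qed simp
  ultimately show ?thesis by simp
qed

section \<open>Sorted columns and addable nodes\<close>

definition collist :: "nat list \<Rightarrow> ('a::linorder) filling \<Rightarrow> nat \<Rightarrow> 'a list" where
  "collist \<alpha> \<tau> c = rev (sort [the (\<tau> (r, c)). r \<leftarrow> [1..<length \<alpha> + 1], (r, c) \<in> dom \<tau>])"

lemma rho_collist: "1 \<le> c \<Longrightarrow> 1 \<le> p \<Longrightarrow> p \<le> length (collist \<alpha> \<tau> c) \<Longrightarrow>
    rho \<alpha> \<tau> (p, c) = Some (collist \<alpha> \<tau> c ! (p - 1))"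
  by (simp add: rho_def collist_def Let_def)

lemma concat_if_singleton: "concat (map (\<lambda>r. if P r then [f r] else []) xs) = map f (filter P xs)"
  by (induction xs) simp_all

lemma collist_props:
  assumes s: "sct \<tau>" and d: "dom \<tau> = diag \<alpha>" and c: "1 \<le> c"
  shows "sorted (rev (collist \<alpha> \<tau> c))" "distinct (collist \<alpha> \<tau> c)" "set (collist \<alpha> \<tau> c) = col \<tau> c"
    "length (collist \<alpha> \<tau> c) = length (filter (\<lambda>x. c \<le> x) \<alpha>)"
proof -
  define R where "R = filter (\<lambda>r. (r, c) \<in> dom \<tau>) [1..<length \<alpha> + 1]"
  have cl: "collist \<alpha> \<tau> c = rev (sort (map (\<lambda>r. the (\<tau> (r, c))) R))"
    unfolding collist_def R_def concat_if_singleton by (rule refl)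
  have R: "set R = {r. (r, c) \<in> dom \<tau>}" using d by (auto simp: R_def diag_def)
  show "sorted (rev (collist \<alpha> \<tau> c))" by (simp add: cl)
  have inj: "inj_on (\<lambda>r. the (\<tau> (r, c))) (set R)"
    unfolding R using sct_column_inj[OF s c] by (force intro: inj_onI)
  moreover have "distinct R" by (simp add: R_def)
  ultimately show "distinct (collist \<alpha> \<tau> c)" by (simp add: cl distinct_map)
  show "set (collist \<alpha> \<tau> c) = col \<tau> c" unfolding cl col_def by (force simp: R)
  have "length R = card (set R)" using \<open>distinct R\<close> by (simp add: distinct_card)
  also have "set R = Suc ` {k. k < length \<alpha> \<and> c \<le> \<alpha> ! k}"
  proof (rule set_eqI)
    fix r
    show "r \<in> set R \<longleftrightarrow> r \<in> Suc ` {k. k < length \<alpha> \<and> c \<le> \<alpha> ! k}"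
      unfolding R d using c by (cases r) (auto simp: diag_def)
  qed
  also have "card \<dots> = length (filter (\<lambda>x. c \<le> x) \<alpha>)"
    by (simp add: card_image length_filter_conv_card)
  finally show "length (collist \<alpha> \<tau> c) = length (filter (\<lambda>x. c \<le> x) \<alpha>)" by (simp add: cl)
qed

text \<open>The parts \<open>\<ge> c\<close> form a final segment of \<open>sort \<alpha>\<close>,
  so after reversal they are the first rows.\<close>

lemma diag_psort: "1 \<le> c \<Longrightarrow> (r, c) \<in> diag (psort \<alpha>) \<longleftrightarrow> 1 \<le> r \<and> r \<le> length (filter (\<lambda>x. c \<le> x) \<alpha>)"
proof -
  assume c: "1 \<le> c"
  have len: "length (filter (\<lambda>x. c \<le> x) (sort \<alpha>)) = length (filter (\<lambda>x. c \<le> x) \<alpha>)"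
    by (metis filter_sort length_sort map_ident)
  show ?thesis
  proof (cases "1 \<le> r \<and> r \<le> length \<alpha>")
    case True
    have "length \<alpha> - Suc (r - 1) = length \<alpha> - r" "r - 1 < length \<alpha>" using True by linarith+
    then have "psort \<alpha> ! (r - 1) = sort \<alpha> ! (length \<alpha> - r)"
      by (simp only: psort_def rev_nth length_sort)
    moreover have "c \<le> sort \<alpha> ! (length \<alpha> - r) \<longleftrightarrow>
        length \<alpha> - length (filter (\<lambda>x. c \<le> x) \<alpha>) \<le> length \<alpha> - r"
    proof -
      have "upclosed (\<lambda>x. c \<le> x)" "length \<alpha> - r < length (sort \<alpha>)"
        using True by (auto simp: upclosed_def)
      then show ?thesis using sorted_filter_nth[of "sort \<alpha>" "\<lambda>x. c \<le> x" "length \<alpha> - r"] len by simp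
    qed
    moreover have "length \<alpha> - length (filter (\<lambda>x. c \<le> x) \<alpha>) \<le> length \<alpha> - r \<longleftrightarrow>
        r \<le> length (filter (\<lambda>x. c \<le> x) \<alpha>)"
      using True length_filter_le[of "\<lambda>x. c \<le> x" \<alpha>] by linarith
    ultimately show ?thesis
      using True c length_filter_le[of "\<lambda>x. c \<le> x" \<alpha>] by (auto simp: diag_def psort_def)
  next
    case False
    then have "\<not> (1 \<le> r \<and> r \<le> length (filter (\<lambda>x. c \<le> x) \<alpha>))"
      using length_filter_le[of "\<lambda>x. c \<le> x" \<alpha>] by linarith
    then show ?thesis using False by (auto simp: diag_def psort_def)
  qed
qed

text \<open>For \<open>i > 1\<close>, column \<open>i - 1\<close> has to be longer than column
  \<open>i\<close>, and the difference of the lengths counts the parts equal to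
  \<open>i - 1\<close>.\<close>

lemma addable_props:
  assumes "addable (diag (psort \<alpha>)) (p, i)"
  shows "1 \<le> i" "p = length (filter (\<lambda>x. i \<le> x) \<alpha>) + 1" "i - 1 = 0 \<or> i - 1 \<in> set \<alpha>"
    "2 \<le> i \<Longrightarrow> p \<le> length (filter (\<lambda>x. i - 1 \<le> x) \<alpha>)"
proof -
  show i: "1 \<le> i" using assms by (simp add: addable_def)
  have p: "1 \<le> p" "\<not> p \<le> length (filter (\<lambda>x. i \<le> x) \<alpha>)"
    "p = 1 \<or> p - 1 \<le> length (filter (\<lambda>x. i \<le> x) \<alpha>)"
    using assms diag_psort[OF i] by (auto simp: addable_def)
  then show p': "p = length (filter (\<lambda>x. i \<le> x) \<alpha>) + 1" by linarith
  show q: "p \<le> length (filter (\<lambda>x. i - 1 \<le> x) \<alpha>)" if "2 \<le> i"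
    using assms diag_psort[of "i - 1" p \<alpha>] that by (auto simp: addable_def)
  show "i - 1 = 0 \<or> i - 1 \<in> set \<alpha>"
  proof (rule ccontr)
    assume n: "\<not> (i - 1 = 0 \<or> i - 1 \<in> set \<alpha>)"
    then have "i - 1 \<le> x \<longleftrightarrow> i \<le> x" if "x \<in> set \<alpha>" for x using that by (cases "x = i - 1") auto
    then have "filter (\<lambda>x. i - 1 \<le> x) \<alpha> = filter (\<lambda>x. i \<le> x) \<alpha>" by (rule filter_cong[OF refl])
    then show False using q p' n by auto
  qed
qed

text \<open>The path enters column \<open>t\<close> in the row of the exit \<open>x t\<close> of the
  sorted column, so the entries moved horizontally are the exits. They grow weakly towards column
  \<open>1\<close>, so the large ones are those of an initial run of columns.\<close>

lemma jval_phiseq: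
  fixes \<tau> :: "letter filling"
  assumes ss: "ssrct \<alpha> [] \<tau>" and cp: "is_comp \<alpha>" and ad: "addable (diag (psort \<alpha>)) (p, i)"
    and ph: "phiseq (i - 1) (\<alpha>, \<tau>) = ((\<gamma>, \<tau>'), H)"
    and P: "upclosed P" "\<And>x. x \<in> ran \<tau> \<Longrightarrow> inAbar x \<longleftrightarrow> P x"
  shows "jval (rho \<alpha> \<tau>) p i = length (filter P H)"
proof -
  note ap = addable_props[OF ad]
  note pp = phiseq_props[OF ss cp ap(3) ph]
  have so: "sorted H" by (rule phiseq_sorted[OF ss cp ap(3) ph])
  have len: "length H = i - 1" using pp by simp
  have d: "dom \<tau> = diag \<alpha>" and s: "sct \<tau>" using ss by (auto simp: ssrct_Nil_iff)
  have fin: "finite (dom \<tau>)" using d by simp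
  have d': "finite (dom \<tau>')" and s': "sct \<tau>'" using pp by (auto simp: ssrct_Nil_iff)
  define x where "x t = H ! (i - 1 - t)" for t
  define T where "T = rho \<alpha> \<tau>"
  \<comment> \<open>The row of \<open>x t\<close> in the sorted column \<open>t\<close>, where
    exactly the larger entries lie below it. At \<open>i\<close> it is the row of the addable node,
    where the path starts.\<close>
  define a where "a t = (if t = i then p else cnt \<tau> t (x t) + 1)" for t
  have xp: "x t \<in> col \<tau> t" "col \<tau>' t = col \<tau> t - {x t}"
    "\<And>r. Some (x t) \<le> \<tau>' (r, t) \<Longrightarrow> Some (x t) < \<tau>' (r, t + 1)" if "1 \<le> t" "t < i" for t
    using pp[THEN conjunct2, THEN conjunct2, THEN conjunct2, THEN conjunct2, THEN conjunct1,
          rule_format, of t] that unfolding x_def by auto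
  have coli: "col \<tau>' i = col \<tau> i"
    using pp[THEN conjunct2, THEN conjunct2, THEN conjunct2, THEN conjunct2, THEN conjunct2, THEN conjunct1,
          rule_format, of i] ap(1) by simp
  have xmono: "x (t + 1) \<le> x t" if "1 \<le> t" "t + 1 < i" for t
    unfolding x_def using so len that by (intro sorted_nth_mono) auto
  have cnt': "cnt \<tau> t y = cnt \<tau>' t y + (if y < x t then 1 else 0)" if "1 \<le> t" "t < i" for t y
    using cnt_remove[OF finite_col[OF fin] xp(1,2)[OF that]] .
  have cnti: "cnt \<tau>' i y = cnt \<tau> i y" for y by (simp add: cnt_def coli)
  have cntle: "cnt \<tau>' (t + 1) y \<le> cnt \<tau> (t + 1) y" if "1 \<le> t" "t < i" for t y
    using cnt'[of "t + 1" y] cnti[of y] that by (cases "t + 1 = i") auto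
  define L where "L t = length (filter (\<lambda>x. t \<le> x) \<alpha>)" for t
  have xs: "sorted (rev (collist \<alpha> \<tau> t))" "distinct (collist \<alpha> \<tau> t)" "set (collist \<alpha> \<tau> t) = col \<tau> t"
    "length (collist \<alpha> \<tau> t) = L t" if "1 \<le> t" for t
    using collist_props[OF s d that] by (simp_all add: L_def)
  have cardL: "card (col \<tau> t) = L t" if "1 \<le> t" for t
    using distinct_card[OF xs(2)[OF that]] xs(3,4)[OF that] by simp
  have cntL: "cnt \<tau> t y \<le> L t" if "1 \<le> t" for t y
    unfolding cnt_def cardL[OF that, symmetric] by (intro card_mono finite_col[OF fin]) auto
  have Tval: "the (T (b, t)) = collist \<alpha> \<tau> t ! (b - 1)" if "1 \<le> t" "1 \<le> b" "b \<le> L t" for b t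
    using rho_collist[of t b \<alpha> \<tau>] that xs(4) by (simp add: T_def)
  have nth_less: "y < collist \<alpha> \<tau> t ! k \<longleftrightarrow> k < cnt \<tau> t y" if "1 \<le> t" "k < L t" for t k y
    using decreasing_nth_card[OF xs(1,2)[OF that(1)], of k y] that xs(3,4) by (simp add: cnt_def)
  have nth_cnt: "cnt \<tau> t (collist \<alpha> \<tau> t ! k) = k" if "1 \<le> t" "k < L t" for t k
    using decreasing_card_nth[OF xs(1,2)[OF that(1)], of k] that xs(3,4) by (simp add: cnt_def)
  have cnt_nth: "cnt \<tau> t y < L t \<and> collist \<alpha> \<tau> t ! cnt \<tau> t y = y" if "1 \<le> t" "y \<in> col \<tau> t" for t y
    using that nth_cnt[OF that(1)] xs(3,4)[OF that(1)] by (metis in_set_conv_nth)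
  have cnt_anti: "cnt \<tau> t y' \<le> cnt \<tau> t y" if "y \<le> y'" for t y y'
    unfolding cnt_def using that by (intro card_mono) (auto simp: finite_col[OF fin])
  have exit: "cnt \<tau> t (x t) \<le> cnt \<tau>' (t + 1) (x t)" if t: "1 \<le> t" "t < i" for t
    using cnt_exit[OF s' d' t(1), of "x t"] xp(3)[OF t] cnt'[OF t, of "x t"] by auto
  have LSuc: "L (t + 1) \<le> L t" for t
    unfolding L_def length_filter_conv_card by (intro card_mono) auto
  have aL: "a (t + 1) \<le> L t" "a (t + 1) \<le> L (t + 1) + 1" if t: "1 \<le> t" "t < i" for t
  proof -
    show "a (t + 1) \<le> L t"
    proof (cases "t + 1 = i")
      case True
      then have "2 \<le> i" "i - 1 = t" using t by auto
      then show ?thesis using ap(4) True by (simp add: a_def L_def)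
    next
      case False
      then show ?thesis using cnt_nth[of "t + 1" "x (t + 1)"] xp(1)[of "t + 1"] t LSuc[of t]
        by (simp add: a_def)
    qed
    show "a (t + 1) \<le> L (t + 1) + 1"
      using ap(2) cntL[of "t + 1" "x (t + 1)"] by (simp add: a_def L_def)
  qed
  have hor: "((z, b), (z, b + 1)) \<in> set (jpath T p i) \<longleftrightarrow> 1 \<le> b \<and> b < i \<and> z = a b" for z b
  proof (rule jpath_horizontal)
    fix t assume t: "1 \<le> t" "t < i"
    have at: "a t = cnt \<tau> t (x t) + 1" using t by (simp add: a_def)
    \<comment> \<open>This inequality, a consequence of the exit rule, yields both the order of the
      crossing rows and the stop in row \<open>a t\<close>.\<close>
    have up: "cnt \<tau> t (x t) \<le> cnt \<tau> (t + 1) (x t)" using exit[OF t] cntle[OF t] by (rule le_trans)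
    have "a t \<le> a (t + 1)"
    proof (cases "t + 1 = i")
      case True
      then show ?thesis using up cntL[of i "x t"] t ap(2) unfolding at by (simp add: a_def L_def)
    next
      case False
      then have "cnt \<tau> (t + 1) (x t) \<le> cnt \<tau> (t + 1) (x (t + 1))"
        using xmono[of t] t by (intro cnt_anti) simp
      then show ?thesis using up False unfolding at by (simp add: a_def)
    qed
    then show "1 \<le> a t \<and> a t \<le> a (t + 1)" by (simp add: at)
    have Ta: "the (T (a t, t)) = x t"
      using cnt_nth[OF t(1) xp(1)[OF t]] Tval[OF t(1), of "a t"] by (simp add: at)
    show "the (T (a t, t)) < the (T (a t - 1, t + 1))" if "1 < a t"
    proof -
      have k: "a t - 1 - 1 < cnt \<tau> (t + 1) (x t)" using up that by (simp add: at)
      moreover have kL: "a t - 1 - 1 < L (t + 1)" using k cntL[of "t + 1" "x t"] by simp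
      ultimately have "x t < collist \<alpha> \<tau> (t + 1) ! (a t - 1 - 1)" using nth_less by simp
      moreover have "the (T (a t - 1, t + 1)) = collist \<alpha> \<tau> (t + 1) ! (a t - 1 - 1)"
        by (rule Tval) (use that kL in auto)
      ultimately show ?thesis using Ta by simp
    qed
    \<comment> \<open>The entry \<open>y\<close> of row \<open>b\<close> is smaller than
      \<open>x t\<close>, so the slides lower its count from \<open>b - 1\<close> to
      \<open>b - 2\<close>. Column \<open>t + 1\<close> loses nothing above \<open>y\<close>, and
      the row condition after the slides bounds its count by \<open>b - 2\<close>. So the entry in
      row \<open>b - 1\<close> is at most \<open>y\<close>, and the path goes down, also in a
      tie.\<close>
    show "\<not> the (T (b, t)) < the (T (b - 1, t + 1))" if b: "a t < b" "b \<le> a (t + 1)" for b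
    proof -
      have bL: "b - 1 < L t" "b - 2 < L (t + 1)" "2 \<le> b" using b aL[OF t] unfolding at by auto
      define y where "y = collist \<alpha> \<tau> t ! (b - 1)"
      have y: "the (T (b, t)) = y" unfolding y_def by (rule Tval) (use t bL in auto)
      have cy: "cnt \<tau> t y = b - 1" unfolding y_def by (rule nth_cnt[OF t(1) bL(1)])
      have "\<not> x t \<le> y" using cnt_anti[of "x t" y t] cy b(1) at by auto
      then have "y < x t" by simp
      then have cy': "cnt \<tau>' t y = b - 2" using cnt'[OF t, of y] cy bL by simp
      have "cnt \<tau> (t + 1) y = cnt \<tau>' (t + 1) y"
      proof (cases "t + 1 = i")
        case True
        then show ?thesis using cnti by simp
      next
        case False
        then have t1: "1 \<le> t + 1" "t + 1 < i" using t by auto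
        \<comment> \<open>Otherwise \<open>x (t + 1)\<close> is among the at most
          \<open>b - 1\<close> entries above \<open>y\<close> in its column, so its row
          \<open>a (t + 1)\<close> would be less than \<open>b\<close>.\<close>
        have "\<not> y < x (t + 1)"
        proof
          assume lt: "y < x (t + 1)"
          have "cnt \<tau> (t + 1) (x (t + 1)) < cnt \<tau> (t + 1) y"
            unfolding cnt_def using lt xp(1)[OF t1] by (intro psubset_card_mono) (auto simp: finite_col[OF fin])
          also have "\<dots> \<le> b - 1" using cnt_Suc_le[OF s fin t(1), of y] cy by simp
          finally show False using b(2) False by (simp add: a_def)
        qed
        then show ?thesis using cnt'[OF t1, of y] by simp
      qed
      also have "\<dots> \<le> b - 2" using cnt_Suc_le[OF s' d' t(1), of y] cy' by simp
      finally have "\<not> y < collist \<alpha> \<tau> (t + 1) ! (b - 2)" using nth_less[of "t + 1" "b - 2" y] bL by simp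
      moreover have "the (T (b - 1, t + 1)) = collist \<alpha> \<tau> (t + 1) ! (b - 2)"
        using Tval[of "t + 1" "b - 1"] bL by (simp add: numeral_2_eq_2)
      ultimately show ?thesis using y by simp
    qed
  next
    show "i = 1 \<or> a (i - 1) \<le> p"
    proof (cases "i = 1")
      case False
      define t where "t = i - 1"
      have t: "1 \<le> t" "t < i" "t + 1 = i" using False ap(1) by (auto simp: t_def)
      have "cnt \<tau> t (x t) \<le> L i" using exit[OF t(1,2)] cntL[OF ap(1), of "x t"] cnti t(3) by simp
      then show ?thesis using ap(2) t by (simp add: a_def L_def t_def)
    qed simp
  qed (use ap in \<open>auto simp: a_def\<close>)
  have "(\<exists>z. ((z, b), (z, b + 1)) \<in> set (jpath T p i) \<and> inAbar (the (T (z, b)))) \<longleftrightarrow> b \<le> length (filter P H)"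
    if b: "1 \<le> b" "b \<le> i - 1" for b
  proof -
    have bi: "b < i" using b by simp
    have "the (T (a b, b)) = x b"
      using cnt_nth[OF b(1) xp(1)[OF b(1) bi]] Tval[OF b(1), of "a b"] bi by (simp add: a_def)
    moreover have "inAbar (x b) \<longleftrightarrow> P (x b)"
      using xp(1)[OF b(1) bi] by (intro P(2)) (auto simp: col_def ran_def)
    moreover have "P (x b) \<longleftrightarrow> b \<le> length (filter P H)"
    proof -
      have "i - 1 - b < length H" using len b by simp
      then have "P (x b) \<longleftrightarrow> i - 1 - length (filter P H) \<le> i - 1 - b"
        unfolding x_def using sorted_filter_nth[OF so P(1)] len by simp
      then show ?thesis using b length_filter_le[of P H] len by auto
    qed
    ultimately show ?thesis using hor b bi by auto
  qed
  then have *: "\<And>b. 1 \<le> b \<Longrightarrow> b \<le> i - 1 \<Longrightarrow>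
    (\<exists>z. ((z, b), (z, b + 1)) \<in> set (jpath T p i) \<and> inAbar (the (T (z, b)))) \<longleftrightarrow> b \<le> length (filter P H)" .
  have J: "length (filter P H) \<le> i - 1" using length_filter_le[of P H] len by simp
  have "{0} \<union> {b. 1 \<le> b \<and> b \<le> i - 1 \<and>
      (\<exists>z. ((z, b), (z, b + 1)) \<in> set (jpath T p i) \<and> inAbar (the (T (z, b))))} = {0..length (filter P H)}"
    (is "_ \<union> ?B = _")
  proof (rule set_eqI)
    fix b
    have "b \<in> ?B \<longleftrightarrow> 1 \<le> b \<and> b \<le> length (filter P H)"
      unfolding mem_Collect_eq using *[of b] J by (meson le_trans)
    then show "b \<in> {0} \<union> ?B \<longleftrightarrow> b \<in> {0..length (filter P H)}"
      unfolding Un_iff singleton_iff atLeastAtMost_iff by linarith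
  qed
  moreover have "Max {0..length (filter P H)} = length (filter P H)" by (intro Max_eqI) auto
  ultimately show ?thesis unfolding jval_def T_def[symmetric] by simp
qed

theorem theorem7p7:
  fixes \<alpha> \<beta> :: "nat list" and \<tau>o \<tau>bar :: "letter filling" and i p :: nat
  assumes "is_comp \<alpha>" and "is_comp \<beta>" and "leq_c \<beta> \<alpha>"
    and "ssrct \<alpha> \<beta> \<tau>o" and "\<forall>x\<in>ran \<tau>o. inA x"
    and "ssrct \<beta> [] \<tau>bar" and "\<forall>x\<in>ran \<tau>bar. inAbar x"
    and "1 \<le> i" and "addable (diag (psort \<alpha>)) (p, i)"
  shows "\<exists>X Y. uop (jval (rho \<alpha> (combine \<alpha> \<beta> \<tau>o \<tau>bar)) p i + 1) \<beta> = Some X \<and>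
           uop i \<alpha> = Some Y \<and>
           fst (mu i \<alpha> (combine \<alpha> \<beta> \<tau>o \<tau>bar)) = Y \<and>
           leq_c [1] X \<and> leq_c X Y \<and>
           {b. \<exists>x. snd (mu i \<alpha> (combine \<alpha> \<beta> \<tau>o \<tau>bar)) b = Some x \<and> inAbar x}
             \<union> {(length Y, 1)} = inner Y X \<and>
           ssrct X [1] (lastrows (length Y) (length X)
                          (filt inAbar (snd (mu i \<alpha> (combine \<alpha> \<beta> \<tau>o \<tau>bar))))) \<and>
           ssrct Y X (filt inA (snd (mu i \<alpha> (combine \<alpha> \<beta> \<tau>o \<tau>bar)))) \<and>
           (\<forall>\<tau>bar'. ssrct \<beta> [] \<tau>bar' \<and> (\<forall>x\<in>ran \<tau>bar'. inAbar x) \<longrightarrow>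
              filt inA (snd (mu i \<alpha> (combine \<alpha> \<beta> \<tau>o \<tau>bar'))) =
              filt inA (snd (mu i \<alpha> (combine \<alpha> \<beta> \<tau>o \<tau>bar))))"
proof -
  note \<alpha> = assms(1) and \<beta> = assms(2) and le = assms(3) and o = assms(4) and b = assms(6,7)
  \<comment> \<open>On the entries that occur, \<open>P\<close> agrees with \<open>inAbar\<close>
    and its negation with \<open>inA\<close>, so one up-closed predicate describes both
    filters.\<close>
  define P where "P x \<longleftrightarrow> (\<exists>n. x = Bar n)" for x
  have P: "upclosed P"
    unfolding upclosed_def P_def by (metis less_eq_letter.simps(3) letter.exhaust)
  have PA: "inA x \<Longrightarrow> \<not> P x" "inAbar x \<Longrightarrow> P x" for x by (auto simp: inA_def inAbar_def P_def)
  have oP: "\<forall>x\<in>ran \<tau>o. \<not> P x" using assms(5) PA by blast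
  have bP: "\<forall>x\<in>ran \<tau>b. P x" if "\<forall>x\<in>ran \<tau>b. inAbar x" for \<tau>b :: "letter filling" using that PA by blast
  define C where "C = combine \<alpha> \<beta> \<tau>o \<tau>bar"
  have C: "ssrct \<alpha> [] C" "barshape P \<alpha> C \<beta>"
    unfolding C_def by (rule combine_ssrct[OF \<beta> le o oP b(1) bP[OF b(2)] P])+
  have len: "length \<beta> \<le> length \<alpha>" using leq_c_inner[OF le] by simp
  note ap = addable_props[OF assms(9)]
  obtain \<gamma> \<tau>' H where ph: "phiseq (i - 1) (\<alpha>, C) = ((\<gamma>, \<tau>'), H)"
    by (cases "phiseq (i - 1) (\<alpha>, C)") auto
  note pp = phiseq_props[OF C(1) \<alpha> ap(3) ph]
  have so: "sorted H" by (rule phiseq_sorted[OF C(1) \<alpha> ap(3) ph])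
  have lenH: "length H = i - 1" using pp by simp
  have \<gamma>: "vop (i - 1) \<alpha> = Some \<gamma>" "is_comp \<gamma>" and d': "dom \<tau>' = diag \<gamma>"
    using pp by (simp_all add: ssrct_Nil_iff)
  define J where "J = length (filter P H)"
  obtain \<beta>' where \<beta>': "vop J \<beta> = Some \<beta>'" "barshape P \<gamma> \<tau>' \<beta>'"
    using phiseq_barshape[OF C(1) \<alpha> ap(3) ph P C(2) so] by (auto simp: J_def)
  define X where "X = \<beta>' @ [J + 1]"
  define Y where "Y = \<gamma> @ [i]"
  define G where "G = slideout i (length \<gamma>) \<tau>' H"
  have mu: "mu i \<alpha> C = (Y, G)" unfolding Y_def G_def by (rule mu_slideout[OF ph so lenH])
  have ranC: "inA x \<or> inAbar x" if "C e = Some x" for e x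
    using that assms(5) b(2) unfolding C_def combine_def
    by (cases e) (auto split: if_splits intro: ranI)
  have jv: "jval (rho \<alpha> C) p i = J"
    unfolding J_def
  proof (rule jval_phiseq[OF C(1) \<alpha> assms(9) ph P])
    fix x assume "x \<in> ran C"
    then show "inAbar x \<longleftrightarrow> P x" using ranC PA by (auto simp: ran_def)
  qed
  have colC: "inA x \<or> inAbar x" if "x \<in> col C c" for x c using that ranC by (auto simp: col_def)
  \<comment> \<open>Slides create no entries: every entry of \<open>G\<close> stems from
    \<open>C\<close>, through a kept column or as an exit, and so belongs to one of the two
    alphabets.\<close>
  have col': "col \<tau>' c \<subseteq> col C c" for c
    using pp[THEN conjunct2, THEN conjunct2, THEN conjunct2, THEN conjunct2, THEN conjunct1, rule_format, of c]
      pp[THEN conjunct2, THEN conjunct2, THEN conjunct2, THEN conjunct2, THEN conjunct2, THEN conjunct1, rule_format, of c]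
    by (cases "1 \<le> c \<and> c \<le> i - 1") auto
  have ranG: "inA x \<or> inAbar x" if "G (r, c) = Some x" for r c x
  proof (cases "r \<le> length \<gamma>")
    case True
    then have "x \<in> col \<tau>' c" using that by (auto simp: G_def slideout_def col_def)
    then show ?thesis using col' colC by blast
  next
    case False
    then have c: "2 \<le> c" "c \<le> i" "x = H ! (i - c)"
      using that by (auto simp: G_def slideout_def split: if_splits)
    have "i - 1 - (c - 1) = i - c" "1 \<le> c - 1" "c - 1 \<le> i - 1" using c by auto
    then have "x \<in> col C (c - 1)"
      using pp[THEN conjunct2, THEN conjunct2, THEN conjunct2, THEN conjunct2, THEN conjunct1,
          rule_format, of "c - 1"] c(3) by simp
    then show ?thesis using colC by blast
  qed
  then have ranG: "G e = Some x \<Longrightarrow> inA x \<or> inAbar x" for e x by (cases e) auto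
  have bar: "inAbar x \<longleftrightarrow> P x" "inA x \<longleftrightarrow> \<not> P x" if "G e = Some x" for e x
    using ranG[OF that] PA by blast+
  have fb: "filt inAbar G = filt P G" and fA: "filt inA G = filt (\<lambda>x. \<not> P x) G"
    using bar by (auto simp: filt_def fun_eq_iff split: option.splits)
  have ssG: "ssrct Y [1] G"
    unfolding Y_def G_def by (rule slideout_ssrct[OF C(1) \<alpha> assms(8) ap(3) ph])
  have bh: "{e. holds P (G e)} \<union> {(length Y, 1)} = inner Y X"
    unfolding Y_def G_def X_def J_def by (rule slideout_inner[OF \<beta>'(2) so P lenH assms(8) d'])
  have Xc: "is_comp X" "X \<noteq> []" "length X \<le> length Y"
    using \<beta>'(2) by (auto simp: X_def Y_def barshape_def is_comp_def)
  have Yc: "is_comp Y" using \<gamma>(2) assms(8) by (auto simp: Y_def is_comp_def)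
  note split = ssrct_split[OF ssG Xc P bh Yc]
  have "(length X, 1) \<in> diag X" using first_in_diag[OF Xc(1), of "length X"] Xc(2) by (simp add: Suc_le_eq)
  then have "inner X [1] \<subseteq> diag X" unfolding inner_one[OF Xc(2)] by simp
  moreover have "is_comp [1]" "length [1::nat] \<le> length X" using Xc(2) by (auto simp: is_comp_def Suc_le_eq)
  ultimately have X1: "leq_c [1] X" using ssrct_leq_c[OF Xc(1) _ _ _ split(2)] by blast
  have XY: "leq_c X Y" by (rule ssrct_leq_c[OF Yc Xc(1,3) split(3,1)])
  have u: "uop (J + 1) \<beta> = Some X" "uop i \<alpha> = Some Y" using \<beta>'(1) \<gamma>(1) by (simp_all add: uop_def X_def Y_def)
  \<comment> \<open>Blurring makes the choice of the inner tableau invisible, and the unbarred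
    entries can still be read off the blurred result.\<close>
  have indep: "filt inA (snd (mu i \<alpha> (combine \<alpha> \<beta> \<tau>o \<tau>bar'))) = filt inA (snd (mu i \<alpha> C))"
    if t: "ssrct \<beta> [] \<tau>bar'" "\<forall>x\<in>ran \<tau>bar'. inAbar x" for \<tau>bar'
  proof -
    define C' where "C' = combine \<alpha> \<beta> \<tau>o \<tau>bar'"
    have C': "ssrct \<alpha> [] C'" unfolding C'_def by (rule combine_ssrct[OF \<beta> le o oP t(1) bP[OF t(2)] P])
    have "blurf C' = blurf C"
      unfolding C_def C'_def
      using blurf_combine[OF len _ _ t(2) b(2)] t(1) b(1) by (simp add: ssrct_Nil_iff)
    then have "blurf (snd (mu i \<alpha> C')) = blurf (snd (mu i \<alpha> C))"
      using mu_blur[OF C' \<alpha> assms(8) ap(3)] mu_blur[OF C(1) \<alpha> assms(8) ap(3)] by simp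
    then show ?thesis unfolding C'_def by (metis filt_inA_blurf)
  qed
  have "{e. \<exists>x. G e = Some x \<and> inAbar x} = {e. holds P (G e)}" using bar by (auto simp: holds_def)
  then show ?thesis
    using u X1 XY bh split indep
    unfolding C_def[symmetric] jv mu fst_conv snd_conv fb fA by blast
qed

end
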